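(* Let $\mathcal{N}_{SU_N}\subseteq\Omega^1_u(\mathbf{C}_q[SU_N])$ be the sub-bimodule defining the calculus $\Omega^1_q(SU_N)$, let $\mathcal{N}_{S^{2N-1}}=\mathcal{N}_{SU_N}\cap\Omega^1_u(\mathbf{C}_q[S^{2N-1}])$ be the sub-bimodule defining its restriction to $\mathbf{C}_q[S^{2N-1}]$, and let $I_{S^{2N-1}}=I_{SU_N}\cap\mathbf{C}_q[S^{2N-1}]$. Then $$\big(\mathbf{C}_q[S^{2N-1}],\ \mathbf{C}[U_1],\ \mathcal{N}_{S^{2N-1}},\ \gamma_N(I_{S^{2N-1}})\big)$$ is a quantum principal bundle (with base $\mathbf{C}_q[\mathbf{C}P^{N-1}]$), where $\mathbf{C}_q[S^{2N-1}]$ carries the right $\mathbf{C}[U_1]$-coaction $(\mathrm{id}\otimes\gamma_N)\circ\Delta$.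
   Context: Algebras are unital over $\mathbf{C}$; Sweedler notation is used. Fix $N\ge 2$, $q\in(0,1]$, $\nu=q-q^{-1}$, and an $N$-th root $q^{1/N}$ of $q$. Let $H(x)=1$ for $x>0$ and $H(x)=0$ for $x\le 0$, and $R^{ik}_{jl}=q^{\delta_{ik}}\delta_{il}\delta_{kj}+\nu H(k-i)\delta_{ij}\delta_{kl}$. Quantum groups. For $n\ge1$, $\mathbf{C}_q[M_n]$ is the bialgebra generated by $u^i_j$ ($1\le i,j\le n$) with relations $\sum_{w,x}R^{ac}_{wx}u^w_bu^x_d=\sum_{y,z}R^{yz}_{bd}u^a_yu^c_z$, $\Delta(u^i_j)=\sum_k u^i_k\otimes u^k_j$, $\varepsilon(u^i_j)=\delta_{ij}$. The element $\det_n=\sum_{\pi\in S_n}(-q)^{\ell(\pi)}u^1_{\pi(1)}\cdots u^n_{\pi(n)}$ is central and grouplike. $\mathbf{C}_q[U_n]$ is the Hopf algebra obtained by adjoining $\det_n^{-1}$; $\mathbf{C}_q[SU_n]=\mathbf{C}_q[M_n]/\langle\det_n-1\rangle$; $\mathbf{C}[U_1]=\mathbf{C}[t,t^{-1}]$ with $t$ grouplike. Put $G=\mathbf{C}_q[SU_N]$, $G^+=\ker\varepsilon$. Spaces. $\beta_N:G\to\mathbf{C}_q[SU_{N-1}]$ is the Hopf algebra map with $\beta_N(u^1_1)=1$, $\beta_N(u^1_i)=\beta_N(u^i_1)=0$ ($i\neq1$), $\beta_N(u^i_j)=u^{i-1}_{j-1}$ ($i,j\ge2$); $\mathbf{C}_q[S^{2N-1}]\subseteq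 G$ is the algebra of coinvariants of $(\mathrm{id}\otimes\beta_N)\Delta$. $\gamma_N:G\to\mathbf{C}[U_1]$ is the Hopf algebra map with $\gamma_N(u^1_1)=t^{-1}$, $\gamma_N(u^k_k)=1$ for $2\le k\le N-1$, $\gamma_N(u^N_N)=t$, $\gamma_N(u^i_j)=0$ for $i\ne j$. The coaction $(\mathrm{id}\otimes\gamma_N)\Delta$ restricts to a $\mathbf{C}[U_1]$-coaction on $\mathbf{C}_q[S^{2N-1}]$, whose coinvariant subalgebra is $\mathbf{C}_q[\mathbf{C}P^{N-1}]$ (which equals the coinvariants in $G$ of $(\mathrm{id}\otimes\alpha_N)\Delta$, where $\alpha_N:G\to\mathbf{C}_q[U_{N-1}]$, $\alpha_N(u^1_1)=\det_{N-1}^{-1}$, $\alpha_N(u^1_i)=\alpha_N(u^i_1)=0$ for $i\ne1$, $\alpha_N(u^i_j)=u^{i-1}_{j-1}$ for $i,j\ge2$). The calculus. $G$ is coquasi-triangular with $r$ determined by $r(u^i_j\otimes u^k_l)=q^{-1/N}R^{ki}_{jl}$, $r(fg\otimes h)=r(f\otimes h_{(1)})r(g\otimes h_{(2)})$, $r(f\otimes gh)=r(f_{(1)}\otimes h)r(f_{(2)}\otimes g)$. Define $Q:G\to M_N(\mathbf{C})$ by $Q_{kl}(h)=\mathcal{Q}(h\otimes u^k_l)$, $\mathcal{Q}(h\otimes g)=r(g_{(1)}\otimes h_{(1)})r(h_{(2)}\otimes g_{(2)})$. Let $I_{SU_N}=(\ker Q\cap G^+)+\mathrm{span}\{u^i_1S(u^1_i):2\le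 i\le N\}+\mathrm{span}\{u^i_j:2\le i,j\le N,\ i\ne j\}$, a right ideal of $G^+$. For an algebra $A$, $\Omega^1_u(A)=\ker(m:A\otimes A\to A)$, $\mathrm{d}_ua=1\otimes a-a\otimes 1$. Then $\Omega^1_q(SU_N)=\Omega^1_u(G)/\mathcal{N}_{SU_N}$ with $\mathcal{N}_{SU_N}=s(G\otimes I_{SU_N})$, $s(a\otimes b)=aS(b_{(1)})\otimes b_{(2)}$. Quantum principal bundles. For a Hopf algebra $H$, $\mathrm{Ad}_R(h)=h_{(2)}\otimes S(h_{(1)})h_{(3)}$. For a right $H$-comodule algebra $P$ with coinvariants $M=P^H$ let $\mathrm{ver}(f\otimes g)=fg_{(0)}\otimes g_{(1)}$; $P$ is a Hopf–Galois extension of $M$ if $\mathrm{ver}:P\otimes_MP\to P\otimes H$ is an isomorphism. A quantum principal bundle is a tuple $(P,H,\mathcal{N},I_H)$ where $P$ is a Hopf–Galois extension of $M=P^H$ (the base), $\mathcal{N}\subseteq\Omega^1_u(P)$ is a sub-bimodule such that $\Omega^1_u(P)/\mathcal{N}$ is right $H$-covariant (i.e. $\mathcal{N}$ is stable under the coaction), $I_H\subseteq\ker\varepsilon_H$ is a right ideal with $\mathrm{Ad}_R(I_H)\subseteq I_H\otimes H$, and $\mathrm{ver}(\mathcal{N})=P\otimes I_H$ (with $\mathrm{ver}$ regarded on $\Omega^1_u(P)\subseteq P\otimes P$). *)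

theory Defs
  imports Complex_Main "HOL-Library.Poly_Mapping" "HOL-Combinatorics.Permutations"
begin

section \<open>Complex vector spaces and unital complex algebras\<close>

class complex_vector = ab_group_add +
  fixes scaleC :: "complex \<Rightarrow> 'a \<Rightarrow> 'a" (infixr \<open>*\<^sub>C\<close> 75)
  assumes scaleC_add_right: "a *\<^sub>C (x + y) = a *\<^sub>C x + a *\<^sub>C y"
    and scaleC_add_left: "(a + b) *\<^sub>C x = a *\<^sub>C x + b *\<^sub>C x"
    and scaleC_scaleC: "a *\<^sub>C (b *\<^sub>C x) = (a * b) *\<^sub>C x"
    and scaleC_one: "1 *\<^sub>C x = x"

class complex_algebra_1 = complex_vector + ring_1 +
  assumes mult_scaleC_left: "(a *\<^sub>C x) * y = a *\<^sub>C (x * y)"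
    and mult_scaleC_right: "x * (a *\<^sub>C y) = a *\<^sub>C (x * y)"

interpretation complex_vector: vector_space "scaleC :: complex \<Rightarrow> 'a \<Rightarrow> 'a::complex_vector"
  by unfold_locales (simp_all add: scaleC_add_right scaleC_add_left scaleC_scaleC scaleC_one)

abbreviation csubspace :: "'a::complex_vector set \<Rightarrow> bool"
  where "csubspace \<equiv> module.subspace scaleC"

abbreviation cspan :: "'a::complex_vector set \<Rightarrow> 'a set"
  where "cspan \<equiv> module.span scaleC"

abbreviation clinear :: "('a::complex_vector \<Rightarrow> 'b::complex_vector) \<Rightarrow> bool"
  where "clinear \<equiv> Vector_Spaces.linear scaleC scaleC"

definition cbilinear :: "('a::complex_vector \<Rightarrow> 'b::complex_vector \<Rightarrow> 'c::complex_vector) \<Rightarrow> bool"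
  where "cbilinear f \<longleftrightarrow> (\<forall>a. clinear (f a)) \<and> (\<forall>b. clinear (\<lambda>a. f a b))"

lemma clinearI:
  assumes "\<And>x y. f (x + y) = f x + f y" "\<And>c x. f (c *\<^sub>C x) = c *\<^sub>C f x"
  shows "clinear f"
  unfolding Vector_Spaces.linear_def module_hom_def module_hom_axioms_def
  by (intro conjI allI assms complex_vector.vector_space_axioms complex_vector.module_axioms)

lemma clinearD:
  assumes "clinear f"
  shows "f (x + y) = f x + f y" "f (c *\<^sub>C x) = c *\<^sub>C f x" "f 0 = 0" "f (x - y) = f x - f y"
    "f (sum g A) = (\<Sum>a\<in>A. f (g a))"
proof -
  interpret Vector_Spaces.linear scaleC scaleC f by fact
  show "f (x + y) = f x + f y" "f (c *\<^sub>C x) = c *\<^sub>C f x" "f 0 = 0" "f (x - y) = f x - f y"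
    "f (sum g A) = (\<Sum>a\<in>A. f (g a))"
    by (simp_all add: add scale diff sum)
qed

instantiation complex :: complex_algebra_1
begin
definition scaleC_complex_def: "scaleC a (x::complex) = a * x"
instance by standard (simp_all add: scaleC_complex_def algebra_simps)
end

instantiation poly_mapping :: (type, complex_vector) complex_vector
begin

definition scaleC_poly_mapping_def:
  "scaleC a (p :: 'a \<Rightarrow>\<^sub>0 'b) = Poly_Mapping.map (\<lambda>y. a *\<^sub>C y) p"

lemma lookup_scaleC: "Poly_Mapping.lookup (a *\<^sub>C (p :: 'a \<Rightarrow>\<^sub>0 'b)) k = a *\<^sub>C Poly_Mapping.lookup p k"
proof -
  have "a *\<^sub>C (0 :: 'b) = 0" by (rule complex_vector.scale_zero_right)
  then show ?thesis
    by (simp add: scaleC_poly_mapping_def Poly_Mapping.map.rep_eq when_def)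
qed

instance
  by standard
    (auto intro!: poly_mapping_eqI simp: lookup_scaleC lookup_add scaleC_add_right scaleC_add_left
      scaleC_scaleC scaleC_one)

end

lemma scaleC_single: "a *\<^sub>C Poly_Mapping.single k y = Poly_Mapping.single k (a *\<^sub>C y)"
  by (rule poly_mapping_eqI)
    (simp add: lookup_scaleC lookup_single when_def complex_vector.scale_zero_right)

lemma poly_mapping_add_induct [case_names zero single add]:
  fixes p :: "'k \<Rightarrow>\<^sub>0 'b::ab_group_add"
  assumes "P 0" "\<And>k y. P (Poly_Mapping.single k y)" "\<And>p q. P p \<Longrightarrow> P q \<Longrightarrow> P (p + q)"
  shows "P p"
proof (induction "card (Poly_Mapping.keys p)" arbitrary: p)
  case 0
  then show ?case using assms(1) by simp
next
  case (Suc n)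
  then obtain k where k: "k \<in> Poly_Mapping.keys p" by (metis card.empty nat.distinct(1) equals0I)
  let ?s = "Poly_Mapping.single k (Poly_Mapping.lookup p k)"
  have "Poly_Mapping.keys (p - ?s) = Poly_Mapping.keys p - {k}"
    by (auto simp: in_keys_iff lookup_minus lookup_single when_def split: if_splits)
  then have "n = card (Poly_Mapping.keys (p - ?s))" using Suc(2) k by simp
  from Suc(1)[OF this] have "P (p - ?s)" .
  from assms(3)[OF this assms(2)[of k "Poly_Mapping.lookup p k"]] show ?case by simp
qed

instance poly_mapping :: (monoid_add, complex_algebra_1) complex_algebra_1
proof
  fix a :: complex and x y :: "'a \<Rightarrow>\<^sub>0 'b"
  show "(a *\<^sub>C x) * y = a *\<^sub>C (x * y)"
  proof (induction x rule: poly_mapping_add_induct)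
    case (single k u)
    show ?case
      by (induction y rule: poly_mapping_add_induct)
        (simp_all add: scaleC_single mult_single mult_scaleC_left distrib_left scaleC_add_right
          complex_vector.scale_zero_right)
  qed (simp_all add: distrib_right scaleC_add_right complex_vector.scale_zero_right)
  show "x * (a *\<^sub>C y) = a *\<^sub>C (x * y)"
  proof (induction x rule: poly_mapping_add_induct)
    case (single k u)
    show ?case
      by (induction y rule: poly_mapping_add_induct)
        (simp_all add: scaleC_single mult_single mult_scaleC_right distrib_left scaleC_add_right
          complex_vector.scale_zero_right)
  qed (simp_all add: distrib_right scaleC_add_right complex_vector.scale_zero_right)
qed

text \<open>Linear extension of a map on basis elements.\<close>

definition linext :: "('k \<Rightarrow> 'v::complex_vector) \<Rightarrow> ('k \<Rightarrow>\<^sub>0 complex) \<Rightarrow> 'v"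
  where "linext f p = (\<Sum>k\<in>Poly_Mapping.keys p. Poly_Mapping.lookup p k *\<^sub>C f k)"

lemma linext_superset:
  assumes "finite A" "Poly_Mapping.keys p \<subseteq> A"
  shows "linext f p = (\<Sum>k\<in>A. Poly_Mapping.lookup p k *\<^sub>C f k)"
  unfolding linext_def
  by (rule sum.mono_neutral_left) (use assms in \<open>auto simp: in_keys_iff\<close>)

lemma linext_single [simp]: "linext f (Poly_Mapping.single k c) = c *\<^sub>C f k"
  by (subst linext_superset[of "{k}"]) (auto simp: lookup_single when_def split: if_splits)

lemma clinear_linext: "clinear (linext f)"
proof (rule clinearI)
  fix x y :: "'a \<Rightarrow>\<^sub>0 complex" and c
  let ?A = "Poly_Mapping.keys x \<union> Poly_Mapping.keys y"
  have "Poly_Mapping.keys (x + y) \<subseteq> ?A" by (rule Poly_Mapping.keys_add)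
  then have "linext f (x + y) = (\<Sum>k\<in>?A. Poly_Mapping.lookup (x + y) k *\<^sub>C f k)"
    by (intro linext_superset) auto
  also have "\<dots> = linext f x + linext f y"
    by (simp add: linext_superset[of ?A x] linext_superset[of ?A y] lookup_add scaleC_add_left
        sum.distrib)
  finally show "linext f (x + y) = linext f x + linext f y" .
  have "Poly_Mapping.keys (c *\<^sub>C x) \<subseteq> Poly_Mapping.keys x"
    by (auto simp: in_keys_iff lookup_scaleC scaleC_complex_def)
  then have "linext f (c *\<^sub>C x) =
      (\<Sum>k\<in>Poly_Mapping.keys x. Poly_Mapping.lookup (c *\<^sub>C x) k *\<^sub>C f k)"
    by (intro linext_superset) auto
  also have "\<dots> = c *\<^sub>C linext f x"
    by (simp add: linext_def lookup_scaleC scaleC_complex_def scaleC_scaleC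
        complex_vector.scale_sum_right)
  finally show "linext f (c *\<^sub>C x) = c *\<^sub>C linext f x" .
qed

section \<open>Tensor products over the complex numbers\<close>

definition tensor_rels :: "('a::complex_vector \<times> 'b::complex_vector \<Rightarrow>\<^sub>0 complex) set" where
  "tensor_rels =
     {Poly_Mapping.single (a + a', b) 1 - Poly_Mapping.single (a, b) 1
        - Poly_Mapping.single (a', b) 1 | a a' b. True} \<union>
     {Poly_Mapping.single (a, b + b') 1 - Poly_Mapping.single (a, b) 1
        - Poly_Mapping.single (a, b') 1 | a b b'. True} \<union>
     {Poly_Mapping.single (c *\<^sub>C a, b) 1 - c *\<^sub>C Poly_Mapping.single (a, b) 1 | c a b. True} \<union>
     {Poly_Mapping.single (a, c *\<^sub>C b) 1 - c *\<^sub>C Poly_Mapping.single (a, b) 1 | c a b. True}"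

definition tensor_eq ::
  "('a::complex_vector \<times> 'b::complex_vector \<Rightarrow>\<^sub>0 complex) \<Rightarrow> ('a \<times> 'b \<Rightarrow>\<^sub>0 complex) \<Rightarrow> bool"
  where "tensor_eq x y \<longleftrightarrow> x - y \<in> cspan tensor_rels"

lemma equivp_tensor_eq:
  "equivp (tensor_eq :: ('a::complex_vector \<times> 'b::complex_vector \<Rightarrow>\<^sub>0 complex) \<Rightarrow> _ \<Rightarrow> bool)"
  (is "equivp ?E")
proof (rule equivpI)
  show "reflp ?E"
    by (auto simp: reflp_def tensor_eq_def complex_vector.span_zero)
  show "symp ?E"
  proof (rule sympI)
    fix x y :: "'a \<times> 'b \<Rightarrow>\<^sub>0 complex"
    assume "tensor_eq x y"
    then have "- (x - y) \<in> cspan tensor_rels"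
      unfolding tensor_eq_def by (rule complex_vector.span_neg)
    then show "tensor_eq y x" by (simp add: tensor_eq_def)
  qed
  show "transp ?E"
  proof (rule transpI)
    fix x y z :: "'a \<times> 'b \<Rightarrow>\<^sub>0 complex"
    assume "tensor_eq x y" "tensor_eq y z"
    then have "(x - y) + (y - z) \<in> cspan tensor_rels"
      unfolding tensor_eq_def by (rule complex_vector.span_add)
    then show "tensor_eq x z" by (simp add: tensor_eq_def)
  qed
qed

quotient_type (overloaded) ('a, 'b) tensor =
  "('a::complex_vector \<times> 'b::complex_vector) \<Rightarrow>\<^sub>0 complex" / tensor_eq
  by (rule equivp_tensor_eq)

instantiation tensor :: (complex_vector, complex_vector) complex_vector
begin

lift_definition zero_tensor :: "('a, 'b) tensor" is 0 .

lift_definition plus_tensor :: "('a, 'b) tensor \<Rightarrow> ('a, 'b) tensor \<Rightarrow> ('a, 'b) tensor" is "(+)"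
proof -
  fix a b c d :: "'a \<times> 'b \<Rightarrow>\<^sub>0 complex"
  assume "tensor_eq a b" "tensor_eq c d"
  then have "(a - b) + (c - d) \<in> cspan tensor_rels"
    unfolding tensor_eq_def by (rule complex_vector.span_add)
  then show "tensor_eq (a + c) (b + d)" by (simp add: tensor_eq_def add_diff_add)
qed

lift_definition uminus_tensor :: "('a, 'b) tensor \<Rightarrow> ('a, 'b) tensor" is uminus
proof -
  fix a b :: "'a \<times> 'b \<Rightarrow>\<^sub>0 complex"
  assume "tensor_eq a b"
  then have "- (a - b) \<in> cspan tensor_rels"
    unfolding tensor_eq_def by (rule complex_vector.span_neg)
  then show "tensor_eq (- a) (- b)" by (simp add: tensor_eq_def)
qed

lift_definition minus_tensor :: "('a, 'b) tensor \<Rightarrow> ('a, 'b) tensor \<Rightarrow> ('a, 'b) tensor" is "(-)"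
proof -
  fix a b c d :: "'a \<times> 'b \<Rightarrow>\<^sub>0 complex"
  assume "tensor_eq a b" "tensor_eq c d"
  then have "(a - b) - (c - d) \<in> cspan tensor_rels"
    unfolding tensor_eq_def by (rule complex_vector.span_diff)
  then show "tensor_eq (a - c) (b - d)" by (simp add: tensor_eq_def algebra_simps)
qed

lift_definition scaleC_tensor :: "complex \<Rightarrow> ('a, 'b) tensor \<Rightarrow> ('a, 'b) tensor" is scaleC
proof -
  fix k and a b :: "'a \<times> 'b \<Rightarrow>\<^sub>0 complex"
  assume "tensor_eq a b"
  then have "k *\<^sub>C (a - b) \<in> cspan tensor_rels"
    unfolding tensor_eq_def by (rule complex_vector.span_scale)
  then show "tensor_eq (k *\<^sub>C a) (k *\<^sub>C b)"
    by (simp add: tensor_eq_def complex_vector.scale_right_diff_distrib)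
qed

lemma tensor_eq_refl: "tensor_eq x x"
  by (simp add: tensor_eq_def complex_vector.span_zero)

instance
  by standard
    (transfer, simp add: tensor_eq_refl algebra_simps scaleC_add_right scaleC_add_left
      scaleC_scaleC scaleC_one)+

end

lift_definition tpure ::
  "'a::complex_vector \<Rightarrow> 'b::complex_vector \<Rightarrow> ('a, 'b) tensor" (infixr \<open>\<otimes>\<^sub>t\<close> 72)
  is "\<lambda>a b. Poly_Mapping.single (a, b) 1" .

text \<open>
  \<open>tlift f\<close> is the linear map on the tensor product that a bilinear map \<open>f\<close> induces; the value does
  not depend on the representative chosen by \<open>rep_tensor\<close> (lemma \<open>tlift_tpure\<close> below).  In Sweedler
  notation, \<open>tlift f (\<Delta> x)\<close> is \<open>f x\<^sub>(\<^sub>1\<^sub>) x\<^sub>(\<^sub>2\<^sub>)\<close>.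
\<close>

definition tlift ::
  "('a::complex_vector \<Rightarrow> 'b::complex_vector \<Rightarrow> 'c::complex_vector) \<Rightarrow> ('a, 'b) tensor \<Rightarrow> 'c"
  where "tlift f t = linext (\<lambda>(a, b). f a b) (rep_tensor t)"

lemma tlift_abs:
  assumes "cbilinear f"
  shows "tlift f (abs_tensor p) = linext (\<lambda>(a, b). f a b) p"
proof -
  let ?L = "linext (\<lambda>(a, b). f a b)"
  have l1: "clinear (f a)" and l2: "clinear (\<lambda>a. f a b)" for a b
    using assms by (auto simp: cbilinear_def)
  have zero: "?L x = 0" if "x \<in> cspan tensor_rels" for x
    using that
  proof (induction rule: complex_vector.span_induct_alt)
    case base
    show ?case by (rule clinearD(3)[OF clinear_linext])
  next
    case (step c x y)
    have "?L x = 0"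
      using step(1) clinearD(1,2)[OF l1] clinearD(1,2)[OF l2]
      unfolding tensor_rels_def
      by (auto simp: clinearD[OF clinear_linext] scaleC_one)
    with step(2) show ?case
      by (simp add: clinearD[OF clinear_linext] complex_vector.scale_zero_right)
  qed
  have "tensor_eq (rep_tensor (abs_tensor p)) p"
    by (rule Quotient_rep_abs[OF Quotient_tensor]) (rule tensor_eq_refl)
  then have "?L (rep_tensor (abs_tensor p) - p) = 0" by (intro zero) (simp add: tensor_eq_def)
  then show ?thesis by (simp add: tlift_def clinearD(4)[OF clinear_linext])
qed

lemma tlift_tpure: "cbilinear f \<Longrightarrow> tlift f (a \<otimes>\<^sub>t b) = f a b"
  unfolding tpure.abs_eq by (simp add: tlift_abs scaleC_one)

lemma clinear_tlift:
  assumes "cbilinear f"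
  shows "clinear (tlift f)"
proof (rule clinearI)
  fix x y :: "('a, 'b) tensor" and c
  obtain p q where [simp]: "x = abs_tensor p" "y = abs_tensor q"
    by (metis Quotient_abs_rep[OF Quotient_tensor])
  show "tlift f (x + y) = tlift f x + tlift f y"
    by (simp add: plus_tensor.abs_eq tlift_abs[OF assms] clinearD[OF clinear_linext])
  show "tlift f (c *\<^sub>C x) = c *\<^sub>C tlift f x"
    by (simp add: scaleC_tensor.abs_eq tlift_abs[OF assms] clinearD[OF clinear_linext])
qed

lemma tpure_add_left: "(a + a') \<otimes>\<^sub>t b = a \<otimes>\<^sub>t b + a' \<otimes>\<^sub>t b"
  and tpure_add_right: "a \<otimes>\<^sub>t (b + b') = a \<otimes>\<^sub>t b + a \<otimes>\<^sub>t b'"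
  and tpure_scale_left: "(c *\<^sub>C a) \<otimes>\<^sub>t b = c *\<^sub>C (a \<otimes>\<^sub>t b)"
  and tpure_scale_right: "a \<otimes>\<^sub>t (c *\<^sub>C b) = c *\<^sub>C (a \<otimes>\<^sub>t b)"
  by (transfer, unfold tensor_eq_def, rule complex_vector.span_base, unfold tensor_rels_def,
      simp only: Un_iff mem_Collect_eq diff_diff_eq[symmetric], blast)+

lemma cbilinear_tpure: "cbilinear (\<otimes>\<^sub>t)"
  unfolding cbilinear_def
  by (auto intro!: clinearI simp: tpure_add_left tpure_add_right tpure_scale_left tpure_scale_right)

lemma tensor_induct [case_names pure add]:
  assumes "\<And>a b. P (a \<otimes>\<^sub>t b)" "\<And>x y. P x \<Longrightarrow> P y \<Longrightarrow> P (x + y)"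
  shows "P t"
proof -
  have "P (abs_tensor p)" for p
  proof (induction p rule: poly_mapping_add_induct)
    case zero
    have "(0 \<otimes>\<^sub>t 0 :: ('a, 'b) tensor) = 0"
      using tpure_scale_left[of 0 0 0] by (simp add: complex_vector.scale_zero_left)
    then show ?case using assms(1)[of 0 0] by (simp add: zero_tensor.abs_eq)
  next
    case (single k c)
    obtain a b where k: "k = (a, b)" by force
    have "abs_tensor (Poly_Mapping.single k c) = c *\<^sub>C (a \<otimes>\<^sub>t b)"
      by (simp add: k tpure.abs_eq scaleC_tensor.abs_eq scaleC_single scaleC_complex_def)
    then show ?case using assms(1)[of "c *\<^sub>C a" b] by (simp add: tpure_scale_left)
  next
    case (add p q)
    then show ?case using assms(2) by (simp add: plus_tensor.abs_eq[symmetric])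
  qed
  then show ?thesis by (metis Quotient_abs_rep[OF Quotient_tensor])
qed

lemma clinear_compose: "clinear f \<Longrightarrow> clinear g \<Longrightarrow> clinear (\<lambda>x. g (f x))"
  by (rule clinearI) (simp_all add: clinearD)

lemma clinear_add: "clinear f \<Longrightarrow> clinear g \<Longrightarrow> clinear (\<lambda>x. f x + g x)"
  by (rule clinearI) (simp_all add: clinearD scaleC_add_right)

lemma clinear_tensor_eqI:
  assumes "clinear f" "clinear g" "\<And>a b. f (a \<otimes>\<^sub>t b) = g (a \<otimes>\<^sub>t b)"
  shows "f t = g t"
  by (induction t rule: tensor_induct) (simp_all add: assms clinearD)

text \<open>The algebra structure is determined by \<open>(a \<otimes> b)(c \<otimes> d) = ac \<otimes> bd\<close>.\<close>

instantiation tensor :: (complex_algebra_1, complex_algebra_1) "{one, times}"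
begin

definition one_tensor_def: "1 = (1 \<otimes>\<^sub>t 1 :: ('a, 'b) tensor)"

definition times_tensor_def:
  "(x :: ('a, 'b) tensor) * y = tlift (\<lambda>a b. tlift (\<lambda>c d. (a * c) \<otimes>\<^sub>t (b * d)) y) x"

instance ..

end

lemma cbilinear_mult_tensor_aux:
  fixes a :: "'a::complex_algebra_1" and b :: "'b::complex_algebra_1"
  shows "cbilinear (\<lambda>c d. (a * c) \<otimes>\<^sub>t (b * d))"
  unfolding cbilinear_def
  by (auto intro!: clinearI simp: distrib_left mult_scaleC_right tpure_add_left tpure_add_right
      tpure_scale_left tpure_scale_right)

lemma cbilinear_mult_tensor_aux2:
  fixes y :: "('a::complex_algebra_1, 'b::complex_algebra_1) tensor"
  shows "cbilinear (\<lambda>a b. tlift (\<lambda>c d. (a * c) \<otimes>\<^sub>t (b * d)) y)"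
proof -
  define F where "F a b = tlift (\<lambda>c d. (a * c) \<otimes>\<^sub>t (b * d))" for a :: 'a and b :: 'b
  have l: "clinear (F a b)" for a b
    unfolding F_def by (rule clinear_tlift[OF cbilinear_mult_tensor_aux])
  have p: "F a b (c \<otimes>\<^sub>t d) = (a * c) \<otimes>\<^sub>t (b * d)" for a b c d
    unfolding F_def by (rule tlift_tpure[OF cbilinear_mult_tensor_aux])
  have "cbilinear (\<lambda>a b. F a b y)"
    unfolding cbilinear_def
  proof (intro conjI allI clinearI)
    fix a a' :: 'a and b b' :: 'b and k :: complex
    show "F a (b + b') y = F a b y + F a b' y"
      by (induction y rule: tensor_induct)
        (simp_all add: clinearD[OF l] p distrib_right tpure_add_right)
    show "F (a + a') b y = F a b y + F a' b y"
      by (induction y rule: tensor_induct)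
        (simp_all add: clinearD[OF l] p distrib_right tpure_add_left)
    show "F a (k *\<^sub>C b) y = k *\<^sub>C F a b y"
      by (induction y rule: tensor_induct)
        (simp_all add: clinearD[OF l] p mult_scaleC_left tpure_scale_right scaleC_add_right)
    show "F (k *\<^sub>C a) b y = k *\<^sub>C F a b y"
      by (induction y rule: tensor_induct)
        (simp_all add: clinearD[OF l] p mult_scaleC_left tpure_scale_left scaleC_add_right)
  qed
  then show ?thesis by (simp add: F_def)
qed

lemma tensor_mult_pure: "(a \<otimes>\<^sub>t b) * (c \<otimes>\<^sub>t d) = (a * c) \<otimes>\<^sub>t (b * d)"
  unfolding times_tensor_def tlift_tpure[OF cbilinear_mult_tensor_aux2]
  by (rule tlift_tpure[OF cbilinear_mult_tensor_aux])

lemma tensor_mult_linear_left: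
  fixes y :: "('a::complex_algebra_1, 'b::complex_algebra_1) tensor"
  shows "clinear (\<lambda>x. x * y)"
  unfolding times_tensor_def by (rule clinear_tlift[OF cbilinear_mult_tensor_aux2])

lemma tensor_mult_linear_right:
  fixes x :: "('a::complex_algebra_1, 'b::complex_algebra_1) tensor"
  shows "clinear (\<lambda>y. x * y)"
proof (induction x rule: tensor_induct)
  case (pure a b)
  show ?case
    by (simp add: times_tensor_def tlift_tpure[OF cbilinear_mult_tensor_aux2]
        clinear_tlift[OF cbilinear_mult_tensor_aux])
next
  case (add x x')
  then show ?case
    by (simp add: clinearD(1)[OF tensor_mult_linear_left] clinear_add)
qed

lemma ex_functional_one: "\<exists>f :: 'a::complex_algebra_1 \<Rightarrow> complex. clinear f \<and> f 1 = 1"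
proof -
  interpret vector_space_pair "scaleC :: complex \<Rightarrow> 'a \<Rightarrow> 'a" "scaleC :: complex \<Rightarrow> complex \<Rightarrow> complex"
    ..
  have "\<not> complex_vector.dependent {1::'a}"
    by (simp add: complex_vector.dependent_single)
  from linear_independent_extend[OF this, of "\<lambda>_. 1"] show ?thesis by auto
qed

instance tensor :: (complex_algebra_1, complex_algebra_1) complex_algebra_1
proof
  fix x y z :: "('a, 'b) tensor" and k :: complex
  note L = clinearD[OF tensor_mult_linear_left] and R = clinearD[OF tensor_mult_linear_right]
  show "(x + y) * z = x * z + y * z" by (rule L(1))
  show "x * (y + z) = x * y + x * z" by (rule R(1))
  show "(k *\<^sub>C x) * y = k *\<^sub>C (x * y)" by (rule L(2))
  show "x * (k *\<^sub>C y) = k *\<^sub>C (x * y)" by (rule R(2))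
  show "1 * x = x" "x * 1 = x"
    by (induction x rule: tensor_induct) (simp_all add: one_tensor_def tensor_mult_pure L R)
  show "(x * y) * z = x * (y * z)"
  proof (induction x rule: tensor_induct)
    case x: (pure a b)
    show ?case
    proof (induction y rule: tensor_induct)
      case y: (pure c d)
      show ?case
        by (induction z rule: tensor_induct) (simp_all add: tensor_mult_pure R mult.assoc)
    qed (simp_all add: L R)
  qed (simp_all add: L)
  obtain f :: "'a \<Rightarrow> complex" where f: "clinear f" "f 1 = 1" using ex_functional_one by blast
  obtain g :: "'b \<Rightarrow> complex" where g: "clinear g" "g 1 = 1" using ex_functional_one by blast
  have b: "cbilinear (\<lambda>a b. f a * g b)"
    unfolding cbilinear_def
    by (auto intro!: clinearI simp: clinearD(1,2)[OF f(1)] clinearD(1,2)[OF g(1)]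
        scaleC_complex_def algebra_simps)
  have "tlift (\<lambda>a b. f a * g b) (1 \<otimes>\<^sub>t 1) = 1"
    by (simp add: tlift_tpure[OF b] f g)
  then show "0 \<noteq> (1 :: ('a, 'b) tensor)"
    unfolding one_tensor_def using clinearD(3)[OF clinear_tlift[OF b]] by force
qed

definition tmap ::
  "('a::complex_vector \<Rightarrow> 'c::complex_vector) \<Rightarrow> ('b::complex_vector \<Rightarrow> 'd::complex_vector) \<Rightarrow>
    ('a, 'b) tensor \<Rightarrow> ('c, 'd) tensor"
  where "tmap f g = tlift (\<lambda>a b. f a \<otimes>\<^sub>t g b)"

definition tassoc ::
  "(('a::complex_vector, 'b::complex_vector) tensor, 'c::complex_vector) tensor \<Rightarrow>
    ('a, ('b, 'c) tensor) tensor"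
  where "tassoc = tlift (\<lambda>x c. tlift (\<lambda>a b. a \<otimes>\<^sub>t b \<otimes>\<^sub>t c) x)"

text \<open>For subspaces \<open>V\<close>, \<open>W\<close>, the tensor product of \<open>V\<close> and \<open>W\<close> as a subspace of the ambient one.\<close>

definition tsub ::
  "'a::complex_vector set \<Rightarrow> 'b::complex_vector set \<Rightarrow> ('a, 'b) tensor set"
  where "tsub V W = cspan {a \<otimes>\<^sub>t b | a b. a \<in> V \<and> b \<in> W}"

section \<open>Hopf algebras and comodule algebras\<close>

definition alg_hom :: "('a::complex_algebra_1 \<Rightarrow> 'b::complex_algebra_1) \<Rightarrow> bool" where
  "alg_hom f \<longleftrightarrow> clinear f \<and> f 1 = 1 \<and> (\<forall>x y. f (x * y) = f x * f y)"

definition subalgebra :: "'a::complex_algebra_1 set \<Rightarrow> bool" where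
  "subalgebra A \<longleftrightarrow> csubspace A \<and> 1 \<in> A \<and> (\<forall>x\<in>A. \<forall>y\<in>A. x * y \<in> A)"

definition bialgebra ::
  "('h::complex_algebra_1 \<Rightarrow> ('h, 'h) tensor) \<Rightarrow> ('h \<Rightarrow> complex) \<Rightarrow> bool" where
  "bialgebra \<Delta> \<epsilon> \<longleftrightarrow> alg_hom \<Delta> \<and> alg_hom \<epsilon> \<and>
     (\<forall>x. tassoc (tmap \<Delta> id (\<Delta> x)) = tmap id \<Delta> (\<Delta> x)) \<and>
     (\<forall>x. tlift (\<lambda>a b. \<epsilon> a *\<^sub>C b) (\<Delta> x) = x) \<and>
     (\<forall>x. tlift (\<lambda>a b. \<epsilon> b *\<^sub>C a) (\<Delta> x) = x)"

definition hopf_algebra ::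
  "('h::complex_algebra_1 \<Rightarrow> ('h, 'h) tensor) \<Rightarrow> ('h \<Rightarrow> complex) \<Rightarrow> ('h \<Rightarrow> 'h) \<Rightarrow> bool" where
  "hopf_algebra \<Delta> \<epsilon> S \<longleftrightarrow> bialgebra \<Delta> \<epsilon> \<and> clinear S \<and>
     (\<forall>x. tlift (\<lambda>a b. S a * b) (\<Delta> x) = \<epsilon> x *\<^sub>C 1) \<and>
     (\<forall>x. tlift (\<lambda>a b. a * S b) (\<Delta> x) = \<epsilon> x *\<^sub>C 1)"

text \<open>A bialgebra map between Hopf algebras automatically commutes with the antipodes.\<close>

definition hopf_hom ::
  "('g::complex_algebra_1 \<Rightarrow> ('g, 'g) tensor) \<Rightarrow> ('g \<Rightarrow> complex) \<Rightarrow>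
   ('h::complex_algebra_1 \<Rightarrow> ('h, 'h) tensor) \<Rightarrow> ('h \<Rightarrow> complex) \<Rightarrow> ('g \<Rightarrow> 'h) \<Rightarrow> bool" where
  "hopf_hom \<Delta>\<^sub>G \<epsilon>\<^sub>G \<Delta>\<^sub>H \<epsilon>\<^sub>H f \<longleftrightarrow> alg_hom f \<and>
     (\<forall>x. \<Delta>\<^sub>H (f x) = tmap f f (\<Delta>\<^sub>G x)) \<and> (\<forall>x. \<epsilon>\<^sub>H (f x) = \<epsilon>\<^sub>G x)"

definition Ad_R ::
  "('h::complex_algebra_1 \<Rightarrow> ('h, 'h) tensor) \<Rightarrow> ('h \<Rightarrow> 'h) \<Rightarrow> 'h \<Rightarrow> ('h, 'h) tensor" where
  "Ad_R \<Delta> S h = tlift (\<lambda>h1 h'. tlift (\<lambda>h2 h3. h2 \<otimes>\<^sub>t (S h1 * h3)) (\<Delta> h')) (\<Delta> h)"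

text \<open>
  A right comodule algebra \<open>P\<close> is a subalgebra of an algebra type \<open>'a\<close>.  Its coaction is given by a
  linear map on all of \<open>'a\<close>, of which only the restriction to \<open>P\<close> is constrained and used; every
  linear map on \<open>P\<close> has such an extension.
\<close>

definition comodule_algebra ::
  "'a::complex_algebra_1 set \<Rightarrow> ('a \<Rightarrow> ('a, 'h::complex_algebra_1) tensor) \<Rightarrow>
   ('h \<Rightarrow> ('h, 'h) tensor) \<Rightarrow> ('h \<Rightarrow> complex) \<Rightarrow> bool" where
  "comodule_algebra P \<delta> \<Delta> \<epsilon> \<longleftrightarrow> subalgebra P \<and> clinear \<delta> \<and>
     (\<forall>p\<in>P. \<delta> p \<in> tsub P UNIV) \<and>
     (\<forall>p\<in>P. tassoc (tmap \<delta> id (\<delta> p)) = tmap id \<Delta> (\<delta> p)) \<and>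
     (\<forall>p\<in>P. tlift (\<lambda>a h. \<epsilon> h *\<^sub>C a) (\<delta> p) = p) \<and>
     \<delta> 1 = 1 \<and> (\<forall>p\<in>P. \<forall>p'\<in>P. \<delta> (p * p') = \<delta> p * \<delta> p')"

definition coinv ::
  "'a::complex_algebra_1 set \<Rightarrow> ('a \<Rightarrow> ('a, 'h::complex_algebra_1) tensor) \<Rightarrow> 'a set" where
  "coinv P \<delta> = {p \<in> P. \<delta> p = p \<otimes>\<^sub>t 1}"

section \<open>Quantum principal bundles\<close>

text \<open>The universal calculus of a subalgebra \<open>P\<close>, inside the tensor square of the ambient algebra.\<close>

definition Omega_u :: "'a::complex_algebra_1 set \<Rightarrow> ('a, 'a) tensor set" where
  "Omega_u P = {x \<in> tsub P P. tlift (*) x = 0}"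

definition ver ::
  "('a::complex_algebra_1 \<Rightarrow> ('a, 'h::complex_algebra_1) tensor) \<Rightarrow>
    ('a, 'a) tensor \<Rightarrow> ('a, 'h) tensor" where
  "ver \<delta> = tlift (\<lambda>f g. tlift (\<lambda>g0 g1. (f * g0) \<otimes>\<^sub>t g1) (\<delta> g))"

definition balancing :: "'a::complex_algebra_1 set \<Rightarrow> 'a set \<Rightarrow> ('a, 'a) tensor set" where
  "balancing P M =
     cspan {(p * m) \<otimes>\<^sub>t p' - p \<otimes>\<^sub>t (m * p') | p m p'. p \<in> P \<and> m \<in> M \<and> p' \<in> P}"

definition balanced_tensor :: "'a::complex_algebra_1 set \<Rightarrow> 'a set \<Rightarrow> ('a, 'a) tensor set set" where
  "balanced_tensor P M =
     tsub P P // {(x, y). x \<in> tsub P P \<and> y \<in> tsub P P \<and> x - y \<in> balancing P M}"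

text \<open>
  The map induced by \<open>ver \<delta>\<close> on classes is \<open>X \<mapsto> the_elem (ver \<delta> ` X)\<close>: on coinvariants \<open>M\<close>,
  \<open>ver \<delta>\<close> is constant on each class.
\<close>

definition hopf_galois ::
  "'a::complex_algebra_1 set \<Rightarrow> 'a set \<Rightarrow> ('a \<Rightarrow> ('a, 'h::complex_algebra_1) tensor) \<Rightarrow> bool" where
  "hopf_galois P M \<delta> \<longleftrightarrow>
     bij_betw (\<lambda>X. the_elem (ver \<delta> ` X)) (balanced_tensor P M) (tsub P UNIV)"

definition sub_bimodule :: "'a::complex_algebra_1 set \<Rightarrow> ('a, 'a) tensor set \<Rightarrow> bool" where
  "sub_bimodule P \<N> \<longleftrightarrow> csubspace \<N> \<and> \<N> \<subseteq> Omega_u P \<and>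
     (\<forall>p\<in>P. \<forall>x\<in>\<N>. (p \<otimes>\<^sub>t 1) * x \<in> \<N> \<and> x * (1 \<otimes>\<^sub>t p) \<in> \<N>)"

text \<open>The diagonal coaction \<open>f \<otimes> g \<mapsto> f\<^sub>(\<^sub>0\<^sub>) \<otimes> g\<^sub>(\<^sub>0\<^sub>) \<otimes> f\<^sub>(\<^sub>1\<^sub>) g\<^sub>(\<^sub>1\<^sub>)\<close>.\<close>

definition diag_coaction ::
  "('a::complex_algebra_1 \<Rightarrow> ('a, 'h::complex_algebra_1) tensor) \<Rightarrow>
    ('a, 'a) tensor \<Rightarrow> (('a, 'a) tensor, 'h) tensor" where
  "diag_coaction \<delta> =
     tlift (\<lambda>f g. tlift (\<lambda>f0 f1. tlift (\<lambda>g0 g1. (f0 \<otimes>\<^sub>t g0) \<otimes>\<^sub>t (f1 * g1)) (\<delta> g)) (\<delta> f))"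

definition right_ideal :: "'h::complex_algebra_1 set \<Rightarrow> bool" where
  "right_ideal I \<longleftrightarrow> csubspace I \<and> (\<forall>x\<in>I. \<forall>h. x * h \<in> I)"

definition quantum_principal_bundle ::
  "'a::complex_algebra_1 set \<Rightarrow> 'a set \<Rightarrow> ('a \<Rightarrow> ('a, 'h::complex_algebra_1) tensor) \<Rightarrow>
   ('h \<Rightarrow> ('h, 'h) tensor) \<Rightarrow> ('h \<Rightarrow> complex) \<Rightarrow> ('h \<Rightarrow> 'h) \<Rightarrow>
   ('a, 'a) tensor set \<Rightarrow> 'h set \<Rightarrow> bool" where
  "quantum_principal_bundle P M \<delta> \<Delta> \<epsilon> S \<N> I \<longleftrightarrow>
     hopf_algebra \<Delta> \<epsilon> S \<and> comodule_algebra P \<delta> \<Delta> \<epsilon> \<and> M = coinv P \<delta> \<and> hopf_galois P M \<delta> \<and>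
     sub_bimodule P \<N> \<and> (\<forall>x\<in>\<N>. diag_coaction \<delta> x \<in> tsub \<N> UNIV) \<and>
     right_ideal I \<and> I \<subseteq> {h. \<epsilon> h = 0} \<and> (\<forall>h\<in>I. Ad_R \<Delta> S h \<in> tsub I UNIV) \<and>
     ver \<delta> ` \<N> = tsub P I"

section \<open>The algebra of functions on U(1)\<close>

text \<open>
  Laurent polynomials \<open>int \<Rightarrow>\<^sub>0 complex\<close> with the convolution product; \<open>tpow k\<close> is the \<open>k\<close>-th power of
  the grouplike generator.
\<close>

type_synonym laurent = "int \<Rightarrow>\<^sub>0 complex"

definition tpow :: "int \<Rightarrow> laurent" where "tpow k = Poly_Mapping.single k 1"

definition Delta_U1 :: "laurent \<Rightarrow> (laurent, laurent) tensor" where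
  "Delta_U1 = linext (\<lambda>k. tpow k \<otimes>\<^sub>t tpow k)"

definition eps_U1 :: "laurent \<Rightarrow> complex" where
  "eps_U1 = linext (\<lambda>k. 1)"

definition antipode_U1 :: "laurent \<Rightarrow> laurent" where
  "antipode_U1 = linext (\<lambda>k. tpow (- k))"

section \<open>Free algebras and presentations\<close>

datatype 'x fword = FWord (letters: "'x list")

instantiation fword :: (type) monoid_add
begin
definition zero_fword_def: "0 = FWord []"
definition plus_fword_def: "v + w = FWord (letters v @ letters w)"
instance by standard (simp_all add: zero_fword_def plus_fword_def)
end

type_synonym 'x free_algebra = "'x fword \<Rightarrow>\<^sub>0 complex"

definition free_gen :: "'x \<Rightarrow> 'x free_algebra" where
  "free_gen x = Poly_Mapping.single (FWord [x]) 1"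

definition free_on :: "'x set \<Rightarrow> 'x free_algebra set" where
  "free_on X = {f. \<forall>w\<in>Poly_Mapping.keys f. set (letters w) \<subseteq> X}"

definition free_eval :: "('x \<Rightarrow> 'a::complex_algebra_1) \<Rightarrow> 'x free_algebra \<Rightarrow> 'a" where
  "free_eval u = linext (\<lambda>w. prod_list (map u (letters w)))"

definition ideal_gen_in :: "'a::complex_algebra_1 set \<Rightarrow> 'a set \<Rightarrow> 'a set" where
  "ideal_gen_in A B = cspan {x * b * y | x b y. x \<in> A \<and> b \<in> B \<and> y \<in> A}"

text \<open>
  The algebra type \<open>'a\<close>, with generators \<open>u x\<close> for \<open>x \<in> X\<close>, is the quotient of the free algebra on
  \<open>X\<close> by the two-sided ideal generated by \<open>B\<close>.
\<close>

definition presented_algebra ::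
  "'x set \<Rightarrow> 'x free_algebra set \<Rightarrow> ('x \<Rightarrow> 'a::complex_algebra_1) \<Rightarrow> bool" where
  "presented_algebra X B u \<longleftrightarrow>
     free_eval u ` free_on X = UNIV \<and>
     {f \<in> free_on X. free_eval u f = 0} = ideal_gen_in (free_on X) B"

section \<open>Quantum special unitary groups\<close>

definition nu :: "real \<Rightarrow> complex" where
  "nu q = complex_of_real (q - inverse q)"

text \<open>\<open>Rmat q i k j l\<close> has upper indices \<open>i k\<close> and lower indices \<open>j l\<close>.\<close>

definition Rmat :: "real \<Rightarrow> nat \<Rightarrow> nat \<Rightarrow> nat \<Rightarrow> nat \<Rightarrow> complex" where
  "Rmat q i k j l =
     (if i = k then complex_of_real q else 1) * of_bool (i = l) * of_bool (k = j)
     + nu q * of_bool (k > i) * of_bool (i = j) * of_bool (k = l)"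

definition qmat_relation ::
  "nat \<Rightarrow> real \<Rightarrow> nat \<Rightarrow> nat \<Rightarrow> nat \<Rightarrow> nat \<Rightarrow> (nat \<times> nat) free_algebra" where
  "qmat_relation n q a c b d =
     (\<Sum>w=1..n. \<Sum>x=1..n. Rmat q a c w x *\<^sub>C (free_gen (w, b) * free_gen (x, d)))
     - (\<Sum>y=1..n. \<Sum>z=1..n. Rmat q y z b d *\<^sub>C (free_gen (a, y) * free_gen (c, z)))"

definition qmat_relations :: "nat \<Rightarrow> real \<Rightarrow> (nat \<times> nat) free_algebra set" where
  "qmat_relations n q =
     {qmat_relation n q a c b d | a c b d. {a, c, b, d} \<subseteq> {1..n}}"

definition perm_length :: "nat \<Rightarrow> (nat \<Rightarrow> nat) \<Rightarrow> nat" where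
  "perm_length n \<pi> = card {(i, j). 1 \<le> i \<and> i < j \<and> j \<le> n \<and> \<pi> j < \<pi> i}"

definition qdet :: "nat \<Rightarrow> real \<Rightarrow> (nat \<times> nat) free_algebra" where
  "qdet n q = (\<Sum>\<pi> | \<pi> permutes {1..n}.
     ((- complex_of_real q) ^ perm_length n \<pi>) *\<^sub>C
     prod_list (map (\<lambda>i. free_gen (i, \<pi> i)) [1..<n + 1]))"

text \<open>
  \<open>(\<Delta>, \<epsilon>, S)\<close> is the Hopf algebra structure on the quotient of the algebra of quantum \<open>n \<times> n\<close>
  matrices by \<open>det\<^sub>n - 1\<close>, with generating matrix \<open>u\<close>; all of \<open>\<Delta>\<close>, \<open>\<epsilon>\<close>, \<open>S\<close> are uniquely determined.
\<close>

definition quantum_SU ::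
  "nat \<Rightarrow> real \<Rightarrow> (nat \<Rightarrow> nat \<Rightarrow> 'g::complex_algebra_1) \<Rightarrow>
   ('g \<Rightarrow> ('g, 'g) tensor) \<Rightarrow> ('g \<Rightarrow> complex) \<Rightarrow> ('g \<Rightarrow> 'g) \<Rightarrow> bool" where
  "quantum_SU n q u \<Delta> \<epsilon> S \<longleftrightarrow>
     presented_algebra ({1..n} \<times> {1..n}) (qmat_relations n q \<union> {qdet n q - 1}) (\<lambda>(i, j). u i j) \<and>
     hopf_algebra \<Delta> \<epsilon> S \<and>
     (\<forall>i\<in>{1..n}. \<forall>j\<in>{1..n}. \<Delta> (u i j) = (\<Sum>k=1..n. u i k \<otimes>\<^sub>t u k j) \<and> \<epsilon> (u i j) = of_bool (i = j))"

text \<open>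
  Coquasi-triangular structures, as linear functionals on the tensor square.  The last clause is the
  commutation rule \<open>g\<^sub>(\<^sub>1\<^sub>) f\<^sub>(\<^sub>1\<^sub>) r(f\<^sub>(\<^sub>2\<^sub>) \<otimes> g\<^sub>(\<^sub>2\<^sub>)) = r(f\<^sub>(\<^sub>1\<^sub>) \<otimes> g\<^sub>(\<^sub>1\<^sub>)) f\<^sub>(\<^sub>2\<^sub>) g\<^sub>(\<^sub>2\<^sub>)\<close>, and the one before
  it convolution-invertibility of \<open>r\<close>.
\<close>

definition conv2 ::
  "('g::complex_algebra_1 \<Rightarrow> ('g, 'g) tensor) \<Rightarrow> (('g, 'g) tensor \<Rightarrow> complex) \<Rightarrow>
   (('g, 'g) tensor \<Rightarrow> complex) \<Rightarrow> 'g \<Rightarrow> 'g \<Rightarrow> complex" where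
  "conv2 \<Delta> r r' f g =
     tlift (\<lambda>f1 f2. tlift (\<lambda>g1 g2. r (f1 \<otimes>\<^sub>t g1) * r' (f2 \<otimes>\<^sub>t g2)) (\<Delta> g)) (\<Delta> f)"

definition coquasitriangular ::
  "('g::complex_algebra_1 \<Rightarrow> ('g, 'g) tensor) \<Rightarrow> ('g \<Rightarrow> complex) \<Rightarrow>
   (('g, 'g) tensor \<Rightarrow> complex) \<Rightarrow> bool" where
  "coquasitriangular \<Delta> \<epsilon> r \<longleftrightarrow> clinear r \<and>
     (\<forall>f. r (1 \<otimes>\<^sub>t f) = \<epsilon> f \<and> r (f \<otimes>\<^sub>t 1) = \<epsilon> f) \<and>
     (\<forall>f g h. r ((f * g) \<otimes>\<^sub>t h) = tlift (\<lambda>h1 h2. r (f \<otimes>\<^sub>t h1) * r (g \<otimes>\<^sub>t h2)) (\<Delta> h)) \<and>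
     (\<forall>f g h. r (f \<otimes>\<^sub>t (g * h)) = tlift (\<lambda>f1 f2. r (f1 \<otimes>\<^sub>t h) * r (f2 \<otimes>\<^sub>t g)) (\<Delta> f)) \<and>
     (\<exists>r'. clinear r' \<and>
       (\<forall>f g. conv2 \<Delta> r r' f g = \<epsilon> f * \<epsilon> g \<and> conv2 \<Delta> r' r f g = \<epsilon> f * \<epsilon> g)) \<and>
     (\<forall>f g.
       tlift (\<lambda>f1 f2. tlift (\<lambda>g1 g2. r (f2 \<otimes>\<^sub>t g2) *\<^sub>C (g1 * f1)) (\<Delta> g)) (\<Delta> f) =
       tlift (\<lambda>f1 f2. tlift (\<lambda>g1 g2. r (f1 \<otimes>\<^sub>t g1) *\<^sub>C (f2 * g2)) (\<Delta> g)) (\<Delta> f))"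

section \<open>The calculus\<close>

definition Qform ::
  "('g::complex_algebra_1 \<Rightarrow> ('g, 'g) tensor) \<Rightarrow> (('g, 'g) tensor \<Rightarrow> complex) \<Rightarrow>
   'g \<Rightarrow> 'g \<Rightarrow> complex" where
  "Qform \<Delta> r h g =
     tlift (\<lambda>g1 g2. tlift (\<lambda>h1 h2. r (g1 \<otimes>\<^sub>t h1) * r (h2 \<otimes>\<^sub>t g2)) (\<Delta> h)) (\<Delta> g)"

definition I_SU ::
  "nat \<Rightarrow> (nat \<Rightarrow> nat \<Rightarrow> 'g::complex_algebra_1) \<Rightarrow> ('g \<Rightarrow> ('g, 'g) tensor) \<Rightarrow> ('g \<Rightarrow> complex) \<Rightarrow>
   ('g \<Rightarrow> 'g) \<Rightarrow> (('g, 'g) tensor \<Rightarrow> complex) \<Rightarrow> 'g set" where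
  "I_SU N u \<Delta> \<epsilon> S r =
     {x + y + z | x y z.
        (\<forall>k\<in>{1..N}. \<forall>l\<in>{1..N}. Qform \<Delta> r x (u k l) = 0) \<and> \<epsilon> x = 0 \<and>
        y \<in> cspan {u i 1 * S (u 1 i) | i. i \<in> {2..N}} \<and>
        z \<in> cspan {u i j | i j. i \<in> {2..N} \<and> j \<in> {2..N} \<and> i \<noteq> j}}"

text \<open>The map \<open>s(a \<otimes> b) = a S(b\<^sub>(\<^sub>1\<^sub>)) \<otimes> b\<^sub>(\<^sub>2\<^sub>)\<close>.\<close>

definition s_map ::
  "('g::complex_algebra_1 \<Rightarrow> ('g, 'g) tensor) \<Rightarrow> ('g \<Rightarrow> 'g) \<Rightarrow> ('g, 'g) tensor \<Rightarrow> ('g, 'g) tensor"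
  where "s_map \<Delta> S = tlift (\<lambda>a b. tlift (\<lambda>b1 b2. (a * S b1) \<otimes>\<^sub>t b2) (\<Delta> b))"

definition N_SU ::
  "nat \<Rightarrow> (nat \<Rightarrow> nat \<Rightarrow> 'g::complex_algebra_1) \<Rightarrow> ('g \<Rightarrow> ('g, 'g) tensor) \<Rightarrow> ('g \<Rightarrow> complex) \<Rightarrow>
   ('g \<Rightarrow> 'g) \<Rightarrow> (('g, 'g) tensor \<Rightarrow> complex) \<Rightarrow> ('g, 'g) tensor set" where
  "N_SU N u \<Delta> \<epsilon> S r = s_map \<Delta> S ` tsub UNIV (I_SU N u \<Delta> \<epsilon> S r)"

section \<open>Quantum spheres and projective spaces\<close>

definition beta_map ::
  "nat \<Rightarrow> (nat \<Rightarrow> nat \<Rightarrow> 'g::complex_algebra_1) \<Rightarrow> ('g \<Rightarrow> ('g, 'g) tensor) \<Rightarrow> ('g \<Rightarrow> complex) \<Rightarrow>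
   (nat \<Rightarrow> nat \<Rightarrow> 'k::complex_algebra_1) \<Rightarrow> ('k \<Rightarrow> ('k, 'k) tensor) \<Rightarrow> ('k \<Rightarrow> complex) \<Rightarrow>
   ('g \<Rightarrow> 'k) \<Rightarrow> bool" where
  "beta_map N u \<Delta> \<epsilon> v \<Delta>' \<epsilon>' \<beta> \<longleftrightarrow> hopf_hom \<Delta> \<epsilon> \<Delta>' \<epsilon>' \<beta> \<and> \<beta> (u 1 1) = 1 \<and>
     (\<forall>i\<in>{2..N}. \<beta> (u 1 i) = 0 \<and> \<beta> (u i 1) = 0) \<and>
     (\<forall>i\<in>{2..N}. \<forall>j\<in>{2..N}. \<beta> (u i j) = v (i - 1) (j - 1))"

definition gamma_map ::
  "nat \<Rightarrow> (nat \<Rightarrow> nat \<Rightarrow> 'g::complex_algebra_1) \<Rightarrow> ('g \<Rightarrow> ('g, 'g) tensor) \<Rightarrow> ('g \<Rightarrow> complex) \<Rightarrow>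
   ('g \<Rightarrow> laurent) \<Rightarrow> bool" where
  "gamma_map N u \<Delta> \<epsilon> \<gamma> \<longleftrightarrow> hopf_hom \<Delta> \<epsilon> Delta_U1 eps_U1 \<gamma> \<and>
     \<gamma> (u 1 1) = tpow (- 1) \<and> (\<forall>k\<in>{2..N - 1}. \<gamma> (u k k) = 1) \<and> \<gamma> (u N N) = tpow 1 \<and>
     (\<forall>i\<in>{1..N}. \<forall>j\<in>{1..N}. i \<noteq> j \<longrightarrow> \<gamma> (u i j) = 0)"

definition qsphere ::
  "('g::complex_algebra_1 \<Rightarrow> ('g, 'g) tensor) \<Rightarrow> ('g \<Rightarrow> 'k::complex_algebra_1) \<Rightarrow> 'g set" where
  "qsphere \<Delta> \<beta> = coinv UNIV (tmap id \<beta> \<circ> \<Delta>)"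

definition qCP ::
  "('g::complex_algebra_1 \<Rightarrow> ('g, 'g) tensor) \<Rightarrow> ('g \<Rightarrow> 'k::complex_algebra_1) \<Rightarrow>
   ('g \<Rightarrow> laurent) \<Rightarrow> 'g set" where
  "qCP \<Delta> \<beta> \<gamma> = coinv (qsphere \<Delta> \<beta>) (tmap id \<gamma> \<circ> \<Delta>)"

end

theory Submission
  imports Defs
begin

text \<open>
  The canonical map \<open>V(f \<otimes> g) = f g\<^sub>(\<^sub>1\<^sub>) \<otimes> g\<^sub>(\<^sub>2\<^sub>)\<close> inverts \<open>s\<close>, so the sub-bimodule of the calculus is
  the preimage of \<open>G \<otimes> I\<close> under \<open>V\<close>, where \<open>I\<close> consists of the elements of \<open>ker \<epsilon>\<close> for which \<open>Q\<close> has
  vanishing first row and column.  Triangularity of the R-matrix makes \<open>I\<close> a right ideal and \<open>Q\<^sub>1\<^sub>1\<close> a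
  character, and on the sphere \<open>Q\<^sub>1\<^sub>1\<close> is evaluation of \<open>\<gamma>\<close> at a complex number \<open>z0\<close>.

  The elements \<open>u\<^sup>1\<^sub>1\<close> and \<open>S(u\<^sup>1\<^sub>1)\<close> are biinvariant, so \<open>S(z\<^sub>(\<^sub>1\<^sub>)) \<otimes> z\<^sub>(\<^sub>2\<^sub>)\<close> lies in \<open>P \<otimes> P\<close> for their powers
  \<open>z\<close>.  These tensors lift every \<open>t\<^sup>n\<close>, which gives the Hopf-Galois property.  An \<open>f\<close> in \<open>\<gamma>(I \<inter> P)\<close> vanishes
  at \<open>1\<close> and \<open>z0\<close>, so its lift \<open>Z f\<close> lies in \<open>I\<close>; hence the lifts realise all of \<open>P \<otimes> \<gamma>(I \<inter> P)\<close> as vertical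
  parts.
\<close>

section \<open>Linear algebra of tensor products\<close>

text \<open>The hard inclusion is that of P tensor gamma(I cap P) in the vertical part. For b in I
  cap P there is no reason why S(b1) tensor b2 should lie in P tensor P, since P is only a left
  coideal. So b is replaced by the lift Z(gamma(b)), and the point is that this replacement is again
  in I. The entry Q_kl has weight w_k - w_l under the adjoint torus action, and the weight of the
  index 1 differs from all the others. On invariant elements every condition Q_1k = Q_k1 = 0 with k
  > 1 is therefore automatic. The two remaining conditions, on the counit and on Q_11, are
  characters which on P factor through gamma, so they see only gamma(b). The description of I by the
  first row and column of Q depends on the added generators filling the complementary block of Q.
  For q different from 1 this needs values of r on antipodes to be nonzero; they come from a
  triangular linear system. The antipode is never handled as an antihomomorphism: its values on
  matrix coefficients are found as entries of inverse matrices.\<close>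

named_theorems clin

lemma clinear_ident [clin]: "clinear (\<lambda>x. x)"
  by (rule clinearI) simp_all

lemma clinear_id [clin]: "clinear id"
  by (rule clinearI) simp_all

lemma clinear_zero [clin]: "clinear (\<lambda>x. 0)"
  by (rule clinearI) (simp_all add: complex_vector.scale_zero_right)

lemma clinear_plus [clin]: "clinear f \<Longrightarrow> clinear g \<Longrightarrow> clinear (\<lambda>x. f x + g x)"
  by (rule clinear_add)

lemma clinear_minus [clin]: "clinear f \<Longrightarrow> clinear g \<Longrightarrow> clinear (\<lambda>x. f x - g x)"
  by (rule clinearI) (simp_all add: clinearD complex_vector.scale_right_diff_distrib)

lemma clinear_sum [clin]: "(\<And>i. i \<in> A \<Longrightarrow> clinear (f i)) \<Longrightarrow> clinear (\<lambda>x. \<Sum>i\<in>A. f i x)"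
  by (induction A rule: infinite_finite_induct) (simp_all add: clin)

lemma clinear_scale [clin]: "clinear f \<Longrightarrow> clinear (\<lambda>x. c *\<^sub>C f x)"
  by (rule clinearI) (simp_all add: clinearD scaleC_add_right scaleC_scaleC mult.commute)

lemma clinear_scale_left [clin]: "clinear f \<Longrightarrow> clinear (\<lambda>x. f x *\<^sub>C v)"
  by (rule clinearI) (simp_all add: clinearD scaleC_add_left scaleC_scaleC scaleC_complex_def)

lemma clinear_mult_left [clin]:
  fixes f :: "'a::complex_vector \<Rightarrow> 'b::complex_algebra_1"
  shows "clinear f \<Longrightarrow> clinear (\<lambda>x. f x * a)"
  by (rule clinearI) (simp_all add: clinearD distrib_right mult_scaleC_left)

lemma clinear_mult_right [clin]:
  fixes f :: "'a::complex_vector \<Rightarrow> 'b::complex_algebra_1"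
  shows "clinear f \<Longrightarrow> clinear (\<lambda>x. a * f x)"
  by (rule clinearI) (simp_all add: clinearD distrib_left mult_scaleC_right)

lemma clinear_tpure_left [clin]: "clinear f \<Longrightarrow> clinear (\<lambda>x. f x \<otimes>\<^sub>t b)"
  by (rule clinearI) (simp_all add: clinearD tpure_add_left tpure_scale_left)

lemma clinear_tpure_right [clin]: "clinear f \<Longrightarrow> clinear (\<lambda>x. a \<otimes>\<^sub>t f x)"
  by (rule clinearI) (simp_all add: clinearD tpure_add_right tpure_scale_right)

lemma cbilinearI:
  "(\<And>a. clinear (f a)) \<Longrightarrow> (\<And>b. clinear (\<lambda>a. f a b)) \<Longrightarrow> cbilinear f"
  by (simp add: cbilinear_def)

lemma clinear_tlift_compose [clin]:
  "cbilinear F \<Longrightarrow> clinear f \<Longrightarrow> clinear (\<lambda>x. tlift F (f x))"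
  using clinear_compose[OF _ clinear_tlift] .

text \<open>Nested Sweedler sums carry the variable inside the bilinear map and not in its tensor
  argument; linearity in such a parameter reduces to pure tensors.\<close>

lemma clinear_tlift_param:
  assumes "\<And>x. cbilinear (F x)" "\<And>a b. clinear (\<lambda>x. F x a b)"
  shows "clinear (\<lambda>x. tlift (F x) t)"
proof (induction t rule: tensor_induct)
  case (pure a b)
  then show ?case using assms by (simp add: tlift_tpure)
next
  case (add x y)
  then show ?case by (simp add: clinearD(1)[OF clinear_tlift[OF assms(1)]] clinear_plus)
qed

lemma tpure_zero [simp]: "0 \<otimes>\<^sub>t b = 0" "a \<otimes>\<^sub>t 0 = 0"
  using clinearD(3)[OF clinear_tpure_left[OF clinear_ident], of b]
    clinearD(3)[OF clinear_tpure_right[OF clinear_ident], of a] by simp_all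

lemma tpure_sum_left: "sum f A \<otimes>\<^sub>t b = (\<Sum>i\<in>A. f i \<otimes>\<^sub>t b)"
  by (rule clinearD(5)[OF clinear_tpure_left[OF clinear_ident]])

lemma tpure_sum_right: "a \<otimes>\<^sub>t sum f A = (\<Sum>i\<in>A. a \<otimes>\<^sub>t f i)"
  by (rule clinearD(5)[OF clinear_tpure_right[OF clinear_ident]])

lemma tpure_diff_left: "(a - a') \<otimes>\<^sub>t b = a \<otimes>\<^sub>t b - a' \<otimes>\<^sub>t b"
  by (rule clinearD(4)[OF clinear_tpure_left[OF clinear_ident]])

lemma scaleC_complex [simp]: "a *\<^sub>C (x::complex) = a * x"
  by (simp add: scaleC_complex_def)

declare scaleC_one [simp] complex_vector.scale_zero_left [simp] complex_vector.scale_zero_right [simp]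

section \<open>Maps between tensor products, and tensor products of subspaces\<close>

lemma tmap_tpure:
  assumes "clinear f" "clinear g"
  shows "tmap f g (a \<otimes>\<^sub>t b) = f a \<otimes>\<^sub>t g b"
  unfolding tmap_def by (subst tlift_tpure) (auto intro!: cbilinearI clin assms)

lemma clinear_tmap:
  assumes "clinear f" "clinear g"
  shows "clinear (tmap f g)"
  unfolding tmap_def by (intro clin cbilinearI assms)

lemma tmap_compose:
  assumes "clinear f" "clinear g" "clinear f'" "clinear g'"
  shows "tmap f g (tmap f' g' x) = tmap (\<lambda>a. f (f' a)) (\<lambda>b. g (g' b)) x"
proof -
  have l: "clinear (\<lambda>a. f (f' a))" "clinear (\<lambda>b. g (g' b))"
    using clinear_compose assms by blast+
  show ?thesis
    by (rule clinear_tensor_eqI)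
      (auto intro!: clinear_compose[of "tmap f' g'"] clinear_tmap l assms simp: tmap_tpure l assms)
qed

lemma cspan_image_subset:
  assumes "clinear F" "x \<in> cspan A" "\<And>a. a \<in> A \<Longrightarrow> F a \<in> B" "csubspace B"
  shows "F x \<in> B"
  using assms(2)
  by (induction rule: complex_vector.span_induct_alt)
    (auto simp: clinearD[OF assms(1)] assms complex_vector.subspace_0 complex_vector.subspace_add complex_vector.subspace_scale)

lemma csubspace_tsub: "csubspace (tsub A B)"
  unfolding tsub_def by (rule complex_vector.subspace_span)

lemma tpure_in_tsub: "a \<in> A \<Longrightarrow> b \<in> B \<Longrightarrow> a \<otimes>\<^sub>t b \<in> tsub A B"
  unfolding tsub_def by (rule complex_vector.span_base) blast

lemma tsub_mono: "A \<subseteq> A' \<Longrightarrow> B \<subseteq> B' \<Longrightarrow> tsub A B \<subseteq> tsub A' B'"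
  unfolding tsub_def by (rule complex_vector.span_mono) blast

lemma tsub_image_subset:
  assumes "clinear F" "x \<in> tsub A B" "\<And>a b. a \<in> A \<Longrightarrow> b \<in> B \<Longrightarrow> F (a \<otimes>\<^sub>t b) \<in> C" "csubspace C"
  shows "F x \<in> C"
  by (rule cspan_image_subset[OF assms(1) assms(2)[unfolded tsub_def]]) (use assms in auto)

lemma tsub_linear_eq:
  assumes "clinear F" "clinear F'" "x \<in> tsub A B"
    and "\<And>a b. a \<in> A \<Longrightarrow> b \<in> B \<Longrightarrow> F (a \<otimes>\<^sub>t b) = F' (a \<otimes>\<^sub>t b)"
  shows "F x = F' x"
proof -
  have "(F x - F' x) \<in> {0}"
    by (rule tsub_image_subset[of "\<lambda>x. F x - F' x", OF _ assms(3)])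
      (auto intro!: clin assms simp: assms(4) complex_vector.subspace_def)
  then show ?thesis by simp
qed

section \<open>Slices of tensors and membership in tensor products of subspaces\<close>

definition lslice :: "('a::complex_vector \<Rightarrow> complex) \<Rightarrow> ('a, 'b::complex_vector) tensor \<Rightarrow> 'b" where
  "lslice \<phi> = tlift (\<lambda>a b. \<phi> a *\<^sub>C b)"

definition rslice :: "('b::complex_vector \<Rightarrow> complex) \<Rightarrow> ('a::complex_vector, 'b) tensor \<Rightarrow> 'a" where
  "rslice \<phi> = tlift (\<lambda>a b. \<phi> b *\<^sub>C a)"

lemma clinear_lslice: "clinear \<phi> \<Longrightarrow> clinear (lslice \<phi>)"
  unfolding lslice_def by (intro clin cbilinearI)

lemma clinear_rslice: "clinear \<phi> \<Longrightarrow> clinear (rslice \<phi>)"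
  unfolding rslice_def by (intro clin cbilinearI)

lemma lslice_tpure: "clinear \<phi> \<Longrightarrow> lslice \<phi> (a \<otimes>\<^sub>t b) = \<phi> a *\<^sub>C b"
  unfolding lslice_def by (subst tlift_tpure) (auto intro!: cbilinearI clin)

lemma rslice_tpure: "clinear \<phi> \<Longrightarrow> rslice \<phi> (a \<otimes>\<^sub>t b) = \<phi> b *\<^sub>C a"
  unfolding rslice_def by (subst tlift_tpure) (auto intro!: cbilinearI clin)

text \<open>The slices of a tensor along dual coordinates of a basis are its coefficients.  This turns every
  membership in a tensor product of subspaces below into a statement about slices.\<close>

lemma tensor_expansion_left:
  fixes x :: "('a::complex_vector, 'b::complex_vector) tensor"
  shows "\<exists>F \<phi>. finite F \<and> (\<forall>e. clinear (\<phi> e)) \<and> x = (\<Sum>e\<in>F. e \<otimes>\<^sub>t lslice (\<phi> e) x)"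
proof -
  define B where "B = complex_vector.extend_basis ({} :: 'a set)"
  have B: "complex_vector.independent B" "complex_vector.span B = UNIV"
    unfolding B_def
    using complex_vector.independent_extend_basis complex_vector.independent_empty
      complex_vector.span_extend_basis by blast+
  define \<phi> where "\<phi> e v = complex_vector.representation B v e" for e v
  have l: "clinear (\<phi> e)" for e
    unfolding \<phi>_def by (rule clinearI)
      (simp_all add: complex_vector.representation_add complex_vector.representation_scale B)
  \<comment> \<open>The claim is strengthened to all finite supersets, so that the supports of two
    summands can be merged in the additive case.\<close>
  have "\<exists>F0. finite F0 \<and> (\<forall>F. finite F \<longrightarrow> F0 \<subseteq> F \<longrightarrow> x = (\<Sum>e\<in>F. e \<otimes>\<^sub>t lslice (\<phi> e) x))"
  proof (induction x rule: tensor_induct)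
    case (pure a b)
    let ?F0 = "{e. complex_vector.representation B a e \<noteq> 0}"
    have f: "finite ?F0" by (rule complex_vector.finite_representation)
    have "a \<otimes>\<^sub>t b = (\<Sum>e\<in>F. e \<otimes>\<^sub>t lslice (\<phi> e) (a \<otimes>\<^sub>t b))" if F: "finite F" "?F0 \<subseteq> F" for F
    proof -
      have "a = (\<Sum>e\<in>?F0. \<phi> e a *\<^sub>C e)"
        unfolding \<phi>_def using complex_vector.sum_nonzero_representation_eq[OF B(1), of a] B(2)
        by simp
      also have "\<dots> = (\<Sum>e\<in>F. \<phi> e a *\<^sub>C e)"
        by (rule sum.mono_neutral_left) (use F in \<open>auto simp: \<phi>_def\<close>)
      finally have a: "a = (\<Sum>e\<in>F. \<phi> e a *\<^sub>C e)" .
      show ?thesis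
        by (subst a) (simp add: tpure_sum_left lslice_tpure l tpure_scale_left tpure_scale_right)
    qed
    with f show ?case by blast
  next
    case (add x y)
    then obtain F1 F2 where F: "finite F1" "finite F2"
      "\<forall>F. finite F \<longrightarrow> F1 \<subseteq> F \<longrightarrow> x = (\<Sum>e\<in>F. e \<otimes>\<^sub>t lslice (\<phi> e) x)"
      "\<forall>F. finite F \<longrightarrow> F2 \<subseteq> F \<longrightarrow> y = (\<Sum>e\<in>F. e \<otimes>\<^sub>t lslice (\<phi> e) y)" by blast
    have "x + y = (\<Sum>e\<in>F. e \<otimes>\<^sub>t lslice (\<phi> e) (x + y))" if "finite F" "F1 \<union> F2 \<subseteq> F" for F
    proof -
      have "x = (\<Sum>e\<in>F. e \<otimes>\<^sub>t lslice (\<phi> e) x)" "y = (\<Sum>e\<in>F. e \<otimes>\<^sub>t lslice (\<phi> e) y)"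
        using F that by auto
      then show ?thesis
        by (simp add: clinearD[OF clinear_lslice[OF l]] tpure_add_right sum.distrib)
    qed
    with F(1,2) show ?case by (intro exI[of _ "F1 \<union> F2"]) blast
  qed
  with l show ?thesis by blast
qed

definition tflip :: "('a::complex_vector, 'b::complex_vector) tensor \<Rightarrow> ('b, 'a) tensor" where
  "tflip = tlift (\<lambda>a b. b \<otimes>\<^sub>t a)"

lemma clinear_tflip: "clinear tflip"
  unfolding tflip_def by (intro clin cbilinearI)

lemma tflip_tpure: "tflip (a \<otimes>\<^sub>t b) = b \<otimes>\<^sub>t a"
  unfolding tflip_def by (subst tlift_tpure) (auto intro!: cbilinearI clin)

lemma tflip_tflip: "tflip (tflip x) = x"
  by (induction x rule: tensor_induct) (simp_all add: tflip_tpure clinearD[OF clinear_tflip])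

lemma lslice_tflip: "clinear \<phi> \<Longrightarrow> lslice \<phi> (tflip x) = rslice \<phi> x"
  by (induction x rule: tensor_induct)
    (simp_all add: tflip_tpure clinearD[OF clinear_tflip] clinearD[OF clinear_lslice]
      clinearD[OF clinear_rslice] lslice_tpure rslice_tpure)

lemma tsub_UNIV_left_iff:
  assumes "csubspace B"
  shows "x \<in> tsub UNIV B \<longleftrightarrow> (\<forall>\<phi>. clinear \<phi> \<longrightarrow> lslice \<phi> x \<in> B)"
proof
  assume x: "x \<in> tsub UNIV B"
  show "\<forall>\<phi>. clinear \<phi> \<longrightarrow> lslice \<phi> x \<in> B"
  proof (intro allI impI)
    fix \<phi> :: "'b \<Rightarrow> complex"
    assume \<phi>: "clinear \<phi>"
    show "lslice \<phi> x \<in> B"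
      by (rule tsub_image_subset[OF clinear_lslice[OF \<phi>] x])
        (simp_all add: lslice_tpure \<phi> assms complex_vector.subspace_scale)
  qed
next
  assume *: "\<forall>\<phi>. clinear \<phi> \<longrightarrow> lslice \<phi> x \<in> B"
  obtain F \<phi> where F: "finite F" "\<forall>e. clinear (\<phi> e)"
    "x = (\<Sum>e\<in>F. e \<otimes>\<^sub>t lslice (\<phi> e) x)"
    using tensor_expansion_left[of x] by blast
  have "(\<Sum>e\<in>F. e \<otimes>\<^sub>t lslice (\<phi> e) x) \<in> tsub UNIV B"
    by (rule complex_vector.subspace_sum[OF csubspace_tsub], rule tpure_in_tsub) (use * F(2) in auto)
  with F(3) show "x \<in> tsub UNIV B" by simp
qed

lemma tsub_UNIV_right_iff:
  assumes "csubspace A"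
  shows "x \<in> tsub A UNIV \<longleftrightarrow> (\<forall>\<phi>. clinear \<phi> \<longrightarrow> rslice \<phi> x \<in> A)"
proof -
  have *: "tflip y \<in> tsub B A" if "y \<in> tsub A B" for A :: "'c::complex_vector set"
    and B :: "'d::complex_vector set" and y
    using that by (rule tsub_image_subset[OF clinear_tflip])
      (simp_all add: tflip_tpure tpure_in_tsub csubspace_tsub)
  have "x \<in> tsub A UNIV \<longleftrightarrow> tflip x \<in> tsub UNIV A"
    using *[of x A UNIV] *[of "tflip x" UNIV A] by (auto simp: tflip_tflip)
  then show ?thesis by (simp add: tsub_UNIV_left_iff[OF assms] lslice_tflip)
qed

lemma ex_projection:
  assumes "csubspace (A :: 'a::complex_vector set)"
  obtains p where "clinear p" "\<And>x. p x \<in> A" "\<And>x. x \<in> A \<Longrightarrow> p x = x"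
proof -
  interpret vector_space_pair "scaleC :: complex \<Rightarrow> 'a \<Rightarrow> 'a" "scaleC :: complex \<Rightarrow> 'a \<Rightarrow> 'a" ..
  from linear_exists_left_inverse_on[OF clinear_ident assms] show ?thesis
    using that by (auto simp: inj_on_def)
qed

text \<open>A linear projection onto A, applied to the first leg, fixes x by the one hypothesis and
  moves it into the smaller tensor product by the other.\<close>

lemma tsub_Int:
  assumes "csubspace A" "x \<in> tsub A UNIV" "x \<in> tsub UNIV B"
  shows "x \<in> tsub A B"
proof -
  obtain p where p: "clinear p" "\<And>x. p x \<in> A" "\<And>x. x \<in> A \<Longrightarrow> p x = x"
    using ex_projection[OF assms(1)] by blast
  have "tmap p id x = x"
    by (rule tsub_linear_eq[OF _ _ assms(2)])
      (auto intro!: clinear_tmap clin p simp: tmap_tpure p clin)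
  moreover have "tmap p id x \<in> tsub A B"
    using assms(3) by (rule tsub_image_subset[rotated])
      (auto intro!: clinear_tmap clin p tpure_in_tsub csubspace_tsub simp: tmap_tpure p clin)
  ultimately show ?thesis by simp
qed

section \<open>Algebra homomorphisms out of tensor products\<close>

lemma alg_homD:
  assumes "alg_hom f"
  shows "clinear f" "f 1 = 1" "f (x * y) = f x * f y" "f 0 = 0" "f (x + y) = f x + f y"
    "f (x - y) = f x - f y" "f (c *\<^sub>C x) = c *\<^sub>C f x" "f (sum g A) = (\<Sum>a\<in>A. f (g a))"
  using assms clinearD[of f] by (auto simp: alg_hom_def)

lemma alg_hom_compose: "alg_hom f \<Longrightarrow> alg_hom g \<Longrightarrow> alg_hom (\<lambda>x. g (f x))"
  by (auto simp: alg_hom_def clinear_compose)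

lemma alg_hom_ident: "alg_hom (\<lambda>x. x)" "alg_hom id"
  by (auto simp: alg_hom_def clin)

lemma alg_hom_tpure_one: "alg_hom (\<lambda>a. a \<otimes>\<^sub>t 1)" "alg_hom (\<lambda>b. 1 \<otimes>\<^sub>t b)"
  by (auto simp: alg_hom_def tensor_mult_pure one_tensor_def intro!: clin)

lemma tprod_tpure:
  fixes f :: "'a::complex_vector \<Rightarrow> 'c::complex_algebra_1"
  shows "clinear f \<Longrightarrow> clinear g \<Longrightarrow> tlift (\<lambda>a b. f a * g b) (a \<otimes>\<^sub>t b) = f a * g b"
  by (subst tlift_tpure) (auto intro!: cbilinearI clin)

lemma clinear_tprod:
  fixes f :: "'a::complex_vector \<Rightarrow> 'c::complex_algebra_1"
  shows "clinear f \<Longrightarrow> clinear g \<Longrightarrow> clinear (tlift (\<lambda>a b. f a * g b))"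
  by (intro clin cbilinearI)

text \<open>Interchanging f(c) with g(b) in the middle of a product gives multiplicativity; this is
  the universal property of the tensor product of algebras.\<close>

lemma alg_hom_tprod:
  fixes f :: "'a::complex_algebra_1 \<Rightarrow> 'c::complex_algebra_1"
    and g :: "'b::complex_algebra_1 \<Rightarrow> 'c"
  assumes f: "alg_hom f" and g: "alg_hom g" and comm: "\<And>a b. f a * g b = g b * f a"
  shows "alg_hom (tlift (\<lambda>a b. f a * g b))" (is "alg_hom ?T")
proof -
  note l = alg_homD(1)[OF f] alg_homD(1)[OF g]
  note L = clinearD[OF clinear_tprod[OF l]]
  have "?T (x * y) = ?T x * ?T y" for x y
  proof (induction x rule: tensor_induct)
    case x: (pure a b)
    show ?case
    proof (induction y rule: tensor_induct)
      case y: (pure c d)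
      have "f a * f c * (g b * g d) = f a * (f c * g b) * g d" by (simp add: mult.assoc)
      also have "\<dots> = f a * g b * (f c * g d)" unfolding comm[of c b] by (simp add: mult.assoc)
      finally show ?case
        by (simp add: tensor_mult_pure tprod_tpure l alg_homD[OF f] alg_homD[OF g])
    qed (simp add: L distrib_left)
  qed (simp add: L distrib_right)
  then show ?thesis
    by (simp add: alg_hom_def clinear_tprod l one_tensor_def tprod_tpure alg_homD[OF f] alg_homD[OF g])
qed

text \<open>A tensor product of maps is a product of two commuting legs, the form to which the
  universal property applies.\<close>

lemma tmap_eq_tprod:
  assumes "clinear f" "clinear g"
  shows "tmap f g = tlift (\<lambda>a b. (f a \<otimes>\<^sub>t (1::'d::complex_algebra_1)) * ((1::'c::complex_algebra_1) \<otimes>\<^sub>t g b))"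
  by (simp add: tmap_def tensor_mult_pure)

lemma alg_hom_tmap:
  assumes f: "alg_hom f" and g: "alg_hom g"
  shows "alg_hom (tmap f g)"
  unfolding tmap_eq_tprod[OF alg_homD(1)[OF f] alg_homD(1)[OF g]]
  by (rule alg_hom_tprod)
    (auto intro!: alg_hom_compose[OF f] alg_hom_compose[OF g] alg_hom_tpure_one simp: tensor_mult_pure)

lemma tassoc_tpure: "tassoc ((a \<otimes>\<^sub>t b) \<otimes>\<^sub>t c) = a \<otimes>\<^sub>t (b \<otimes>\<^sub>t c)"
  unfolding tassoc_def
  by (subst tlift_tpure; (subst tlift_tpure)?)
    (auto intro!: cbilinearI clin clinear_tlift_param)

lemma clinear_tassoc: "clinear tassoc"
  unfolding tassoc_def
  by (auto intro!: cbilinearI clin clinear_tlift_param)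

lemma tensor3_eqI:
  assumes "clinear f" "clinear g" "\<And>a b c. f ((a \<otimes>\<^sub>t b) \<otimes>\<^sub>t c) = g ((a \<otimes>\<^sub>t b) \<otimes>\<^sub>t c)"
  shows "f t = g t"
proof (rule clinear_tensor_eqI[OF assms(1,2)])
  fix x c
  show "f (x \<otimes>\<^sub>t c) = g (x \<otimes>\<^sub>t c)"
    by (induction x rule: tensor_induct)
      (simp_all add: assms clinearD[OF assms(1)] clinearD[OF assms(2)] tpure_add_left)
qed

lemma alg_hom_tassoc: "alg_hom tassoc"
proof -
  have "tassoc (x * y) = tassoc x * tassoc y" for x y :: "(('a, 'b) tensor, 'c) tensor"
  proof -
    have l: "clinear (\<lambda>x::(('a, 'b) tensor, 'c) tensor. tassoc (x * y))"
      "clinear (\<lambda>x. tassoc x * tassoc y)" for y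
      by (auto intro!: clin clinear_tassoc clinear_compose[of _ tassoc])
    have l': "clinear (\<lambda>y::(('a, 'b) tensor, 'c) tensor. tassoc (x * y))"
      "clinear (\<lambda>y. tassoc x * tassoc y)" for x
      by (auto intro!: clin clinear_tassoc clinear_compose[of _ tassoc])
    show ?thesis
      by (rule tensor3_eqI[OF l], rule tensor3_eqI[OF l'])
        (simp add: tassoc_tpure tensor_mult_pure)
  qed
  then show ?thesis
    by (simp add: alg_hom_def clinear_tassoc one_tensor_def tassoc_tpure)
qed

section \<open>Laurent polynomials and presented algebras\<close>

lemma tpow_zero: "tpow 0 = 1"
  by (simp add: tpow_def)

lemma tpow_add: "tpow (m + n) = tpow m * tpow n"
  by (simp add: tpow_def mult_single)

lemma laurent_linear_eqI:
  fixes f g :: "laurent \<Rightarrow> 'a::complex_vector"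
  assumes "clinear f" "clinear g" "\<And>k. f (tpow k) = g (tpow k)"
  shows "f x = g x"
proof (induction x rule: poly_mapping_add_induct)
  case (single k c)
  have "Poly_Mapping.single k c = c *\<^sub>C tpow k"
    by (simp add: tpow_def scaleC_single)
  then show ?case by (simp add: clinearD(2) assms)
qed (simp_all add: clinearD assms)

lemma alg_hom_laurentI:
  fixes h :: "laurent \<Rightarrow> 'a::complex_algebra_1"
  assumes h: "clinear h" "h 1 = 1" "\<And>m n. h (tpow (m + n)) = h (tpow m) * h (tpow n)"
  shows "alg_hom h"
proof -
  have "h (x * y) = h x * h y" for x y
  proof -
    have l: "clinear (\<lambda>y. h (x * y))" "clinear (\<lambda>x. h (x * y))" for x y
      by (rule clinear_compose[OF _ h(1)], intro clin)+
    have l': "clinear (\<lambda>y. h x * h y)" "clinear (\<lambda>x. h x * h y)" for x y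
      by (intro clin h)+
    have m: "h (tpow m * y) = h (tpow m) * h y" for m
      by (rule laurent_linear_eqI[OF l(1) l'(1)]) (simp add: h(3) tpow_add[symmetric])
    show ?thesis
      by (rule laurent_linear_eqI[OF l(2) l'(2)]) (rule m)
  qed
  with h show ?thesis by (simp add: alg_hom_def)
qed

lemma linext_tpow [simp]: "linext f (tpow k) = f k"
  by (simp add: tpow_def)

section \<open>The Hopf algebra of Laurent polynomials\<close>

lemma Delta_U1_tpow: "Delta_U1 (tpow k) = tpow k \<otimes>\<^sub>t tpow k"
  by (simp add: Delta_U1_def)

lemma alg_hom_Delta_U1: "alg_hom Delta_U1"
proof (rule alg_hom_laurentI)
  show "clinear Delta_U1" unfolding Delta_U1_def by (rule clinear_linext)
  show "Delta_U1 1 = 1" using Delta_U1_tpow[of 0] by (simp add: tpow_zero one_tensor_def)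
  show "Delta_U1 (tpow (m + n)) = Delta_U1 (tpow m) * Delta_U1 (tpow n)" for m n
    by (simp only: Delta_U1_tpow tensor_mult_pure tpow_add[symmetric])
qed

lemma alg_hom_eps_U1: "alg_hom eps_U1"
  unfolding eps_U1_def
  by (rule alg_hom_laurentI) (auto simp: clinear_linext tpow_zero[symmetric])

lemma eps_U1_tpow: "eps_U1 (tpow k) = 1"
  by (simp add: eps_U1_def)

lemma antipode_U1_tpow: "antipode_U1 (tpow k) = tpow (- k)"
  by (simp add: antipode_U1_def)

lemma clinear_antipode_U1: "clinear antipode_U1"
  unfolding antipode_U1_def by (rule clinear_linext)

lemma alg_hom_coassoc_sides:
  assumes "clinear \<Delta>"
  shows "clinear (\<lambda>x. tassoc (tmap \<Delta> id (\<Delta> x)))" "clinear (\<lambda>x. tmap id \<Delta> (\<Delta> x))"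
  by (intro clinear_compose[OF _ clinear_tassoc] clinear_compose[OF assms clinear_tmap] assms clin)+

lemma hopf_algebra_U1: "hopf_algebra Delta_U1 eps_U1 antipode_U1"
proof -
  note l = alg_homD(1)[OF alg_hom_Delta_U1] alg_homD(1)[OF alg_hom_eps_U1]
  have 1: "tassoc (tmap Delta_U1 id (Delta_U1 x)) = tmap id Delta_U1 (Delta_U1 x)" for x
    by (rule laurent_linear_eqI[OF alg_hom_coassoc_sides[OF l(1)]])
      (simp add: Delta_U1_tpow tmap_tpure l clin tassoc_tpure)
  have 2: "lslice eps_U1 (Delta_U1 x) = x" for x
    by (rule laurent_linear_eqI[OF clinear_compose[OF l(1) clinear_lslice[OF l(2)]] clinear_ident])
      (simp add: Delta_U1_tpow lslice_tpure l eps_U1_tpow)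
  have 3: "rslice eps_U1 (Delta_U1 x) = x" for x
    by (rule laurent_linear_eqI[OF clinear_compose[OF l(1) clinear_rslice[OF l(2)]] clinear_ident])
      (simp add: Delta_U1_tpow rslice_tpure l eps_U1_tpow)
  note a = clinear_antipode_U1 clinear_ident[where 'a = laurent]
  have r: "clinear (\<lambda>x. eps_U1 x *\<^sub>C (1 :: laurent))" by (intro clin l)
  have 4: "tlift (\<lambda>a b. antipode_U1 a * b) (Delta_U1 x) = eps_U1 x *\<^sub>C 1" for x
    by (rule laurent_linear_eqI[OF clinear_compose[OF l(1) clinear_tprod[OF a(1,2)]] r])
      (simp add: Delta_U1_tpow tprod_tpure[OF a(1,2)] antipode_U1_tpow eps_U1_tpow
          tpow_add[symmetric] tpow_zero)
  have 5: "tlift (\<lambda>a b. a * antipode_U1 b) (Delta_U1 x) = eps_U1 x *\<^sub>C 1" for x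
    by (rule laurent_linear_eqI[OF clinear_compose[OF l(1) clinear_tprod[OF a(2,1)]] r])
      (simp add: Delta_U1_tpow tprod_tpure[OF a(2,1)] antipode_U1_tpow eps_U1_tpow
          tpow_add[symmetric] tpow_zero)
  show ?thesis
    unfolding hopf_algebra_def bialgebra_def
    using 1 2 3 4 5 by (auto simp: alg_hom_Delta_U1 alg_hom_eps_U1 clinear_antipode_U1 lslice_def rslice_def)
qed

text \<open>On the k-th power of the generator the second leg is t^(-k) t^k = 1. Hence every
  subspace of Laurent polynomials is stable under the adjoint coaction.\<close>

lemma Ad_R_U1: "Ad_R Delta_U1 antipode_U1 h = h \<otimes>\<^sub>t 1"
proof -
  note l = alg_homD(1)[OF alg_hom_Delta_U1]
  have b: "cbilinear (\<lambda>h2 h3. h2 \<otimes>\<^sub>t (c * h3))" for c :: laurent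
    by (intro clin cbilinearI)
  have b': "cbilinear (\<lambda>h1 h'. tlift (\<lambda>h2 h3. h2 \<otimes>\<^sub>t (antipode_U1 h1 * h3)) (Delta_U1 h'))"
    by (intro cbilinearI clin b l clinear_tlift_param clinear_antipode_U1)
  have r: "clinear (\<lambda>h::laurent. h \<otimes>\<^sub>t (1::laurent))" by (intro clin)
  show ?thesis
    unfolding Ad_R_def
    by (rule laurent_linear_eqI[OF clinear_compose[OF l clinear_tlift[OF b']] r])
      (simp add: Delta_U1_tpow tlift_tpure[OF b'] tlift_tpure[OF b] antipode_U1_tpow
          tpow_add[symmetric] tpow_zero)
qed

definition laurent_eval :: "complex \<Rightarrow> laurent \<Rightarrow> complex" where
  "laurent_eval z = linext (\<lambda>k. z powi k)"

lemma laurent_eval_tpow [simp]: "laurent_eval z (tpow k) = z powi k"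
  by (simp add: laurent_eval_def)

lemma alg_hom_laurent_eval: "z \<noteq> 0 \<Longrightarrow> alg_hom (laurent_eval z)"
  unfolding laurent_eval_def
  by (rule alg_hom_laurentI) (auto simp: clinear_linext tpow_zero[symmetric] power_int_add)

section \<open>Universal property of presented algebras\<close>

lemma alg_hom_prod_list: "alg_hom f \<Longrightarrow> f (prod_list xs) = prod_list (map f xs)"
  by (induction xs) (simp_all add: alg_homD)

lemma alg_hom_free_eval: "alg_hom (free_eval U)"
proof -
  have l: "clinear (free_eval U)" unfolding free_eval_def by (rule clinear_linext)
  have s: "free_eval U (Poly_Mapping.single w c) = c *\<^sub>C prod_list (map U (letters w))" for w c
    by (simp add: free_eval_def)
  have "free_eval U (x * y) = free_eval U x * free_eval U y" for x y
  proof (induction x rule: poly_mapping_add_induct)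
    case x: (single w c)
    show ?case
      by (induction y rule: poly_mapping_add_induct)
        (simp_all add: clinearD[OF l] s mult_single plus_fword_def distrib_left
          mult_scaleC_left mult_scaleC_right scaleC_scaleC)
  qed (simp_all add: clinearD[OF l] distrib_right)
  moreover have "free_eval U 1 = 1"
    using s[of 0 1] by (simp add: zero_fword_def flip: single_one)
  ultimately show ?thesis using l by (simp add: alg_hom_def)
qed

lemma free_eval_gen [simp]: "free_eval U (free_gen x) = U x"
  by (simp add: free_eval_def free_gen_def)

lemma free_on_mult: "f \<in> free_on X \<Longrightarrow> g \<in> free_on X \<Longrightarrow> f * g \<in> free_on X"
  unfolding free_on_def using keys_mult[of f g] by (fastforce simp: plus_fword_def)

lemma free_on_add: "f \<in> free_on X \<Longrightarrow> g \<in> free_on X \<Longrightarrow> f + g \<in> free_on X"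
  unfolding free_on_def using Poly_Mapping.keys_add[of f g] by auto

lemma free_on_scale: "f \<in> free_on X \<Longrightarrow> c *\<^sub>C f \<in> free_on X"
  unfolding free_on_def by (auto simp: in_keys_iff lookup_scaleC)

lemma free_on_one: "1 \<in> free_on X"
  unfolding free_on_def by (auto simp: zero_fword_def)

lemma free_on_gen: "x \<in> X \<Longrightarrow> free_gen x \<in> free_on X"
  unfolding free_on_def free_gen_def by auto

lemma free_on_diff: "f \<in> free_on X \<Longrightarrow> g \<in> free_on X \<Longrightarrow> f - g \<in> free_on X"
  unfolding free_on_def using Poly_Mapping.keys_diff[of f g] by auto

text \<open>\<open>free_eval U\<close> vanishes on the ideal generated by B, which is the kernel of
  \<open>free_eval u\<close> on \<open>free_on X\<close>, so it factors through the presented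
  algebra.\<close>

lemma presented_algebra_hom:
  fixes U :: "'x \<Rightarrow> 'b::complex_algebra_1" and u :: "'x \<Rightarrow> 'a::complex_algebra_1"
  assumes p: "presented_algebra X B u" and B: "\<And>b. b \<in> B \<Longrightarrow> free_eval U b = 0"
  obtains F where "alg_hom F" "\<And>x. x \<in> X \<Longrightarrow> F (u x) = U x"
proof -
  note ehu = alg_homD[OF alg_hom_free_eval[of u]] and ehU = alg_homD[OF alg_hom_free_eval[of U]]
  have surj: "\<exists>f\<in>free_on X. free_eval u f = a" for a
  proof -
    have "a \<in> free_eval u ` free_on X" using p by (simp add: presented_algebra_def)
    then show ?thesis by blast
  qed
  have ker: "free_eval U f = 0" if "f \<in> free_on X" "free_eval u f = 0" for f
  proof -
    have "f \<in> ideal_gen_in (free_on X) B"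
      using p that unfolding presented_algebra_def by blast
    then have "free_eval U f \<in> {0}"
      unfolding ideal_gen_in_def
      by (rule cspan_image_subset[OF ehU(1)])
        (auto simp: ehU B complex_vector.subspace_def)
    then show ?thesis by simp
  qed
  have wd: "free_eval U f = free_eval U g"
    if "f \<in> free_on X" "g \<in> free_on X" "free_eval u f = free_eval u g" for f g
    using ker[of "f - g"] that by (simp add: free_on_diff ehu ehU)
  define rep where "rep a = (SOME f. f \<in> free_on X \<and> free_eval u f = a)" for a
  have rep: "rep a \<in> free_on X" "free_eval u (rep a) = a" for a
    using someI_ex[of "\<lambda>f. f \<in> free_on X \<and> free_eval u f = a"] surj[of a] by (auto simp: rep_def)
  define F where "F a = free_eval U (rep a)" for a
  have F: "F (free_eval u f) = free_eval U f" if "f \<in> free_on X" for f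
    unfolding F_def by (rule wd) (simp_all add: rep that)
  have "alg_hom F"
    unfolding alg_hom_def
  proof (intro conjI allI clinearI)
    fix x y c
    show "F (x + y) = F x + F y"
      using F[of "rep x + rep y"] by (simp add: rep free_on_add ehu ehU F_def)
    show "F (x * y) = F x * F y"
      using F[of "rep x * rep y"] by (simp add: rep free_on_mult ehu ehU F_def)
    show "F (c *\<^sub>C x) = c *\<^sub>C F x"
      using F[of "c *\<^sub>C rep x"] by (simp add: rep free_on_scale ehu ehU F_def)
    show "F 1 = 1"
      using F[of 1] by (simp add: free_on_one ehu ehU)
  qed
  moreover have "F (u x) = U x" if "x \<in> X" for x
    using F[of "free_gen x"] that by (simp add: free_on_gen)
  ultimately show ?thesis by (rule that)
qed

text \<open>Words are built up from the right, so closure under right multiplication by generators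
  suffices. This suits right ideals and the way in which \<open>Q (h * g)\<close> is computed from
  the matrix of h.\<close>

lemma presented_algebra_induct:
  fixes u :: "'x \<Rightarrow> 'a::complex_algebra_1"
  assumes p: "presented_algebra X B u" and A: "csubspace A" "1 \<in> A"
    "\<And>a x. a \<in> A \<Longrightarrow> x \<in> X \<Longrightarrow> a * u x \<in> A"
  shows "a \<in> A"
proof -
  have "a \<in> free_eval u ` free_on X" using p by (simp add: presented_algebra_def)
  then obtain f where f: "f \<in> free_on X" "free_eval u f = a" by blast
  have w: "prod_list (map u xs) \<in> A" if "set xs \<subseteq> X" for xs
    using that by (induction xs rule: rev_induct) (simp_all add: A)
  have "linext (\<lambda>w. prod_list (map u (letters w))) f \<in> A"
    unfolding linext_def
    by (intro complex_vector.subspace_sum[OF A(1)] complex_vector.subspace_scale[OF A(1)] w)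
      (use f(1) in \<open>auto simp: free_on_def\<close>)
  with f(2) show ?thesis by (simp add: free_eval_def)
qed

lemma presented_algebra_hom_eqI:
  assumes p: "presented_algebra X B u" and "alg_hom f" "alg_hom g" "\<And>x. x \<in> X \<Longrightarrow> f (u x) = g (u x)"
  shows "f a = g a"
proof -
  have "a \<in> {a. f a = g a}"
    by (rule presented_algebra_induct[OF p])
      (use assms in \<open>auto simp: alg_homD complex_vector.subspace_def\<close>)
  then show ?thesis by simp
qed

section \<open>Torus actions and antipodes on quantum special unitary groups\<close>

lemma presented_algebra_rel:
  assumes "presented_algebra X B u" "b \<in> B"
  shows "free_eval u b = 0"
proof -
  have "1 * b * 1 \<in> ideal_gen_in (free_on X) B"
    unfolding ideal_gen_in_def by (rule complex_vector.span_base) (use assms(2) free_on_one in blast)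
  then show ?thesis using assms(1) unfolding presented_algebra_def by auto
qed

lemma free_eval_qmat_relation:
  "free_eval (\<lambda>(i, j). U i j) (qmat_relation n q a c b d) =
     (\<Sum>w=1..n. \<Sum>x=1..n. Rmat q a c w x *\<^sub>C (U w b * U x d))
     - (\<Sum>y=1..n. \<Sum>z=1..n. Rmat q y z b d *\<^sub>C (U a y * U c z))"
  by (simp add: qmat_relation_def alg_homD[OF alg_hom_free_eval])

lemma free_eval_qdet:
  "free_eval (\<lambda>(i, j). U i j) (qdet n q) = (\<Sum>\<pi> | \<pi> permutes {1..n}.
     ((- complex_of_real q) ^ perm_length n \<pi>) *\<^sub>C prod_list (map (\<lambda>i. U i (\<pi> i)) [1..<n + 1]))"
  by (simp add: qdet_def alg_homD[OF alg_hom_free_eval] alg_hom_prod_list[OF alg_hom_free_eval] o_def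
      del: upt_Suc)

lemma Rmat_nonzeroD: "Rmat q i k j l \<noteq> 0 \<Longrightarrow> i = l \<and> k = j \<or> i = j \<and> k = l"
  by (auto simp: Rmat_def split: if_splits)

lemma quantum_SU_induct [consumes 1, case_names subspace one mult]:
  assumes "quantum_SU n q u \<Delta> \<epsilon> S" "csubspace A" "1 \<in> A"
    "\<And>a i j. a \<in> A \<Longrightarrow> i \<in> {1..n} \<Longrightarrow> j \<in> {1..n} \<Longrightarrow> a * u i j \<in> A"
  shows "a \<in> A"
  using assms(1) unfolding quantum_SU_def
  by (elim conjE presented_algebra_induct) (use assms in auto)

lemma quantum_SU_hom_eqI:
  assumes "quantum_SU n q u \<Delta> \<epsilon> S" "alg_hom f" "alg_hom g"
    "\<And>i j. i \<in> {1..n} \<Longrightarrow> j \<in> {1..n} \<Longrightarrow> f (u i j) = g (u i j)"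
  shows "f a = g a"
proof -
  have "presented_algebra ({1..n} \<times> {1..n}) (qmat_relations n q \<union> {qdet n q - 1}) (\<lambda>(i, j). u i j)"
    using assms(1) by (simp add: quantum_SU_def)
  then show ?thesis
    by (rule presented_algebra_hom_eqI[OF _ assms(2,3)]) (use assms(4) in auto)
qed

lemma prod_list_tpure_tpow:
  "prod_list (map (\<lambda>i. x i \<otimes>\<^sub>t tpow (e i)) is) = prod_list (map x is) \<otimes>\<^sub>t tpow (\<Sum>i\<leftarrow>is. e i)"
  by (induction "is") (simp_all add: one_tensor_def tpow_zero tensor_mult_pure tpow_add)

text \<open>The two-sided action of the diagonal torus, \<open>v\<^sup>i\<^sub>j \<mapsto> v\<^sup>i\<^sub>j t\<^bsup>b\<^sub>j - a\<^sub>i\<^esup>\<close>, respects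
  the relations because the R-matrix preserves weights.\<close>

lemma quantum_SU_torus:
  fixes a b :: "nat \<Rightarrow> int" and v :: "nat \<Rightarrow> nat \<Rightarrow> 'k::complex_algebra_1"
  assumes K: "quantum_SU n q v \<Delta> \<epsilon> S" and ab: "sum a {1..n} = sum b {1..n}"
  obtains F :: "'k \<Rightarrow> ('k, laurent) tensor" where "alg_hom F"
    "\<And>i j. i \<in> {1..n} \<Longrightarrow> j \<in> {1..n} \<Longrightarrow> F (v i j) = v i j \<otimes>\<^sub>t tpow (b j - a i)"
proof -
  let ?X = "{1..n} \<times> {1..n}" and ?B = "qmat_relations n q \<union> {qdet n q - 1}"
  have p: "presented_algebra ?X ?B (\<lambda>(i, j). v i j)"
    using K by (simp add: quantum_SU_def)
  define U where "U i j = v i j \<otimes>\<^sub>t tpow (b j - a i)" for i j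
  have 1: "free_eval (\<lambda>(i, j). U i j) (qmat_relation n q i k j l) = 0"
    if "{i, k, j, l} \<subseteq> {1..n}" for i k j l
  proof -
    let ?T = "tpow (b j + b l - a i - a k)"
    have *: "Rmat q i k w x *\<^sub>C (U w j * U x l) = (Rmat q i k w x *\<^sub>C (v w j * v x l)) \<otimes>\<^sub>t ?T" for w x
    proof (cases "Rmat q i k w x = 0")
      case False
      have e: "b j - a w + (b l - a x) = b j + b l - a i - a k"
        using Rmat_nonzeroD[OF False] by auto
      show ?thesis
        by (simp only: U_def tensor_mult_pure tpow_add[symmetric] tpure_scale_left e)
    qed simp
    have **: "Rmat q y z j l *\<^sub>C (U i y * U k z) = (Rmat q y z j l *\<^sub>C (v i y * v k z)) \<otimes>\<^sub>t ?T" for y z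
    proof (cases "Rmat q y z j l = 0")
      case False
      have e: "b y - a i + (b z - a k) = b j + b l - a i - a k"
        using Rmat_nonzeroD[OF False] by auto
      show ?thesis
        by (simp only: U_def tensor_mult_pure tpow_add[symmetric] tpure_scale_left e)
    qed simp
    have "free_eval (\<lambda>(i, j). U i j) (qmat_relation n q i k j l)
        = free_eval (\<lambda>(i, j). v i j) (qmat_relation n q i k j l) \<otimes>\<^sub>t ?T"
      unfolding free_eval_qmat_relation * **
      by (simp add: tpure_sum_left tpure_diff_left)
    moreover have "free_eval (\<lambda>(i, j). v i j) (qmat_relation n q i k j l) = 0"
      by (rule presented_algebra_rel[OF p]) (use that in \<open>auto simp: qmat_relations_def\<close>)
    ultimately show ?thesis by simp
  qed
  have 2: "free_eval (\<lambda>(i, j). U i j) (qdet n q - 1) = 0"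
  proof -
    \<comment> \<open>A determinant monomial has one factor in each row and each column, so its
      exponents add up to the sum of b minus the sum of a. The hypothesis \<open>ab\<close> makes
      this zero, and the determinant stays 1.\<close>
    have *: "prod_list (map (\<lambda>i. U i (\<pi> i)) [1..<n + 1]) = prod_list (map (\<lambda>i. v i (\<pi> i)) [1..<n + 1]) \<otimes>\<^sub>t 1"
      if "\<pi> permutes {1..n}" for \<pi>
    proof -
      have "(\<Sum>i\<leftarrow>[1..<n + 1]. b (\<pi> i) - a i) = (\<Sum>i=1..n. b (\<pi> i) - a i)"
        using sum.distinct_set_conv_list[of "[1..<n + 1]" "\<lambda>i. b (\<pi> i) - a i"]
        by (simp add: atLeastLessThanSuc_atLeastAtMost del: upt_Suc)
      also have "\<dots> = sum (\<lambda>i. b (\<pi> i)) {1..n} - sum b {1..n}"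
        by (simp only: sum_subtractf ab)
      also have "\<dots> = 0"
        using sum.permute[OF that, of b] by (simp add: o_def)
      finally show ?thesis
        unfolding U_def prod_list_tpure_tpow by (simp add: tpow_zero del: upt_Suc)
    qed
    have "free_eval (\<lambda>(i, j). U i j) (qdet n q) = free_eval (\<lambda>(i, j). v i j) (qdet n q) \<otimes>\<^sub>t 1"
      unfolding free_eval_qdet tpure_sum_left
      by (rule sum.cong) (simp_all only: * tpure_scale_left mem_Collect_eq)
    moreover have "free_eval (\<lambda>(i, j). v i j) (qdet n q - 1) = 0"
      by (rule presented_algebra_rel[OF p]) auto
    ultimately show ?thesis
      by (simp add: alg_homD[OF alg_hom_free_eval] one_tensor_def)
  qed
  obtain F where F: "alg_hom F" "\<And>x. x \<in> ?X \<Longrightarrow> F ((\<lambda>(i, j). v i j) x) = (\<lambda>(i, j). U i j) x"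
    by (rule presented_algebra_hom[OF p, of "\<lambda>(i, j). U i j"]) (use 1 2 in \<open>auto simp: qmat_relations_def\<close>)
  show ?thesis
    by (rule that[OF F(1)]) (use F(2) in \<open>force simp: U_def\<close>)
qed

section \<open>Inverse matrices, corepresentations and their antipodes\<close>

lemma of_bool_sum_simps [simp]:
  fixes g :: "'i \<Rightarrow> 'a::ring_1"
  assumes "finite I"
  shows "(\<Sum>k\<in>I. of_bool (i = k) * g k) = (if i \<in> I then g i else 0)"
    "(\<Sum>k\<in>I. of_bool (k = i) * g k) = (if i \<in> I then g i else 0)"
    "(\<Sum>k\<in>I. g k * of_bool (i = k)) = (if i \<in> I then g i else 0)"
    "(\<Sum>k\<in>I. g k * of_bool (k = i)) = (if i \<in> I then g i else 0)"
proof -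
  have 1: "of_bool (i = k) * g k = (if i = k then g k else 0)" "of_bool (k = i) * g k = (if k = i then g k else 0)"
    "g k * of_bool (i = k) = (if i = k then g k else 0)" "g k * of_bool (k = i) = (if k = i then g k else 0)" for k
    by auto
  show "(\<Sum>k\<in>I. of_bool (i = k) * g k) = (if i \<in> I then g i else 0)"
    "(\<Sum>k\<in>I. of_bool (k = i) * g k) = (if i \<in> I then g i else 0)"
    "(\<Sum>k\<in>I. g k * of_bool (i = k)) = (if i \<in> I then g i else 0)"
    "(\<Sum>k\<in>I. g k * of_bool (k = i)) = (if i \<in> I then g i else 0)"
    unfolding 1 using assms by simp_all
qed

text \<open>W = W (M M') = (W M) M' = M', over a ring that need not be commutative.\<close>

lemma matrix_inverse_unique:
  fixes W M M' :: "'i \<Rightarrow> 'i \<Rightarrow> 'a::ring_1"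
  assumes "finite I"
    and WM: "\<And>i j. i \<in> I \<Longrightarrow> j \<in> I \<Longrightarrow> (\<Sum>k\<in>I. W i k * M k j) = of_bool (i = j)"
    and MM: "\<And>i j. i \<in> I \<Longrightarrow> j \<in> I \<Longrightarrow> (\<Sum>k\<in>I. M i k * M' k j) = of_bool (i = j)"
    and ij: "i \<in> I" "j \<in> I"
  shows "W i j = M' i j"
proof -
  have "W i j = (\<Sum>k\<in>I. W i k * of_bool (k = j))" using assms by simp
  also have "\<dots> = (\<Sum>k\<in>I. W i k * (\<Sum>l\<in>I. M k l * M' l j))"
    by (rule sum.cong) (simp_all add: MM ij)
  also have "\<dots> = (\<Sum>l\<in>I. \<Sum>k\<in>I. W i k * (M k l * M' l j))"
    by (simp add: sum_distrib_left) (rule sum.swap)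
  also have "\<dots> = (\<Sum>l\<in>I. (\<Sum>k\<in>I. W i k * M k l) * M' l j)"
    by (simp add: sum_distrib_right mult.assoc)
  also have "\<dots> = (\<Sum>l\<in>I. of_bool (i = l) * M' l j)"
    by (rule sum.cong) (simp_all add: WM ij)
  finally show ?thesis using assms by simp
qed

text \<open>A matrix of coefficients, kept apart from \<open>u\<close> so that the transposed
  antipode matrix and its iterate are covered by the same lemmas.\<close>

definition corep ::
  "('g::complex_algebra_1 \<Rightarrow> ('g, 'g) tensor) \<Rightarrow> ('g \<Rightarrow> complex) \<Rightarrow> 'i set \<Rightarrow> ('i \<Rightarrow> 'i \<Rightarrow> 'g) \<Rightarrow> bool" where
  "corep \<Delta> \<epsilon> I y \<longleftrightarrow> finite I \<and>
     (\<forall>i\<in>I. \<forall>j\<in>I. \<Delta> (y i j) = (\<Sum>k\<in>I. y i k \<otimes>\<^sub>t y k j) \<and> \<epsilon> (y i j) = of_bool (i = j))"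

lemma quantum_SU_corep: "quantum_SU n q u \<Delta> \<epsilon> S \<Longrightarrow> corep \<Delta> \<epsilon> {1..n} u"
  by (simp add: quantum_SU_def corep_def)

lemma hopf_algebraD:
  assumes "hopf_algebra \<Delta> \<epsilon> S"
  shows "alg_hom \<Delta>" "alg_hom \<epsilon>" "clinear S" "tassoc (tmap \<Delta> (\<lambda>x. x) (\<Delta> x)) = tmap (\<lambda>x. x) \<Delta> (\<Delta> x)"
    "lslice \<epsilon> (\<Delta> x) = x" "rslice \<epsilon> (\<Delta> x) = x"
    "tlift (\<lambda>a b. S a * b) (\<Delta> x) = \<epsilon> x *\<^sub>C 1" "tlift (\<lambda>a b. a * S b) (\<Delta> x) = \<epsilon> x *\<^sub>C 1"
  using assms by (simp_all add: hopf_algebra_def bialgebra_def lslice_def rslice_def id_def)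

lemma corep_antipode_mult:
  assumes H: "hopf_algebra \<Delta> \<epsilon> S" and y: "corep \<Delta> \<epsilon> I y" and ij: "i \<in> I" "j \<in> I"
  shows "(\<Sum>k\<in>I. S (y i k) * y k j) = of_bool (i = j)" "(\<Sum>k\<in>I. y i k * S (y k j)) = of_bool (i = j)"
proof -
  note h = hopf_algebraD[OF H]
  have *: "\<Delta> (y i j) = (\<Sum>k\<in>I. y i k \<otimes>\<^sub>t y k j)" "\<epsilon> (y i j) = of_bool (i = j)"
    using y ij by (auto simp: corep_def)
  show "(\<Sum>k\<in>I. S (y i k) * y k j) = of_bool (i = j)"
    using h(7)[of "y i j"] unfolding *
    by (simp add: clinearD[OF clinear_tprod[OF h(3) clinear_ident]] tprod_tpure[OF h(3) clinear_ident])
  show "(\<Sum>k\<in>I. y i k * S (y k j)) = of_bool (i = j)"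
    using h(8)[of "y i j"] unfolding *
    by (simp add: clinearD[OF clinear_tprod[OF clinear_ident h(3)]] tprod_tpure[OF clinear_ident h(3)])
qed

lemma alg_hom_of_bool: "alg_hom f \<Longrightarrow> f (of_bool P) = of_bool P"
  by (cases P) (simp_all add: alg_homD)

text \<open>The composite of f with S is in general not an algebra homomorphism. However, f(S(y)) is
  a right inverse of the matrix f(y), hence equal to any left inverse W that can be guessed.\<close>

lemma alg_hom_antipode_corep:
  fixes f :: "'g::complex_algebra_1 \<Rightarrow> 'b::complex_algebra_1"
  assumes H: "hopf_algebra \<Delta> \<epsilon> S" and y: "corep \<Delta> \<epsilon> I y" and f: "alg_hom f"
    and W: "\<And>i j. i \<in> I \<Longrightarrow> j \<in> I \<Longrightarrow> (\<Sum>k\<in>I. W i k * f (y k j)) = of_bool (i = j)"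
    and ij: "i \<in> I" "j \<in> I"
  shows "f (S (y i j)) = W i j"
proof (rule sym, rule matrix_inverse_unique[of I W "\<lambda>i j. f (y i j)" "\<lambda>i j. f (S (y i j))"])
  show "finite I" using y by (simp add: corep_def)
  fix i j assume ij: "i \<in> I" "j \<in> I"
  show "(\<Sum>k\<in>I. W i k * f (y k j)) = of_bool (i = j)" by (rule W[OF ij])
  show "(\<Sum>k\<in>I. f (y i k) * f (S (y k j))) = of_bool (i = j)"
    using arg_cong[OF corep_antipode_mult(2)[OF H y ij], of f]
    by (simp add: alg_homD[OF f] alg_hom_of_bool[OF f])
qed (rule ij)+

text \<open>The antipode reverses the coproduct, which explains the transposition. The expected
  coproduct of S(y) is verified to be a left inverse of the matrix of coproducts of y.\<close>

lemma corep_antipode: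
  assumes H: "hopf_algebra \<Delta> \<epsilon> S" and y: "corep \<Delta> \<epsilon> I y"
  shows "corep \<Delta> \<epsilon> I (\<lambda>i j. S (y j i))"
proof -
  note h = hopf_algebraD[OF H]
  have fin: "finite I" using y by (simp add: corep_def)
  have D: "\<Delta> (S (y i j)) = (\<Sum>k\<in>I. S (y k j) \<otimes>\<^sub>t S (y i k))" if ij: "i \<in> I" "j \<in> I" for i j
  proof (rule alg_hom_antipode_corep[OF H y h(1) _ ij])
    fix i j assume ij: "i \<in> I" "j \<in> I"
    have "(\<Sum>k\<in>I. (\<Sum>b\<in>I. S (y b k) \<otimes>\<^sub>t S (y i b)) * \<Delta> (y k j))
        = (\<Sum>k\<in>I. \<Sum>b\<in>I. \<Sum>a\<in>I. (S (y b k) * y k a) \<otimes>\<^sub>t (S (y i b) * y a j))"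
      using y ij by (intro sum.cong refl)
        (simp add: corep_def sum_product tensor_mult_pure)
    also have "\<dots> = (\<Sum>b\<in>I. \<Sum>k\<in>I. \<Sum>a\<in>I. (S (y b k) * y k a) \<otimes>\<^sub>t (S (y i b) * y a j))"
      by (rule sum.swap)
    also have "\<dots> = (\<Sum>b\<in>I. \<Sum>a\<in>I. \<Sum>k\<in>I. (S (y b k) * y k a) \<otimes>\<^sub>t (S (y i b) * y a j))"
      by (intro sum.cong refl sum.swap)
    also have "\<dots> = (\<Sum>b\<in>I. \<Sum>a\<in>I. of_bool (b = a) \<otimes>\<^sub>t (S (y i b) * y a j))"
      by (intro sum.cong refl) (simp only: tpure_sum_left[symmetric] corep_antipode_mult(1)[OF H y])
    also have "\<dots> = (\<Sum>b\<in>I. \<Sum>a\<in>I. if b = a then 1 \<otimes>\<^sub>t (S (y i b) * y a j) else 0)"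
      by (intro sum.cong refl) auto
    also have "\<dots> = (\<Sum>b\<in>I. 1 \<otimes>\<^sub>t (S (y i b) * y b j))"
      using fin by simp
    also have "\<dots> = 1 \<otimes>\<^sub>t of_bool (i = j)"
      by (simp only: tpure_sum_right[symmetric] corep_antipode_mult(1)[OF H y ij])
    also have "\<dots> = of_bool (i = j)" by (simp add: one_tensor_def)
    finally show "(\<Sum>k\<in>I. (\<Sum>b\<in>I. S (y b k) \<otimes>\<^sub>t S (y i b)) * \<Delta> (y k j)) = of_bool (i = j)" .
  qed
  have e: "\<epsilon> (S (y i j)) = of_bool (i = j)" if ij: "i \<in> I" "j \<in> I" for i j
    by (rule alg_hom_antipode_corep[OF H y h(2) _ ij]) (use y fin in \<open>simp add: corep_def\<close>)
  show ?thesis using D e fin by (auto simp: corep_def)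
qed

section \<open>Codiagonal coactions and the canonical map\<close>

text \<open>The codiagonal coaction for two possibly different coactions, written as a product of
  two legs. The legs commute because Laurent polynomials do, so two multiplicative coactions give a
  multiplicative one.\<close>

definition codiag ::
  "('a::complex_algebra_1 \<Rightarrow> ('a, laurent) tensor) \<Rightarrow> ('b::complex_algebra_1 \<Rightarrow> ('b, laurent) tensor) \<Rightarrow>
    ('a, 'b) tensor \<Rightarrow> (('a, 'b) tensor, laurent) tensor" where
  "codiag \<rho> \<sigma> = tlift (\<lambda>a b. tmap (\<lambda>a. a \<otimes>\<^sub>t 1) (\<lambda>x. x) (\<rho> a) * tmap (\<lambda>b. 1 \<otimes>\<^sub>t b) (\<lambda>x. x) (\<sigma> b))"

lemma clinear_codiag_legs:
  assumes "clinear \<rho>" "clinear \<sigma>"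
  shows "clinear (\<lambda>a. tmap (\<lambda>a. a \<otimes>\<^sub>t 1) (\<lambda>x. x) (\<rho> a))" "clinear (\<lambda>b. tmap (\<lambda>b. 1 \<otimes>\<^sub>t b) (\<lambda>x. x) (\<sigma> b))"
proof -
  show "clinear (\<lambda>a. tmap (\<lambda>a. a \<otimes>\<^sub>t 1) (\<lambda>x. x) (\<rho> a))"
    by (rule clinear_compose[OF assms(1) clinear_tmap]; intro clin)
  show "clinear (\<lambda>b. tmap (\<lambda>b. 1 \<otimes>\<^sub>t b) (\<lambda>x. x) (\<sigma> b))"
    by (rule clinear_compose[OF assms(2) clinear_tmap]; intro clin)
qed

lemma codiag_tpure:
  assumes "clinear \<rho>" "clinear \<sigma>"
  shows "codiag \<rho> \<sigma> (a \<otimes>\<^sub>t b) = tmap (\<lambda>a. a \<otimes>\<^sub>t 1) (\<lambda>x. x) (\<rho> a) * tmap (\<lambda>b. 1 \<otimes>\<^sub>t b) (\<lambda>x. x) (\<sigma> b)"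
  unfolding codiag_def by (rule tprod_tpure) (rule clinear_codiag_legs[OF assms])+

lemma clinear_codiag: "clinear \<rho> \<Longrightarrow> clinear \<sigma> \<Longrightarrow> clinear (codiag \<rho> \<sigma>)"
  unfolding codiag_def by (rule clinear_tprod; rule clinear_codiag_legs)

lemma tmap_leg_tpure:
  "tmap (\<lambda>a. a \<otimes>\<^sub>t (1::'c::complex_algebra_1)) (\<lambda>x. x) (x \<otimes>\<^sub>t h) = (x \<otimes>\<^sub>t 1) \<otimes>\<^sub>t h"
  "tmap (\<lambda>b. (1::'c) \<otimes>\<^sub>t b) (\<lambda>x. x) (x \<otimes>\<^sub>t h) = (1 \<otimes>\<^sub>t x) \<otimes>\<^sub>t h"
  by (subst tmap_tpure; (intro clin)?; simp)+

lemma clinear_tmap_leg: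
  "clinear (tmap (\<lambda>a. a \<otimes>\<^sub>t (1::'c::complex_algebra_1)) (\<lambda>x. x))" "clinear (tmap (\<lambda>b. (1::'c) \<otimes>\<^sub>t b) (\<lambda>x. x))"
  by (intro clinear_tmap clin)+

lemma tmap_legs_commute:
  fixes X :: "('a::complex_algebra_1, laurent) tensor" and Y :: "('b::complex_algebra_1, laurent) tensor"
  shows "tmap (\<lambda>a. a \<otimes>\<^sub>t 1) (\<lambda>x. x) X * tmap (\<lambda>b. 1 \<otimes>\<^sub>t b) (\<lambda>x. x) Y
    = tmap (\<lambda>b. 1 \<otimes>\<^sub>t b) (\<lambda>x. x) Y * tmap (\<lambda>a. a \<otimes>\<^sub>t 1) (\<lambda>x. x) X"
proof (induction X rule: tensor_induct)
  case X: (pure a h)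
  show ?case
  proof (induction Y rule: tensor_induct)
    case (pure b k)
    show ?case by (simp add: tmap_leg_tpure tensor_mult_pure mult.commute)
  qed (simp add: clinearD[OF clinear_tmap_leg(2)] distrib_left distrib_right)
qed (simp add: clinearD[OF clinear_tmap_leg(1)] distrib_left distrib_right)

lemma alg_hom_codiag:
  assumes "alg_hom \<rho>" "alg_hom \<sigma>"
  shows "alg_hom (codiag \<rho> \<sigma>)"
  unfolding codiag_def
proof (rule alg_hom_tprod)
  show "alg_hom (\<lambda>a. tmap (\<lambda>a. a \<otimes>\<^sub>t 1) (\<lambda>x. x) (\<rho> a))"
    by (intro alg_hom_compose[OF assms(1)] alg_hom_tmap alg_hom_tpure_one alg_hom_ident(1))
  show "alg_hom (\<lambda>b. tmap (\<lambda>b. 1 \<otimes>\<^sub>t b) (\<lambda>x. x) (\<sigma> b))"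
    by (intro alg_hom_compose[OF assms(2)] alg_hom_tmap alg_hom_tpure_one alg_hom_ident(1))
qed (rule tmap_legs_commute)

lemma codiag_tpure_homogeneous:
  assumes "clinear \<rho>" "clinear \<sigma>" "\<rho> a = a \<otimes>\<^sub>t x" "\<sigma> b = b \<otimes>\<^sub>t y"
  shows "codiag \<rho> \<sigma> (a \<otimes>\<^sub>t b) = (a \<otimes>\<^sub>t b) \<otimes>\<^sub>t (x * y)"
  by (simp add: codiag_tpure assms tmap_leg_tpure tensor_mult_pure)

lemma diag_coaction_eq_codiag:
  assumes "clinear \<delta>"
  shows "diag_coaction \<delta> = codiag \<delta> \<delta>"
proof -
  have b: "cbilinear (\<lambda>g0 g1. (f0 \<otimes>\<^sub>t g0) \<otimes>\<^sub>t (f1 * g1))" for f0 :: 'a and f1 :: laurent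
    by (intro cbilinearI clin)
  have b': "cbilinear (\<lambda>f0 f1. tlift (\<lambda>g0 g1. (f0 \<otimes>\<^sub>t g0) \<otimes>\<^sub>t (f1 * g1)) Y)" for Y :: "('a, laurent) tensor"
    by (intro cbilinearI clinear_tlift_param b clin)
  have "tlift (\<lambda>f0 f1. tlift (\<lambda>g0 g1. (f0 \<otimes>\<^sub>t g0) \<otimes>\<^sub>t (f1 * g1)) Y) X
      = tmap (\<lambda>a. a \<otimes>\<^sub>t 1) (\<lambda>x. x) X * tmap (\<lambda>b. 1 \<otimes>\<^sub>t b) (\<lambda>x. x) Y" for X Y :: "('a, laurent) tensor"
  proof (induction X rule: tensor_induct)
    case X: (pure a h)
    show ?case
      unfolding tlift_tpure[OF b']
      by (induction Y rule: tensor_induct)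
        (simp_all add: tlift_tpure[OF b] tmap_leg_tpure tensor_mult_pure clinearD[OF clinear_tlift[OF b]]
          clinearD[OF clinear_tmap_leg(2)] distrib_left)
  qed (simp add: clinearD[OF clinear_tlift[OF b']] clinearD[OF clinear_tmap_leg(1)] distrib_right)
  then show ?thesis by (simp add: diag_coaction_def codiag_def)
qed

section \<open>The canonical map and its inverse\<close>

lemma tlift_mult_left:
  "tlift (\<lambda>g0 g1. (f * g0) \<otimes>\<^sub>t g1) x = (f \<otimes>\<^sub>t 1) * x"
proof -
  have b: "cbilinear (\<lambda>g0 g1. (f * g0) \<otimes>\<^sub>t g1)" by (intro cbilinearI clin)
  show ?thesis
    by (induction x rule: tensor_induct)
      (simp_all add: tlift_tpure[OF b] clinearD[OF clinear_tlift[OF b]] tensor_mult_pure distrib_left)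
qed

lemma ver_eq: "ver \<delta> = tlift (\<lambda>f g. (f \<otimes>\<^sub>t 1) * \<delta> g)"
  by (simp add: ver_def tlift_mult_left)

lemma clinear_tpure_one_left: "clinear (\<lambda>f. f \<otimes>\<^sub>t b)"
  by (intro clin)

lemma clinear_ver: "clinear \<delta> \<Longrightarrow> clinear (ver \<delta>)"
  unfolding ver_eq by (intro clinear_tprod clinear_tpure_one_left)

lemma ver_tpure: "clinear \<delta> \<Longrightarrow> ver \<delta> (f \<otimes>\<^sub>t g) = (f \<otimes>\<^sub>t 1) * \<delta> g"
  unfolding ver_eq by (intro tprod_tpure clinear_tpure_one_left)

lemma mult_tpure_one: "((a * b) \<otimes>\<^sub>t 1) * x = (a \<otimes>\<^sub>t 1) * ((b \<otimes>\<^sub>t 1) * x)"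
  by (simp add: tensor_mult_pure mult.assoc[symmetric])

lemma s_map_eq:
  fixes \<Delta> :: "'g::complex_algebra_1 \<Rightarrow> ('g, 'g) tensor"
  assumes S: "clinear S"
  shows "s_map \<Delta> S = tlift (\<lambda>a b. (a \<otimes>\<^sub>t 1) * tmap S (\<lambda>x. x) (\<Delta> b))"
proof -
  have b: "cbilinear (\<lambda>b1 b2. (a * S b1) \<otimes>\<^sub>t b2)" for a by (intro cbilinearI clin S)
  have "tlift (\<lambda>b1 b2. (a * S b1) \<otimes>\<^sub>t b2) x = (a \<otimes>\<^sub>t 1) * tmap S (\<lambda>x. x) x"
    for a and x :: "('g, 'g) tensor"
    by (induction x rule: tensor_induct)
      (simp_all add: tlift_tpure[OF b] clinearD[OF clinear_tlift[OF b]] tensor_mult_pure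
        distrib_left tmap_tpure S clinear_ident clinearD[OF clinear_tmap[OF S clinear_ident]])
  then show ?thesis by (simp add: s_map_def)
qed

context
  fixes \<Delta> :: "'g::complex_algebra_1 \<Rightarrow> ('g, 'g) tensor" and \<epsilon> S
  assumes H: "hopf_algebra \<Delta> \<epsilon> S"
begin

lemma clinear_s_map: "clinear (s_map \<Delta> S)"
  unfolding s_map_eq[OF hopf_algebraD(3)[OF H]]
  by (intro clinear_tprod clinear_tpure_one_left clinear_compose[OF alg_homD(1)[OF hopf_algebraD(1)[OF H]]]
      clinear_tmap hopf_algebraD(3)[OF H] clinear_ident)

lemma s_map_tpure: "s_map \<Delta> S (a \<otimes>\<^sub>t b) = (a \<otimes>\<^sub>t 1) * tmap S (\<lambda>x. x) (\<Delta> b)"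
  unfolding s_map_eq[OF hopf_algebraD(3)[OF H]]
  by (intro tprod_tpure clinear_tpure_one_left clinear_compose[OF alg_homD(1)[OF hopf_algebraD(1)[OF H]]]
      clinear_tmap hopf_algebraD(3)[OF H] clinear_ident)

text \<open>By coassociativity f(b1) h(b2) tensor b3 collapses to 1 tensor b. The choices f = S, h =
  id and f = id, h = S give the two halves of the mutual inversion of \<open>ver\<close> and
  \<open>s_map\<close>.\<close>

lemma convolution_cancel:
  assumes f: "clinear f" and h: "clinear h"
    and inv: "\<And>x. tlift (\<lambda>a b. f a * h b) (\<Delta> x) = \<epsilon> x *\<^sub>C 1"
  shows "tlift (\<lambda>c z. (f c \<otimes>\<^sub>t 1) * tmap h (\<lambda>x. x) z) (tmap (\<lambda>x. x) \<Delta> (\<Delta> b)) = 1 \<otimes>\<^sub>t b"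
proof -
  note D = alg_homD(1)[OF hopf_algebraD(1)[OF H]] and e = alg_homD(1)[OF hopf_algebraD(2)[OF H]]
  define G where "G = tlift (\<lambda>c z. (f c \<otimes>\<^sub>t (1::'g)) * tmap h (\<lambda>x. x) z)"
  have fl: "clinear (\<lambda>c. f c \<otimes>\<^sub>t (1::'g))" by (intro clin f)
  have hl: "clinear (tmap h (\<lambda>x::'g. x))" by (intro clinear_tmap clin h)
  have Gl: "clinear G" unfolding G_def by (rule clinear_tprod[OF fl hl])
  have Gp: "G (c \<otimes>\<^sub>t z) = (f c \<otimes>\<^sub>t 1) * tmap h (\<lambda>x. x) z" for c z
    unfolding G_def by (rule tprod_tpure[OF fl hl])
  have m: "clinear (tlift (\<lambda>a b. f a * h b))" by (rule clinear_tprod[OF f h])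
  have *: "G (tassoc (x \<otimes>\<^sub>t e)) = tlift (\<lambda>a b. f a * h b) x \<otimes>\<^sub>t e" for x e
    by (induction x rule: tensor_induct)
      (simp_all add: tassoc_tpure Gp tmap_tpure h clinear_ident tensor_mult_pure tprod_tpure[OF f h]
        tpure_add_left clinearD[OF clinear_tassoc] clinearD[OF Gl] clinearD[OF m])
  have "G (tmap (\<lambda>x. x) \<Delta> (\<Delta> b)) = G (tassoc (tmap \<Delta> (\<lambda>x. x) (\<Delta> b)))"
    by (simp add: hopf_algebraD(4)[OF H])
  also have "\<dots> = 1 \<otimes>\<^sub>t lslice \<epsilon> (\<Delta> b)"
    by (rule clinear_tensor_eqI[where f = "\<lambda>x. G (tassoc (tmap \<Delta> (\<lambda>x. x) x))" and g = "\<lambda>x. 1 \<otimes>\<^sub>t lslice \<epsilon> x"])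
      (auto intro!: clinear_compose[OF _ Gl] clinear_compose[OF _ clinear_tassoc] clinear_tmap D clinear_ident
        clinear_tpure_right clinear_lslice e
        simp: tmap_tpure D clinear_ident * inv lslice_tpure e tpure_scale_left tpure_scale_right)
  finally show ?thesis by (simp add: G_def hopf_algebraD(5)[OF H])
qed

lemma ver_s_map: "ver \<Delta> (s_map \<Delta> S x) = x"
proof -
  note D = alg_homD(1)[OF hopf_algebraD(1)[OF H]] and S = hopf_algebraD(3)[OF H]
  have fl: "clinear (\<lambda>c. S c \<otimes>\<^sub>t (1::'g))" by (intro clin S)
  have hl: "clinear (tmap (\<lambda>x::'g. x) (\<lambda>x::'g. x))" by (intro clinear_tmap clin)
  have l: "clinear (\<lambda>y. tlift (\<lambda>c z. (S c \<otimes>\<^sub>t 1) * tmap (\<lambda>x. x) (\<lambda>x. x) z) (tmap (\<lambda>x. x) \<Delta> y))"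
    by (intro clinear_compose[OF clinear_tmap clinear_tprod] fl hl clin D)
  have tid: "tmap (\<lambda>x. x) (\<lambda>x. x) y = y" for y :: "('g, 'g) tensor"
    by (induction y rule: tensor_induct) (simp_all add: tmap_tpure clinear_ident clinearD[OF hl])
  have tp: "tlift (\<lambda>c z. (S c \<otimes>\<^sub>t 1) * tmap (\<lambda>x. x) (\<lambda>x. x) z) (a \<otimes>\<^sub>t z) = (S a \<otimes>\<^sub>t 1) * z"
    for a and z :: "('g, 'g) tensor"
    by (subst tprod_tpure[OF fl hl]) (simp add: tid)
  have 1: "ver \<Delta> (tmap S (\<lambda>x. x) y) = tlift (\<lambda>c z. (S c \<otimes>\<^sub>t 1) * tmap (\<lambda>x. x) (\<lambda>x. x) z) (tmap (\<lambda>x. x) \<Delta> y)" for y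
    by (rule clinear_tensor_eqI[OF clinear_compose[OF clinear_tmap clinear_ver] l])
      (simp_all add: S D clinear_ident tmap_tpure ver_tpure tp)
  have 2: "ver \<Delta> ((a \<otimes>\<^sub>t 1) * y) = (a \<otimes>\<^sub>t 1) * ver \<Delta> y" for a y
    by (induction y rule: tensor_induct)
      (simp_all add: tensor_mult_pure ver_tpure D distrib_left clinearD[OF clinear_ver[OF D]] mult.assoc[symmetric])
  have *: "ver \<Delta> (s_map \<Delta> S (a \<otimes>\<^sub>t b)) = a \<otimes>\<^sub>t b" for a b
    unfolding s_map_tpure 2 1
    by (subst convolution_cancel) (simp_all add: S clinear_ident hopf_algebraD(7)[OF H] tensor_mult_pure)
  show ?thesis
    by (rule clinear_tensor_eqI[OF clinear_compose[OF clinear_s_map clinear_ver[OF D]] clinear_ident]) (rule *)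
qed

lemma s_map_ver: "s_map \<Delta> S (ver \<Delta> x) = x"
proof -
  note D = alg_homD(1)[OF hopf_algebraD(1)[OF H]] and S = hopf_algebraD(3)[OF H]
  have fl: "clinear (\<lambda>c. c \<otimes>\<^sub>t (1::'g))" by (intro clin)
  have hl: "clinear (tmap S (\<lambda>x::'g. x))" by (intro clinear_tmap clin S)
  have l: "clinear (\<lambda>y. tlift (\<lambda>c z. (c \<otimes>\<^sub>t 1) * tmap S (\<lambda>x. x) z) (tmap (\<lambda>x. x) \<Delta> y))"
    by (intro clinear_compose[OF clinear_tmap clinear_tprod] fl hl clin D)
  have 1: "s_map \<Delta> S y = tlift (\<lambda>c z. (c \<otimes>\<^sub>t 1) * tmap S (\<lambda>x. x) z) (tmap (\<lambda>x. x) \<Delta> y)" for y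
    by (rule clinear_tensor_eqI[OF clinear_s_map l])
      (simp add: S D clinear_ident tmap_tpure s_map_tpure tprod_tpure[OF fl hl])
  have 2: "s_map \<Delta> S ((a \<otimes>\<^sub>t 1) * y) = (a \<otimes>\<^sub>t 1) * s_map \<Delta> S y" for a y
  proof (induction y rule: tensor_induct)
    case (pure b c)
    show ?case by (simp add: tensor_mult_pure s_map_tpure mult_tpure_one)
  qed (simp_all add: distrib_left clinearD[OF clinear_s_map])
  have *: "s_map \<Delta> S (ver \<Delta> (a \<otimes>\<^sub>t b)) = a \<otimes>\<^sub>t b" for a b
  proof -
    have "s_map \<Delta> S (\<Delta> b) = 1 \<otimes>\<^sub>t b"
      unfolding 1 by (rule convolution_cancel) (simp_all add: S clinear_ident hopf_algebraD(8)[OF H])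
    then show ?thesis by (simp add: ver_tpure D 2 tensor_mult_pure)
  qed
  show ?thesis
    by (rule clinear_tensor_eqI[OF clinear_compose[OF clinear_ver[OF D] clinear_s_map] clinear_ident]) (rule *)
qed

lemma s_map_image_iff: "x \<in> s_map \<Delta> S ` A \<longleftrightarrow> ver \<Delta> x \<in> A"
  using ver_s_map s_map_ver by (metis imageE imageI)

lemma ver_mult_right: "ver \<Delta> (x * (1 \<otimes>\<^sub>t p)) = ver \<Delta> x * \<Delta> p"
proof -
  note D = hopf_algebraD(1)[OF H]
  show ?thesis
    by (induction x rule: tensor_induct)
      (simp_all add: tensor_mult_pure ver_tpure alg_homD[OF D] mult.assoc distrib_right
        clinearD[OF clinear_ver[OF alg_homD(1)[OF D]]])
qed

lemma ver_mult_left: "ver \<Delta> ((p \<otimes>\<^sub>t 1) * x) = (p \<otimes>\<^sub>t 1) * ver \<Delta> x"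
proof -
  note D = hopf_algebraD(1)[OF H]
  show ?thesis
  proof (induction x rule: tensor_induct)
    case (pure a b)
    show ?case by (simp add: tensor_mult_pure ver_tpure alg_homD[OF D] mult_tpure_one)
  qed (simp_all add: distrib_left clinearD[OF clinear_ver[OF alg_homD(1)[OF D]]])
qed

text \<open>The counit on the second leg collapses f g1 tensor g2 to f g, so membership in the
  universal calculus can be read off after applying the canonical map.\<close>

lemma rslice_counit_ver: "rslice \<epsilon> (ver \<Delta> x) = tlift (*) x"
proof -
  note D = alg_homD(1)[OF hopf_algebraD(1)[OF H]] and e = alg_homD(1)[OF hopf_algebraD(2)[OF H]]
  note m = clinear_tprod[OF clinear_ident clinear_ident] and mp = tprod_tpure[OF clinear_ident clinear_ident]
  have r: "rslice \<epsilon> ((f \<otimes>\<^sub>t 1) * y) = f * rslice \<epsilon> y" for f y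
    by (induction y rule: tensor_induct)
      (simp_all add: tensor_mult_pure rslice_tpure e clinearD[OF clinear_rslice[OF e]] distrib_left mult_scaleC_right)
  show ?thesis
    by (induction x rule: tensor_induct)
      (simp_all add: ver_tpure D r hopf_algebraD(6)[OF H] mp clinearD[OF m] clinearD[OF clinear_ver[OF D]]
        clinearD[OF clinear_rslice[OF e]])
qed

text \<open>Vertical parts for a quotient group are obtained from the canonical map of the whole
  group, where they are easier to control.\<close>

lemma ver_pushforward:
  fixes \<gamma> :: "'g \<Rightarrow> 'h::complex_algebra_1"
  assumes g: "alg_hom \<gamma>"
  shows "ver (\<lambda>x. tmap (\<lambda>x. x) \<gamma> (\<Delta> x)) x = tmap (\<lambda>x. x) \<gamma> (ver \<Delta> x)"
proof -
  note D = alg_homD(1)[OF hopf_algebraD(1)[OF H]]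
  note t = alg_hom_tmap[OF alg_hom_ident(1) g]
  have l: "clinear (\<lambda>x. tmap (\<lambda>x. x) \<gamma> (\<Delta> x))"
    unfolding comp_def by (rule clinear_compose[OF D alg_homD(1)[OF t]])
  have *: "tmap (\<lambda>x. x) \<gamma> ((f \<otimes>\<^sub>t 1) * y) = (f \<otimes>\<^sub>t 1) * tmap (\<lambda>x. x) \<gamma> y" for f y
    by (simp add: alg_homD(3)[OF t] tmap_tpure clinear_ident alg_homD[OF g])
  show ?thesis
    by (rule clinear_tensor_eqI[OF clinear_ver[OF l] clinear_compose[OF clinear_ver[OF D] alg_homD(1)[OF t]]])
      (simp add: ver_tpure l D *)
qed

end

lemma tsub_mult_left:
  assumes "x \<in> tsub UNIV I"
  shows "(p \<otimes>\<^sub>t 1) * x \<in> tsub UNIV I"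
  by (rule tsub_image_subset[OF _ assms, of "\<lambda>x. (p \<otimes>\<^sub>t 1) * x"])
    (intro clin, simp_all add: tensor_mult_pure tpure_in_tsub csubspace_tsub)

lemma tsub_mult_right:
  assumes "x \<in> tsub UNIV I" "right_ideal I"
  shows "x * y \<in> tsub UNIV I"
proof (induction y rule: tensor_induct)
  case (pure c d)
  show ?case
    by (rule tsub_image_subset[OF _ assms(1), of "\<lambda>x. x * (c \<otimes>\<^sub>t d)"])
      (intro clin, use assms(2) in \<open>simp_all add: right_ideal_def tensor_mult_pure tpure_in_tsub csubspace_tsub\<close>)
next
  case (add y z)
  then show ?case by (simp add: distrib_left complex_vector.subspace_add[OF csubspace_tsub])
qed

section \<open>The right ideal of the calculus\<close>

declare One_nat_def [simp del]

text \<open>With 1 in the second upper place the \<open>nu\<close> term would need an index below 1,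
  so only the permuting term survives. Together with the next lemma this is the triangularity of the
  two L-operators.\<close>

lemma Rmat_lower: "1 \<le> i \<Longrightarrow> Rmat q i 1 a m = (if i = 1 then complex_of_real q else 1) * of_bool (i = m) * of_bool (a = 1)"
  by (auto simp: Rmat_def)

lemma Rmat_upper: "1 \<le> b \<Longrightarrow> Rmat q b m j 1 = (if b = m then complex_of_real q else 1) * of_bool (b = 1) * of_bool (m = j)"
  by (auto simp: Rmat_def)

locale coquasitriangular_SU =
  fixes N :: nat and q :: real and qroot :: complex
    and u :: "nat \<Rightarrow> nat \<Rightarrow> 'g::complex_algebra_1"
    and \<Delta> :: "'g \<Rightarrow> ('g, 'g) tensor" and \<epsilon> :: "'g \<Rightarrow> complex" and S :: "'g \<Rightarrow> 'g"
    and r :: "('g, 'g) tensor \<Rightarrow> complex"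
  assumes N: "2 \<le> N" and q: "0 < q" and qroot: "qroot ^ N = complex_of_real q"
    and G: "quantum_SU N q u \<Delta> \<epsilon> S"
    and cqt: "coquasitriangular \<Delta> \<epsilon> r"
    and r_gen: "\<And>i j k l. i \<in> {1..N} \<Longrightarrow> j \<in> {1..N} \<Longrightarrow> k \<in> {1..N} \<Longrightarrow> l \<in> {1..N} \<Longrightarrow>
        r (u i j \<otimes>\<^sub>t u k l) = inverse qroot * Rmat q k i j l"
begin

declare atLeastAtMost_iff [simp del]

lemma one_index: "1 \<in> {1..N}"
  using N by (simp add: atLeastAtMost_iff)

lemma index_ge: "i \<in> {1..N} \<Longrightarrow> 1 \<le> i"
  by (simp add: atLeastAtMost_iff)

lemma hopf: "hopf_algebra \<Delta> \<epsilon> S"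
  using G by (simp add: quantum_SU_def)

lemmas Delta_hom = hopf_algebraD(1)[OF hopf]
lemmas counit_hom = hopf_algebraD(2)[OF hopf]

lemmas corep_u = quantum_SU_corep[OF G]
lemmas corep_Su = corep_antipode[OF hopf corep_u]

lemma counit_u: "i \<in> {1..N} \<Longrightarrow> j \<in> {1..N} \<Longrightarrow> \<epsilon> (u i j) = of_bool (i = j)"
  using corep_u by (simp add: corep_def)

lemma Delta_u: "i \<in> {1..N} \<Longrightarrow> j \<in> {1..N} \<Longrightarrow> \<Delta> (u i j) = (\<Sum>k=1..N. u i k \<otimes>\<^sub>t u k j)"
  using corep_u by (simp add: corep_def)

lemma qroot_nonzero: "qroot \<noteq> 0"
  using qroot q N by (auto simp: power_0_left)

section \<open>The coquasi-triangular structure on matrix coefficients\<close>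

lemma r_linear: "clinear r"
  using cqt by (simp add: coquasitriangular_def)

lemma r_linear_right: "clinear (\<lambda>x. r (f \<otimes>\<^sub>t x))" and r_linear_left: "clinear (\<lambda>x. r (x \<otimes>\<^sub>t f))"
  by (rule clinear_compose[OF _ r_linear], intro clin)+

lemma r_one: "r (1 \<otimes>\<^sub>t f) = \<epsilon> f" "r (f \<otimes>\<^sub>t 1) = \<epsilon> f"
  using cqt by (auto simp: coquasitriangular_def)

lemma r_mult_left:
  assumes "corep \<Delta> \<epsilon> I y" "i \<in> I" "j \<in> I"
  shows "r ((f * g) \<otimes>\<^sub>t y i j) = (\<Sum>k\<in>I. r (f \<otimes>\<^sub>t y i k) * r (g \<otimes>\<^sub>t y k j))"
proof -
  note l = r_linear_right[of f] r_linear_right[of g]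
  have "r ((f * g) \<otimes>\<^sub>t y i j) = tlift (\<lambda>h1 h2. r (f \<otimes>\<^sub>t h1) * r (g \<otimes>\<^sub>t h2)) (\<Delta> (y i j))"
    using cqt by (simp add: coquasitriangular_def)
  then show ?thesis
    using assms by (simp add: corep_def clinearD[OF clinear_tprod[OF l]] tprod_tpure[OF l])
qed

lemma r_mult_right:
  assumes "corep \<Delta> \<epsilon> I y" "i \<in> I" "j \<in> I"
  shows "r (y i j \<otimes>\<^sub>t (g * h)) = (\<Sum>k\<in>I. r (y i k \<otimes>\<^sub>t h) * r (y k j \<otimes>\<^sub>t g))"
proof -
  note l = r_linear_left[of h] r_linear_left[of g]
  have "r (y i j \<otimes>\<^sub>t (g * h)) = tlift (\<lambda>h1 h2. r (h1 \<otimes>\<^sub>t h) * r (h2 \<otimes>\<^sub>t g)) (\<Delta> (y i j))"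
    using cqt by (simp add: coquasitriangular_def)
  then show ?thesis
    using assms by (simp add: corep_def clinearD[OF clinear_tprod[OF l]] tprod_tpure[OF l])
qed

text \<open>\<open>W k a b l\<close> is the matrix coefficient \<open>g \<mapsto> L\<^sup>+(g\<^sub>(\<^sub>1\<^sub>))\<^sub>k\<^sub>a L\<^sup>-(g\<^sub>(\<^sub>2\<^sub>))\<^sub>b\<^sub>l\<close> of the two-sided action of the
  triangular L-operators, so that \<open>Q(h g) = L\<^sup>+(g\<^sub>(\<^sub>1\<^sub>)) Q(h) L\<^sup>-(g\<^sub>(\<^sub>2\<^sub>))\<close>.\<close>

definition W :: "nat \<Rightarrow> nat \<Rightarrow> nat \<Rightarrow> nat \<Rightarrow> ('g, 'g) tensor \<Rightarrow> complex" where
  "W k a b l = tlift (\<lambda>x y. r (u k a \<otimes>\<^sub>t x) * r (y \<otimes>\<^sub>t u b l))"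

lemma W_linear: "clinear (W k a b l)"
  unfolding W_def by (intro clinear_tprod r_linear_right r_linear_left)

lemma W_tpure: "W k a b l (x \<otimes>\<^sub>t y) = r (u k a \<otimes>\<^sub>t x) * r (y \<otimes>\<^sub>t u b l)"
  unfolding W_def by (intro tprod_tpure r_linear_right r_linear_left)

text \<open>Products in the second argument of r reverse the order of the matrices, products in the
  first argument keep it. So X acts on the inner indices c, d and Y on the outer indices k,
  l.\<close>

lemma W_mult:
  assumes "k \<in> {1..N}" "c \<in> {1..N}" "d \<in> {1..N}" "l \<in> {1..N}"
  shows "W k c d l (X * Y) = (\<Sum>a=1..N. \<Sum>b=1..N. W a c d b X * W k a b l Y)"
proof (induction X rule: tensor_induct)
  case X: (pure x1 x2)
  show ?case
  proof (induction Y rule: tensor_induct)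
    case (pure y1 y2)
    show ?case
      by (simp add: tensor_mult_pure W_tpure r_mult_left[OF corep_u] r_mult_right[OF corep_u] assms
          sum_product mult_ac) (rule sum.swap)
  qed (simp add: distrib_left clinearD[OF W_linear] sum.distrib)
qed (simp add: distrib_left distrib_right clinearD[OF W_linear] sum.distrib)

text \<open>The matrix L+(h1) L-(h2), obtained by contracting the inner indices of
  \<open>W\<close>.\<close>

definition Q :: "nat \<Rightarrow> nat \<Rightarrow> 'g \<Rightarrow> complex" where
  "Q k l h = (\<Sum>c=1..N. W k c c l (\<Delta> h))"

lemma Qform_eq_Q:
  assumes "k \<in> {1..N}" "l \<in> {1..N}"
  shows "Qform \<Delta> r h (u k l) = Q k l h"
proof -
  have b: "cbilinear (\<lambda>g1 g2. tlift (\<lambda>h1 h2. r (g1 \<otimes>\<^sub>t h1) * r (h2 \<otimes>\<^sub>t g2)) x)" for x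
    by (intro cbilinearI clinear_tlift_param clin r_linear_right r_linear_left)
  show ?thesis
    by (simp add: Qform_def Delta_u[OF assms] clinearD[OF clinear_tlift[OF b]] tlift_tpure[OF b] Q_def W_def)
qed

lemma Q_linear: "clinear (Q k l)"
  unfolding Q_def by (intro clin clinear_compose[OF alg_homD(1)[OF Delta_hom] W_linear])

lemma Q_mult:
  assumes "k \<in> {1..N}" "l \<in> {1..N}"
  shows "Q k l (h * g) = (\<Sum>a=1..N. \<Sum>b=1..N. Q a b h * W k a b l (\<Delta> g))"
proof -
  have "Q k l (h * g) = (\<Sum>c=1..N. \<Sum>a=1..N. \<Sum>b=1..N. W a c c b (\<Delta> h) * W k a b l (\<Delta> g))"
    by (simp add: Q_def alg_homD[OF Delta_hom] W_mult assms)
  also have "\<dots> = (\<Sum>a=1..N. \<Sum>c=1..N. \<Sum>b=1..N. W a c c b (\<Delta> h) * W k a b l (\<Delta> g))"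
    by (rule sum.swap)
  also have "\<dots> = (\<Sum>a=1..N. \<Sum>b=1..N. \<Sum>c=1..N. W a c c b (\<Delta> h) * W k a b l (\<Delta> g))"
    by (intro sum.cong refl sum.swap)
  finally show ?thesis by (simp add: Q_def sum_distrib_right)
qed

lemma W_corep:
  assumes "corep \<Delta> \<epsilon> I y" "i \<in> I" "j \<in> I"
  shows "W k a b l (\<Delta> (y i j)) = (\<Sum>m\<in>I. r (u k a \<otimes>\<^sub>t y i m) * r (y m j \<otimes>\<^sub>t u b l))"
  using assms by (simp add: corep_def clinearD[OF W_linear] W_tpure)

lemma W_u:
  assumes "i \<in> {1..N}" "j \<in> {1..N}" "k \<in> {1..N}" "a \<in> {1..N}" "b \<in> {1..N}" "l \<in> {1..N}"
  shows "W k a b l (\<Delta> (u i j)) = (inverse qroot)\<^sup>2 * (\<Sum>m=1..N. Rmat q i k a m * Rmat q b m j l)"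
  using assms
  by (simp add: W_corep[OF corep_u] r_gen power2_eq_square sum_distrib_left mult_ac)

lemma Q_mult_u:
  assumes "i \<in> {1..N}" "j \<in> {1..N}" "k \<in> {1..N}" "l \<in> {1..N}"
  shows "Q k l (h * u i j) = (\<Sum>a=1..N. \<Sum>b=1..N.
    Q a b h * ((inverse qroot)\<^sup>2 * (\<Sum>m=1..N. Rmat q i k a m * Rmat q b m j l)))"
  using assms by (simp add: Q_mult W_u)

lemma Q_one: "k \<in> {1..N} \<Longrightarrow> l \<in> {1..N} \<Longrightarrow> Q k l 1 = of_bool (k = l)"
  by (simp add: Q_def alg_homD[OF Delta_hom] one_tensor_def W_tpure r_one counit_u)

text \<open>An off-diagonal generator is sent to a multiple of the matrix unit E_ji, with the
  indices exchanged. The two orders of i and j get their factor \<open>nu q\<close> from different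
  factors of the R-matrix product.\<close>

lemma Q_u:
  assumes "i \<in> {1..N}" "j \<in> {1..N}" "k \<in> {1..N}" "l \<in> {1..N}" "i \<noteq> j"
  shows "Q k l (u i j) = (inverse qroot)\<^sup>2 * nu q * of_bool (k = j) * of_bool (l = i)"
proof -
  have "Q k l (u i j) = (inverse qroot)\<^sup>2 * (\<Sum>c=1..N. \<Sum>m=1..N. Rmat q i k c m * Rmat q c m j l)"
    using assms by (simp add: Q_def W_u sum_distrib_left)
  also have "(\<Sum>c=1..N. \<Sum>m=1..N. Rmat q i k c m * Rmat q c m j l)
      = (\<Sum>c=1..N. \<Sum>m=1..N. of_bool (k = c) * (of_bool (i = m) * ((if i = k then complex_of_real q else 1) * Rmat q c m j l))
          + of_bool (i = c) * (of_bool (k = m) * (nu q * of_bool (k > i) * Rmat q c m j l)))"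
    by (intro sum.cong refl) (simp add: Rmat_def[of q i k] algebra_simps)
  also have "\<dots> = (if i = k then complex_of_real q else 1) * Rmat q k i j l
      + nu q * of_bool (k > i) * Rmat q i k j l"
    using assms by (simp only: sum.distrib sum_distrib_left[symmetric] of_bool_sum_simps finite_atLeastAtMost if_True)
  also have "\<dots> = nu q * of_bool (k = j) * of_bool (l = i)"
    using assms(5) by (auto simp: Rmat_def)
  finally show ?thesis by simp
qed

section \<open>Triangularity: first row, first column and corner of Q\<close>

lemma Q_first_row_u:
  assumes "i \<in> {1..N}" "j \<in> {1..N}" "l \<in> {1..N}" "\<And>b. b \<in> {1..N} \<Longrightarrow> Q 1 b h = 0"
  shows "Q 1 l (h * u i j) = 0"
proof -
  note 1 = one_index
  have "Q a b h * ((inverse qroot)\<^sup>2 * (\<Sum>m=1..N. Rmat q i 1 a m * Rmat q b m j l)) = 0"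
    if "b \<in> {1..N}" for a b
    using assms(4)[OF that] index_ge[OF assms(1)] by (cases "a = 1") (simp_all add: Rmat_lower)
  then show ?thesis
    unfolding Q_mult_u[OF assms(1,2) 1 assms(3)] by (intro sum.neutral ballI)
qed

lemma Q_first_column_u:
  assumes "i \<in> {1..N}" "j \<in> {1..N}" "k \<in> {1..N}" "\<And>a. a \<in> {1..N} \<Longrightarrow> Q a 1 h = 0"
  shows "Q k 1 (h * u i j) = 0"
proof -
  note 1 = one_index
  have "Q a b h * ((inverse qroot)\<^sup>2 * (\<Sum>m=1..N. Rmat q i k a m * Rmat q b m j 1)) = 0"
    if "a \<in> {1..N}" "b \<in> {1..N}" for a b
    using assms(4)[OF that(1)] index_ge[OF that(2)] by (cases "b = 1") (simp_all add: Rmat_upper)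
  then show ?thesis
    unfolding Q_mult_u[OF assms(1,2,3) 1] by (intro sum.neutral ballI)
qed

text \<open>Triangularity on both sides leaves only a = b = 1. For i = j = 1 both R-matrices
  contribute a factor q, hence the square.\<close>

lemma Q11_mult_u:
  assumes "i \<in> {1..N}" "j \<in> {1..N}"
  shows "Q 1 1 (h * u i j) = Q 1 1 h *
    ((inverse qroot)\<^sup>2 * (if i = 1 then (complex_of_real q)\<^sup>2 else 1) * of_bool (i = j))"
proof -
  note 1 = one_index
  have *: "(\<Sum>m=1..N. Rmat q i 1 a m * Rmat q b m j 1)
      = of_bool (1 = a) * (of_bool (1 = b) * ((if i = 1 then (complex_of_real q)\<^sup>2 else 1) * of_bool (i = j)))"
    if "b \<in> {1..N}" for a b
  proof -
    have "(\<Sum>m=1..N. Rmat q i 1 a m * Rmat q b m j 1)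
      = (\<Sum>m=1..N. of_bool (i = m) * ((if i = 1 then complex_of_real q else 1) * of_bool (a = 1)
          * ((if b = m then complex_of_real q else 1) * of_bool (b = 1) * of_bool (m = j))))"
      using index_ge[OF assms(1)] index_ge[OF that]
      by (intro sum.cong refl) (simp add: Rmat_lower Rmat_upper mult_ac)
    also have "\<dots> = (if i = 1 then complex_of_real q else 1) * of_bool (a = 1)
          * ((if b = i then complex_of_real q else 1) * of_bool (b = 1) * of_bool (i = j))"
      using assms by simp
    also have "\<dots> = of_bool (1 = a) * (of_bool (1 = b) * ((if i = 1 then (complex_of_real q)\<^sup>2 else 1) * of_bool (i = j)))"
      by (auto simp: power2_eq_square)
    finally show ?thesis .
  qed
  have "Q 1 1 (h * u i j) = (\<Sum>a=1..N. \<Sum>b=1..N. of_bool (1 = a) * (of_bool (1 = b) * (Q a b h *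
    ((inverse qroot)\<^sup>2 * (if i = 1 then (complex_of_real q)\<^sup>2 else 1) * of_bool (i = j)))))"
    unfolding Q_mult_u[OF assms 1 1] by (intro sum.cong refl) (subst *, assumption, simp only: mult_ac)
  also have "\<dots> = Q 1 1 h *
    ((inverse qroot)\<^sup>2 * (if i = 1 then (complex_of_real q)\<^sup>2 else 1) * of_bool (i = j))"
    using 1 by (simp only: sum_distrib_left[symmetric] of_bool_sum_simps finite_atLeastAtMost if_True)
  finally show ?thesis .
qed

lemma Q11_hom: "alg_hom (Q 1 1)"
proof -
  note 1 = one_index
  note L = clinearD[OF Q_linear]
  have "\<forall>h. Q 1 1 (h * g) = Q 1 1 h * Q 1 1 g" for g
  proof -
    have "g \<in> {g. \<forall>h. Q 1 1 (h * g) = Q 1 1 h * Q 1 1 g}"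
      using G
    proof (induction rule: quantum_SU_induct)
      case subspace
      show ?case
        by (auto simp: complex_vector.subspace_def L distrib_left mult_scaleC_right)
    next
      case one
      show ?case using Q_one[OF 1 1] by simp
    next
      case (mult a i j)
      then show ?case
        by (simp add: mult.assoc[symmetric] Q11_mult_u)
    qed
    then show ?thesis by simp
  qed
  then show ?thesis using Q_one[OF 1 1] by (simp add: alg_hom_def Q_linear)
qed

lemma Q11_u:
  assumes "i \<in> {1..N}" "j \<in> {1..N}"
  shows "Q 1 1 (u i j) = (inverse qroot)\<^sup>2 * (if i = 1 then (complex_of_real q)\<^sup>2 else 1) * of_bool (i = j)"
  using Q11_mult_u[OF assms, of 1] alg_homD(2)[OF Q11_hom] by simp

text \<open>Each entry of Q is a weight vector for the adjoint torus action, because the R-matrix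
  preserves weights. Two uses follow: the ideal is stable under the action, and on invariant
  elements Q_kl vanishes unless k and l have equal weight.\<close>

lemma Q_torus_weight:
  fixes w :: "nat \<Rightarrow> int"
  assumes ad: "alg_hom ad" "\<And>i j. i \<in> {1..N} \<Longrightarrow> j \<in> {1..N} \<Longrightarrow> ad (u i j) = u i j \<otimes>\<^sub>t tpow (w j - w i)"
  shows "k \<in> {1..N} \<Longrightarrow> l \<in> {1..N} \<Longrightarrow> lslice (Q k l) (ad g) = Q k l g *\<^sub>C tpow (w k - w l)"
proof -
  note L = clinearD[OF Q_linear] and LS = clinearD[OF clinear_lslice[OF Q_linear]]
  have "g \<in> {g. \<forall>k\<in>{1..N}. \<forall>l\<in>{1..N}. lslice (Q k l) (ad g) = Q k l g *\<^sub>C tpow (w k - w l)}"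
    using G
  proof (induction rule: quantum_SU_induct)
    case subspace
    show ?case
      by (auto simp: complex_vector.subspace_def L LS alg_homD[OF ad(1)] scaleC_add_left scaleC_scaleC)
  next
    case one
    show ?case
      by (auto simp: alg_homD[OF ad(1)] one_tensor_def lslice_tpure Q_linear Q_one tpow_zero)
  next
    case (mult x i j)
    note ij = mult(2,3)
    show ?case
    proof (intro CollectI ballI)
      fix k l assume kl: "k \<in> {1..N}" "l \<in> {1..N}"
      have 1: "lslice (Q k l) (X * (u i j \<otimes>\<^sub>t h)) =
          (\<Sum>a=1..N. \<Sum>b=1..N. W k a b l (\<Delta> (u i j)) *\<^sub>C (lslice (Q a b) X * h))" for X and h :: laurent
      proof (induction X rule: tensor_induct)
        case (pure x y)
        show ?case
          by (simp add: tensor_mult_pure lslice_tpure Q_linear Q_mult[OF kl] complex_vector.scale_sum_left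
              mult_scaleC_left mult_scaleC_right scaleC_scaleC mult.commute)
      qed (simp add: distrib_right LS scaleC_add_right sum.distrib)
      have 2: "W k a b l (\<Delta> (u i j)) *\<^sub>C (lslice (Q a b) (ad x) * tpow (w j - w i))
          = (Q a b x * W k a b l (\<Delta> (u i j))) *\<^sub>C tpow (w k - w l)"
        if ab: "a \<in> {1..N}" "b \<in> {1..N}" for a b
      proof (cases "W k a b l (\<Delta> (u i j)) = 0")
        case False
        then have "(\<Sum>m=1..N. Rmat q i k a m * Rmat q b m j l) \<noteq> 0"
          using W_u[OF ij kl(1) ab kl(2)] by auto
        \<comment> \<open>A nonzero coefficient passes through some index m with both R-entries
          nonzero; eliminating the weight of m from the two conservation laws gives the required
          identity of weights.\<close>
        then obtain m where m: "Rmat q i k a m \<noteq> 0" "Rmat q b m j l \<noteq> 0"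
          by (metis (no_types, lifting) mult_eq_0_iff sum.neutral)
        then have "tpow (w a - w b) * tpow (w j - w i) = tpow (w k - w l)"
          unfolding tpow_add[symmetric]
          using Rmat_nonzeroD[OF m(1)] Rmat_nonzeroD[OF m(2)] by auto
        then show ?thesis
          using mult(1) ab by (simp add: mult_scaleC_left scaleC_scaleC mult.commute[of "Q a b x"])
      qed simp
      have "lslice (Q k l) (ad (x * u i j)) = (\<Sum>a=1..N. \<Sum>b=1..N. (Q a b x * W k a b l (\<Delta> (u i j))) *\<^sub>C tpow (w k - w l))"
        by (simp add: alg_homD[OF ad(1)] ad(2)[OF ij] 1 2)
      then show "lslice (Q k l) (ad (x * u i j)) = Q k l (x * u i j) *\<^sub>C tpow (w k - w l)"
        by (simp add: Q_mult[OF kl] complex_vector.scale_sum_left)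
    qed
  qed
  then show "k \<in> {1..N} \<Longrightarrow> l \<in> {1..N} \<Longrightarrow> lslice (Q k l) (ad g) = Q k l g *\<^sub>C tpow (w k - w l)" by simp
qed

section \<open>Values of r on antipodes and the images of the added generators under Q\<close>

lemma r_antipode_left:
  assumes "m \<in> {1..N}" "i \<in> {2..N}" "l \<in> {1..N}"
  shows "r (S (u 1 m) \<otimes>\<^sub>t u i l) = qroot * (of_bool (m = 1) * of_bool (l = i))"
proof -
  have i: "i \<in> {1..N}" "i \<noteq> 1" using assms(2) by (auto simp: atLeastAtMost_iff)
  \<comment> \<open>As i differs from 1, the R-entry of \<open>u 1 j\<close> against
    \<open>u i c\<close> vanishes unless j = 1 and c = i, where it is 1. The antipode identity then
    isolates a single unknown.\<close>
  have *: "(\<Sum>c=1..N. r (u 1 j \<otimes>\<^sub>t u i c) * r (S (u j m) \<otimes>\<^sub>t u c l))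
      = of_bool (1 = j) * (inverse qroot * r (S (u j m) \<otimes>\<^sub>t u i l))" if "j \<in> {1..N}" for j
  proof -
    have "(\<Sum>c=1..N. r (u 1 j \<otimes>\<^sub>t u i c) * r (S (u j m) \<otimes>\<^sub>t u c l))
        = (\<Sum>c=1..N. of_bool (i = c) * (of_bool (1 = j) * (inverse qroot * r (S (u j m) \<otimes>\<^sub>t u c l))))"
      using that i index_ge[OF i(1)]
      by (intro sum.cong refl) (auto simp: r_gen one_index Rmat_def)
    then show ?thesis using i by simp
  qed
  have "of_bool (1 = m) * \<epsilon> (u i l) = r ((\<Sum>j=1..N. u 1 j * S (u j m)) \<otimes>\<^sub>t u i l)"
    unfolding corep_antipode_mult(2)[OF hopf corep_u one_index assms(1)]
    by (simp add: r_one clinearD[OF r_linear])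
  also have "\<dots> = (\<Sum>j=1..N. of_bool (1 = j) * (inverse qroot * r (S (u j m) \<otimes>\<^sub>t u i l)))"
    by (simp add: tpure_sum_left clinearD[OF r_linear] r_mult_left[OF corep_u i(1) assms(3)] *)
  also have "\<dots> = inverse qroot * r (S (u 1 m) \<otimes>\<^sub>t u i l)"
    using one_index by simp
  finally show ?thesis
    using qroot_nonzero by (auto simp: counit_u i assms field_simps)
qed

text \<open>This is r evaluated on \<open>u k 1\<close> against the antipode identity for row 1. For
  m different from k it makes the off-diagonal unknown vanish; for m = k it is a recursion in
  partial sums of the diagonal ones.\<close>

lemma r_antipode_right_system:
  assumes "k \<in> {1..N}" "m \<in> {1..N}"
  shows "(if m = k then complex_of_real q else 1) * r (u k 1 \<otimes>\<^sub>t S (u 1 m))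
      + of_bool (k = m) * (nu q * (\<Sum>j=1..N. of_bool (j < k) * r (u j 1 \<otimes>\<^sub>t S (u 1 j))))
    = qroot * (of_bool (1 = m) * of_bool (k = 1))"
proof -
  have *: "(\<Sum>c=1..N. r (u k c \<otimes>\<^sub>t u j m) * r (u c 1 \<otimes>\<^sub>t S (u 1 j)))
      = of_bool (m = j) * (inverse qroot * ((if j = k then complex_of_real q else 1) * r (u k 1 \<otimes>\<^sub>t S (u 1 j))))
       + inverse qroot * (of_bool (k = m) * (nu q * (of_bool (j < k) * r (u j 1 \<otimes>\<^sub>t S (u 1 j)))))"
    if "j \<in> {1..N}" for j
  proof -
    have "(\<Sum>c=1..N. r (u k c \<otimes>\<^sub>t u j m) * r (u c 1 \<otimes>\<^sub>t S (u 1 j)))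
        = (\<Sum>c=1..N. of_bool (k = c) * (of_bool (m = j) * (inverse qroot * ((if j = k then complex_of_real q else 1) * r (u c 1 \<otimes>\<^sub>t S (u 1 j)))))
          + of_bool (j = c) * (inverse qroot * (of_bool (k = m) * (nu q * (of_bool (j < k) * r (u c 1 \<otimes>\<^sub>t S (u 1 j)))))))"
      using that assms
      by (intro sum.cong refl) (auto simp: r_gen Rmat_def algebra_simps)
    then show ?thesis using assms that by (simp add: sum.distrib)
  qed
  have "of_bool (1 = m) * \<epsilon> (u k 1) = r (u k 1 \<otimes>\<^sub>t (\<Sum>j=1..N. S (u 1 j) * u j m))"
    unfolding corep_antipode_mult(1)[OF hopf corep_u one_index assms(2)]
    by (simp add: r_one clinearD[OF r_linear])
  also have "\<dots> = (\<Sum>j=1..N.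
       of_bool (m = j) * (inverse qroot * ((if j = k then complex_of_real q else 1) * r (u k 1 \<otimes>\<^sub>t S (u 1 j))))
       + inverse qroot * (of_bool (k = m) * (nu q * (of_bool (j < k) * r (u j 1 \<otimes>\<^sub>t S (u 1 j))))))"
    by (simp add: tpure_sum_right clinearD[OF r_linear] r_mult_right[OF corep_u assms(1) one_index] *)
  also have "\<dots> = inverse qroot * ((if m = k then complex_of_real q else 1) * r (u k 1 \<otimes>\<^sub>t S (u 1 m))
      + of_bool (k = m) * (nu q * (\<Sum>j=1..N. of_bool (j < k) * r (u j 1 \<otimes>\<^sub>t S (u 1 j)))))"
    using assms(2) by (simp only: sum.distrib sum_distrib_left[symmetric] of_bool_sum_simps finite_atLeastAtMost
        if_True distrib_left)
  finally show ?thesis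
    using qroot_nonzero assms one_index by (simp add: counit_u field_simps)
qed

text \<open>The partial sums satisfy q Y(m+1) = (q - nu) Y(m) = q^(-1) Y(m) for m > 1 and start at
  Y(2) = X(1), which is nonzero. So none of them vanishes from 2 on, and neither does X(m) = - nu
  Y(m) / q.\<close>

lemma r_antipode_right_nonzero:
  assumes "nu q \<noteq> 0" "m \<in> {2..N}"
  shows "r (u m 1 \<otimes>\<^sub>t S (u 1 m)) \<noteq> 0"
proof -
  define X where "X j = r (u j 1 \<otimes>\<^sub>t S (u 1 j))" for j
  define Y where "Y k = (\<Sum>j=1..N. of_bool (j < k) * X j)" for k
  have sys: "complex_of_real q * X m + nu q * Y m = qroot * of_bool (m = 1)" if "m \<in> {1..N}" for m
    using r_antipode_right_system[OF that that] by (auto simp: X_def Y_def)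
  have Y_Suc: "Y (Suc m) = Y m + X m" if "m \<in> {1..N}" for m
  proof -
    have "Y (Suc m) = (\<Sum>j=1..N. of_bool (j < m) * X j + of_bool (m = j) * X j)"
      unfolding Y_def by (intro sum.cong refl) auto
    then show ?thesis using that by (simp add: sum.distrib Y_def)
  qed
  have Y1: "Y 1 = 0" unfolding Y_def by (intro sum.neutral) (auto simp: atLeastAtMost_iff)
  have Y: "2 \<le> m \<Longrightarrow> m \<le> N \<Longrightarrow> Y m \<noteq> 0" for m
  proof (induction m rule: nat_induct_at_least)
    case base
    have "Y 2 = X 1" using Y_Suc[OF one_index] Y1 by (simp add: numeral_2_eq_2 One_nat_def)
    then show ?case using sys[OF one_index] Y1 qroot_nonzero by auto
  next
    case (Suc m)
    then have m: "m \<in> {1..N}" "m \<noteq> 1" "Y m \<noteq> 0" by (auto simp: atLeastAtMost_iff)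
    have "complex_of_real q * Y (Suc m) = (complex_of_real q - nu q) * Y m"
      using sys[OF m(1)] m(2) by (simp add: Y_Suc[OF m(1)] algebra_simps add_eq_0_iff)
    moreover have "complex_of_real q - nu q \<noteq> 0"
      using q by (simp add: nu_def)
    ultimately show ?case using m(3) by auto
  qed
  have m: "m \<in> {1..N}" "m \<noteq> 1" using assms(2) by (auto simp: atLeastAtMost_iff)
  have "Y m \<noteq> 0" using Y[of m] assms(2) by (simp add: atLeastAtMost_iff)
  then have "nu q * Y m \<noteq> 0" using assms(1) by simp
  then show ?thesis using sys[OF m(1)] m(2) by (auto simp: X_def)
qed

text \<open>\<open>u i 1\<close> contributes a multiple of E_1i, and acting with
  \<open>S (u 1 i)\<close> moves it to a multiple of E_ii. These elements supply the diagonal of the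
  block with indices 2 to N, whose off-diagonal units come from \<open>Q_u\<close>.\<close>

lemma Q_u_antipode:
  assumes "i \<in> {2..N}" "k \<in> {1..N}" "l \<in> {1..N}"
  shows "Q k l (u i 1 * S (u 1 i))
    = inverse qroot * nu q * r (u k 1 \<otimes>\<^sub>t S (u 1 i)) * of_bool (k = i) * of_bool (l = i)"
proof -
  have i: "i \<in> {1..N}" "i \<noteq> 1" using assms(1) by (auto simp: atLeastAtMost_iff)
  have "Q k l (u i 1 * S (u 1 i)) = (\<Sum>a=1..N. \<Sum>b=1..N. of_bool (a = 1) * (of_bool (b = i) *
      ((inverse qroot)\<^sup>2 * nu q * W k a b l (\<Delta> (S (u 1 i))))))"
    unfolding Q_mult[OF assms(2,3)]
    by (intro sum.cong refl, subst Q_u) (use i one_index in \<open>simp_all add: mult_ac\<close>)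
  also have "\<dots> = (inverse qroot)\<^sup>2 * nu q * W k 1 i l (\<Delta> (S (u 1 i)))"
    using one_index i(1) by (simp only: sum_distrib_left[symmetric] of_bool_sum_simps finite_atLeastAtMost if_True)
  also have "W k 1 i l (\<Delta> (S (u 1 i)))
      = (\<Sum>m=1..N. r (u k 1 \<otimes>\<^sub>t S (u m i)) * (qroot * (of_bool (m = 1) * of_bool (l = i))))"
    unfolding W_corep[OF corep_Su i(1) one_index] by (simp add: r_antipode_left assms)
  also have "\<dots> = (\<Sum>m=1..N. of_bool (m = 1) * (r (u k 1 \<otimes>\<^sub>t S (u m i)) * (qroot * of_bool (l = i))))"
    by (intro sum.cong) auto
  also have "\<dots> = r (u k 1 \<otimes>\<^sub>t S (u 1 i)) * qroot * of_bool (l = i)"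
    using one_index by simp
  finally have *: "Q k l (u i 1 * S (u 1 i)) = inverse qroot * nu q * r (u k 1 \<otimes>\<^sub>t S (u 1 i)) * of_bool (l = i)"
    using qroot_nonzero by (simp add: power2_eq_square)
  have "r (u k 1 \<otimes>\<^sub>t S (u 1 i)) = 0" if "k \<noteq> i"
    using r_antipode_right_system[OF assms(2) i(1)] that i(2) by simp
  with * show ?thesis by auto
qed

text \<open>The ideal is cut out of \<open>ker \<epsilon>\<close> by the vanishing of the first row and column of \<open>Q\<close>; unlike the definition of \<open>I_SU\<close>, this description is visibly stable under the triangular
  action.  It also covers \<open>q = 1\<close>, where \<open>Q\<close> is scalar.\<close>

definition Iq :: "'g set" where
  "Iq = {h. \<epsilon> h = 0 \<and> (\<forall>k\<in>{1..N}. Q 1 k h = 0 \<and> Q k 1 h = 0)}"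

lemma csubspace_Iq: "csubspace Iq"
  by (auto simp: Iq_def complex_vector.subspace_def clinearD[OF Q_linear] alg_homD[OF counit_hom])

lemma right_ideal_Iq: "right_ideal Iq"
proof -
  have "g \<in> {g. \<forall>h\<in>Iq. h * g \<in> Iq}" for g
    using G
  proof (induction rule: quantum_SU_induct)
    case subspace
    show ?case
      using csubspace_Iq
      by (auto simp: complex_vector.subspace_def distrib_left mult_scaleC_right)
  next
    case one
    show ?case by simp
  next
    case (mult a i j)
    show ?case
    proof (intro CollectI ballI)
      fix h assume "h \<in> Iq"
      then have "h * a \<in> Iq" using mult(1) by blast
      then have "h * a * u i j \<in> Iq"
        using mult(2,3)
        by (auto simp: Iq_def alg_homD[OF counit_hom] intro!: Q_first_row_u Q_first_column_u)
      then show "h * (a * u i j) \<in> Iq" by (simp add: mult.assoc)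
    qed
  qed
  then show ?thesis using csubspace_Iq by (auto simp: right_ideal_def)
qed

text \<open>Since q is positive, \<open>nu q = 0\<close> forces q = 1. The R-matrix is then only its
  permuting term, and right multiplication by a generator scales the whole matrix Q.\<close>

lemma Q_scalar_if_nu_zero:
  assumes "nu q = 0" "k \<in> {1..N}" "l \<in> {1..N}"
  shows "Q k l h = of_bool (k = l) * Q 1 1 h"
proof -
  have "q = inverse q" using assms(1) by (simp add: nu_def flip: of_real_inverse)
  then have "q * q = 1" using q by (simp add: field_simps)
  then have q1: "q = 1" using q by (simp add: power2_eq_1_iff flip: power2_eq_square)
  have R: "Rmat q i k j l = of_bool (i = l) * of_bool (k = j)" for i k j l
    by (simp add: Rmat_def assms(1)) (simp add: q1)
  have "h \<in> {h. \<forall>k\<in>{1..N}. \<forall>l\<in>{1..N}. Q k l h = of_bool (k = l) * Q 1 1 h}"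
    using G
  proof (induction rule: quantum_SU_induct)
    case subspace
    show ?case
      by (auto simp: complex_vector.subspace_def clinearD[OF Q_linear])
  next
    case one
    show ?case by (auto simp: Q_one one_index)
  next
    case (mult x i j)
    have *: "Q k l (x * u i j) = Q k l x * ((inverse qroot)\<^sup>2 * of_bool (i = j))"
      if kl: "k \<in> {1..N}" "l \<in> {1..N}" for k l
    proof -
      have "Q k l (x * u i j) = (\<Sum>a=1..N. \<Sum>b=1..N. of_bool (k = a) * (of_bool (l = b) *
          (Q a b x * ((inverse qroot)\<^sup>2 * of_bool (i = j)))))"
        unfolding Q_mult_u[OF mult(2,3) kl] R
      proof (intro sum.cong refl)
        fix a b
        have "(\<Sum>m=1..N. of_bool (i = m) * of_bool (k = a) * (of_bool (b = l) * of_bool (m = j)))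
            = (\<Sum>m=1..N. of_bool (i = m) * (of_bool (k = a) * (of_bool (b = l) * of_bool (m = j)) :: complex))"
          by (simp only: mult.assoc)
        also have "\<dots> = of_bool (k = a) * (of_bool (b = l) * of_bool (i = j))"
          using mult(2) by simp
        finally show "Q a b x * ((inverse qroot)\<^sup>2 * (\<Sum>m=1..N. of_bool (i = m) * of_bool (k = a) * (of_bool (b = l) * of_bool (m = j))))
          = of_bool (k = a) * (of_bool (l = b) * (Q a b x * ((inverse qroot)\<^sup>2 * of_bool (i = j))))"
          by auto
      qed
      also have "\<dots> = Q k l x * ((inverse qroot)\<^sup>2 * of_bool (i = j))"
        using kl by (simp only: sum_distrib_left[symmetric] of_bool_sum_simps finite_atLeastAtMost if_True)
      finally show ?thesis .
    qed
    show ?case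
    proof (intro CollectI ballI)
      fix k l assume kl: "k \<in> {1..N}" "l \<in> {1..N}"
      then have "Q k l x = of_bool (k = l) * Q 1 1 x" using mult(1) by blast
      then show "Q k l (x * u i j) = of_bool (k = l) * Q 1 1 (x * u i j)"
        unfolding *[OF kl] *[OF one_index one_index] by simp
    qed
  qed
  then show ?thesis using assms by simp
qed

text \<open>The added generators have Q supported in the block with indices 2 to N. Conversely, if
  \<open>nu q\<close> is nonzero they span that block, so subtracting a combination of them brings
  any element of \<open>Iq\<close> into the kernel of Q.\<close>

lemma I_SU_eq_Iq: "I_SU N u \<Delta> \<epsilon> S r = Iq"
proof (intro equalityI subsetI)
  let ?Y = "{u i 1 * S (u 1 i) | i. i \<in> {2..N}}"
  let ?Z = "{u i j | i j. i \<in> {2..N} \<and> j \<in> {2..N} \<and> i \<noteq> j}"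
  have in2: "i \<in> {1..N}" "i \<noteq> 1" if "i \<in> {2..N}" for i
    using that by (auto simp: atLeastAtMost_iff)
  note sub = complex_vector.subspace_add[OF csubspace_Iq]
  have Y: "?Y \<subseteq> Iq"
    using in2 one_index by (auto simp: Iq_def Q_u_antipode alg_homD[OF counit_hom] counit_u)
  have Z: "?Z \<subseteq> Iq"
    using in2 one_index by (auto simp: Iq_def Q_u counit_u)
  {
    fix h assume "h \<in> I_SU N u \<Delta> \<epsilon> S r"
    then obtain x y z where h: "h = x + y + z" "\<forall>k\<in>{1..N}. \<forall>l\<in>{1..N}. Q k l x = 0" "\<epsilon> x = 0"
      "y \<in> cspan ?Y" "z \<in> cspan ?Z"
      unfolding I_SU_def by (auto simp: Qform_eq_Q)
    have "x \<in> Iq" using h one_index by (auto simp: Iq_def)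
    moreover have "y \<in> Iq" using h(4) complex_vector.span_minimal[OF Y csubspace_Iq] by blast
    moreover have "z \<in> Iq" using h(5) complex_vector.span_minimal[OF Z csubspace_Iq] by blast
    ultimately show "h \<in> Iq" using h(1) sub by blast
  }
  {
    fix h assume h: "h \<in> Iq"
    show "h \<in> I_SU N u \<Delta> \<epsilon> S r"
    proof (cases "nu q = 0")
      case True
      \<comment> \<open>Here Q is a scalar matrix, so its vanishing corner annihilates all of it and
        h is its own component in the kernel.\<close>
      have "Q k l h = 0" if "k \<in> {1..N}" "l \<in> {1..N}" for k l
        using h one_index Q_scalar_if_nu_zero[OF True that, of h] by (simp add: Iq_def)
      then show ?thesis
        unfolding I_SU_def
        using h by (intro CollectI exI[of _ h] exI[of _ 0])
          (auto simp: Qform_eq_Q Iq_def complex_vector.span_zero)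
    next
      case False
      define \<kappa> where "\<kappa> i = inverse qroot * nu q * r (u i 1 \<otimes>\<^sub>t S (u 1 i))" for i
      define \<mu> where "\<mu> = (inverse qroot)\<^sup>2 * nu q"
      have \<kappa>: "\<kappa> i \<noteq> 0" if "i \<in> {2..N}" for i
        using False that qroot_nonzero by (simp add: \<kappa>_def r_antipode_right_nonzero)
      have \<mu>: "\<mu> \<noteq> 0" using False qroot_nonzero by (simp add: \<mu>_def)
      \<comment> \<open>The coefficients make y reproduce the diagonal and z the off-diagonal part
        of the block of Q(h); the entry \<open>Q j i h\<close> goes with \<open>u i j\<close>
        because \<open>Q_u\<close> exchanges the indices.\<close>
      define y where "y = (\<Sum>i=2..N. (Q i i h / \<kappa> i) *\<^sub>C (u i 1 * S (u 1 i)))"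
      define z where "z = (\<Sum>i=2..N. \<Sum>j\<in>{2..N} - {i}. (Q j i h / \<mu>) *\<^sub>C u i j)"
      have y: "y \<in> cspan ?Y" unfolding y_def
        by (intro complex_vector.span_sum complex_vector.span_scale complex_vector.span_base) blast
      have z: "z \<in> cspan ?Z" unfolding z_def
        by (intro complex_vector.span_sum complex_vector.span_scale complex_vector.span_base) blast
      have Qy: "Q k l y = of_bool (k = l) * (if k \<in> {2..N} then Q k k h else 0)"
        if kl: "k \<in> {1..N}" "l \<in> {1..N}" for k l
      proof -
        have "Q k l y = (\<Sum>i=2..N. of_bool (k = i) * (of_bool (l = i) * Q i i h))"
          unfolding y_def clinearD[OF Q_linear]
          by (intro sum.cong refl) (use kl \<kappa> in \<open>auto simp: Q_u_antipode \<kappa>_def\<close>)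
        then show ?thesis by auto
      qed
      have Qz: "Q k l z = of_bool (k \<noteq> l) * (if k \<in> {2..N} \<and> l \<in> {2..N} then Q k l h else 0)"
        if kl: "k \<in> {1..N}" "l \<in> {1..N}" for k l
      proof -
        have "Q k l z = (\<Sum>i=2..N. \<Sum>j\<in>{2..N} - {i}. of_bool (l = i) * (of_bool (k = j) * Q j i h))"
          unfolding z_def clinearD[OF Q_linear]
          by (intro sum.cong refl) (use kl in2 \<mu> in \<open>auto simp: Q_u \<mu>_def\<close>)
        also have "\<dots> = (\<Sum>i=2..N. of_bool (l = i) * (if k \<in> {2..N} - {i} then Q k i h else 0))"
          by (simp only: sum_distrib_left[symmetric] of_bool_sum_simps finite_atLeastAtMost finite_Diff)
        finally show ?thesis by auto
      qed
      have yz: "y \<in> Iq" "z \<in> Iq"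
        using y z complex_vector.span_minimal[OF Y csubspace_Iq]
          complex_vector.span_minimal[OF Z csubspace_Iq] by blast+
      have "Q k l (h - y - z) = 0" if kl: "k \<in> {1..N}" "l \<in> {1..N}" for k l
      proof (cases "k = 1 \<or> l = 1")
        case True
        then show ?thesis
          using kl h yz by (auto simp: clinearD[OF Q_linear] Iq_def)
      next
        case False
        then have "k \<in> {2..N}" "l \<in> {2..N}" using kl by (auto simp: atLeastAtMost_iff)
        then show ?thesis by (simp add: clinearD[OF Q_linear] Qy Qz kl)
      qed
      moreover have "\<epsilon> (h - y - z) = 0"
        using h yz by (simp add: alg_homD[OF counit_hom] Iq_def)
      ultimately show ?thesis
        unfolding I_SU_def using y z
        by (intro CollectI exI[of _ "h - y - z"] exI[of _ y] exI[of _ z]) (auto simp: Qform_eq_Q)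
    qed
  }
qed

end

section \<open>The circle bundle over quantum projective space\<close>

lemma rslice_tmap:
  assumes "clinear f" "clinear \<phi>"
  shows "rslice \<phi> (tmap f (\<lambda>x. x) X) = f (rslice \<phi> X)"
proof -
  note t = clinear_tmap[OF assms(1) clinear_ident] and r = clinear_rslice[OF assms(2)]
  show ?thesis
    by (induction X rule: tensor_induct)
      (simp_all add: tmap_tpure assms clinear_ident rslice_tpure clinearD[OF assms(1)] clinearD[OF t] clinearD[OF r])
qed

lemma lslice_tmap:
  assumes "clinear f" "clinear \<phi>"
  shows "lslice \<phi> (tmap (\<lambda>x. x) f X) = f (lslice \<phi> X)"
proof -
  note t = clinear_tmap[OF clinear_ident assms(1)] and r = clinear_lslice[OF assms(2)]
  show ?thesis
    by (induction X rule: tensor_induct)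
      (simp_all add: tmap_tpure assms clinear_ident lslice_tpure clinearD[OF assms(1)] clinearD[OF t] clinearD[OF r])
qed

lemma slice_commute:
  assumes "clinear f" "clinear \<phi>"
  shows "f (rslice \<phi> X) = \<phi> (lslice f X)"
  by (induction X rule: tensor_induct)
    (simp_all add: assms lslice_tpure rslice_tpure clinearD[OF assms(1)] clinearD[OF assms(2)]
      clinearD[OF clinear_rslice] clinearD[OF clinear_lslice])

lemma lookup_tpow: "Poly_Mapping.lookup (tpow k) n = (if k = n then 1 else 0)"
  by (simp add: tpow_def lookup_single when_def)

lemma tpow_eq_one_iff: "tpow m = 1 \<longleftrightarrow> m = 0"
  using lookup_tpow[of m m] lookup_tpow[of 0 m] by (auto simp: tpow_zero split: if_splits)

lemma clinear_lookup: "clinear (\<lambda>h :: laurent. Poly_Mapping.lookup h n)"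
  by (rule clinearI) (simp_all add: lookup_add lookup_scaleC)

text \<open>The counit is the sum of the coefficients. Applied to a coaction, this decomposes an
  element into its homogeneous components.\<close>

lemma rslice_counit_U1_expansion:
  fixes X :: "('a::complex_vector, laurent) tensor"
  shows "\<exists>F. finite F \<and> rslice eps_U1 X = (\<Sum>n\<in>F. rslice (\<lambda>h. Poly_Mapping.lookup h n) X)"
proof -
  note e = alg_homD(1)[OF alg_hom_eps_U1]
  have "\<exists>F. finite F \<and> (\<forall>F'. finite F' \<longrightarrow> F \<subseteq> F' \<longrightarrow>
      rslice eps_U1 X = (\<Sum>n\<in>F'. rslice (\<lambda>h. Poly_Mapping.lookup h n) X))"
  proof (induction X rule: tensor_induct)
    case (pure a h)
    have "rslice eps_U1 (a \<otimes>\<^sub>t h) = (\<Sum>n\<in>F'. rslice (\<lambda>h. Poly_Mapping.lookup h n) (a \<otimes>\<^sub>t h))"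
      if "finite F'" "Poly_Mapping.keys h \<subseteq> F'" for F'
    proof -
      have "eps_U1 h = (\<Sum>n\<in>F'. Poly_Mapping.lookup h n)"
        using linext_superset[OF that, of "\<lambda>k. 1::complex"] by (simp add: eps_U1_def)
      then show ?thesis
        by (simp add: rslice_tpure e clinear_lookup complex_vector.scale_sum_left)
    qed
    then show ?case by (intro exI[of _ "Poly_Mapping.keys h"]) auto
  next
    case (add X Y)
    then obtain F1 F2 where F: "finite F1" "finite F2"
      "\<forall>F'. finite F' \<longrightarrow> F1 \<subseteq> F' \<longrightarrow> rslice eps_U1 X = (\<Sum>n\<in>F'. rslice (\<lambda>h. Poly_Mapping.lookup h n) X)"
      "\<forall>F'. finite F' \<longrightarrow> F2 \<subseteq> F' \<longrightarrow> rslice eps_U1 Y = (\<Sum>n\<in>F'. rslice (\<lambda>h. Poly_Mapping.lookup h n) Y)"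
      by blast
    show ?case
    proof (intro exI[of _ "F1 \<union> F2"] conjI allI impI)
      fix F' assume F': "finite F'" "F1 \<union> F2 \<subseteq> F'"
      then have "rslice eps_U1 X = (\<Sum>n\<in>F'. rslice (\<lambda>h. Poly_Mapping.lookup h n) X)"
        "rslice eps_U1 Y = (\<Sum>n\<in>F'. rslice (\<lambda>h. Poly_Mapping.lookup h n) Y)"
        using F by auto
      then show "rslice eps_U1 (X + Y) = (\<Sum>n\<in>F'. rslice (\<lambda>h. Poly_Mapping.lookup h n) (X + Y))"
        by (simp add: clinearD[OF clinear_rslice[OF e]] clinearD[OF clinear_rslice[OF clinear_lookup]] sum.distrib)
    qed (use F in auto)
  qed
  then show ?thesis by blast
qed

text \<open>T is a section of the canonical map and inverts it on the other side only modulo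
  \<open>balancing P M\<close>. This identifies the classes of the balanced tensor product with the
  fibres of \<open>ver\<close>, so no map on the quotient has to be constructed.\<close>

lemma hopf_galoisI:
  fixes \<delta> :: "'a::complex_algebra_1 \<Rightarrow> ('a, 'h::complex_algebra_1) tensor"
  assumes \<delta>: "clinear \<delta>"
    and bal: "\<And>x. x \<in> balancing P M \<Longrightarrow> ver \<delta> x = 0"
    and range: "\<And>x. x \<in> tsub P P \<Longrightarrow> ver \<delta> x \<in> tsub P UNIV"
    and T: "\<And>y z. T (y - z) = T y - T z" "\<And>y. y \<in> tsub P UNIV \<Longrightarrow> T y \<in> tsub P P"
    and T_ver: "\<And>x. x \<in> tsub P P \<Longrightarrow> x - T (ver \<delta> x) \<in> balancing P M"
    and ver_T: "\<And>y. y \<in> tsub P UNIV \<Longrightarrow> ver \<delta> (T y) = y"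
  shows "hopf_galois P M \<delta>"
proof -
  define R where "R = {(x, y). x \<in> tsub P P \<and> y \<in> tsub P P \<and> x - y \<in> balancing P M}"
  have B: "csubspace (balancing P M)"
    unfolding balancing_def by (rule complex_vector.subspace_span)
  note V = clinearD[OF clinear_ver[OF \<delta>]]
  have R_iff: "(x, y) \<in> R \<longleftrightarrow> x \<in> tsub P P \<and> y \<in> tsub P P \<and> ver \<delta> x = ver \<delta> y" for x y
  proof -
    have "x - y \<in> balancing P M" if "x \<in> tsub P P" "y \<in> tsub P P" "ver \<delta> x = ver \<delta> y"
    proof -
      have "x - y - T (ver \<delta> (x - y)) \<in> balancing P M"
        using T_ver complex_vector.subspace_diff[OF csubspace_tsub] that by blast
      moreover have "T (ver \<delta> (x - y)) = 0" using that(3) T(1)[of 0 0] by (simp add: V)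
      ultimately show ?thesis by simp
    qed
    moreover have "ver \<delta> x = ver \<delta> y" if "x - y \<in> balancing P M"
      using bal[OF that] by (simp add: V)
    ultimately show ?thesis by (auto simp: R_def)
  qed
  have cls: "the_elem (ver \<delta> ` (R `` {x})) = ver \<delta> x" if "x \<in> tsub P P" for x
  proof -
    have "ver \<delta> ` (R `` {x}) = {ver \<delta> x}" using that by (auto simp: R_iff Image_def)
    then show ?thesis by simp
  qed
  have "bij_betw (\<lambda>X. the_elem (ver \<delta> ` X)) (tsub P P // R) (tsub P UNIV)"
    unfolding bij_betw_def
  proof
    show "inj_on (\<lambda>X. the_elem (ver \<delta> ` X)) (tsub P P // R)"
      by (rule inj_onI) (auto simp: quotient_def cls R_iff)
    show "(\<lambda>X. the_elem (ver \<delta> ` X)) ` (tsub P P // R) = tsub P UNIV"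
    proof (intro equalityI subsetI)
      fix y assume "y \<in> (\<lambda>X. the_elem (ver \<delta> ` X)) ` (tsub P P // R)"
      then show "y \<in> tsub P UNIV" by (auto simp: quotient_def cls range)
    next
      fix y :: "('a, 'h) tensor" assume y: "y \<in> tsub P UNIV"
      have "R `` {T y} \<in> tsub P P // R" using T(2)[OF y] by (rule quotientI)
      moreover have "y = the_elem (ver \<delta> ` (R `` {T y}))" by (simp add: cls T y ver_T)
      ultimately show "y \<in> (\<lambda>X. the_elem (ver \<delta> ` X)) ` (tsub P P // R)" by blast
    qed
  qed
  then show ?thesis by (simp add: hopf_galois_def balanced_tensor_def R_def)
qed

lemma of_bool_tpure_sum:
  assumes "finite I" "j \<in> I"
  shows "(\<Sum>k\<in>I. f k \<otimes>\<^sub>t (of_bool (k = j) * h k)) = f j \<otimes>\<^sub>t (h j :: 'x::complex_algebra_1)"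
proof -
  have "(\<Sum>k\<in>I. f k \<otimes>\<^sub>t (of_bool (k = j) * h k)) = (\<Sum>k\<in>I. if k = j then f k \<otimes>\<^sub>t h k else 0)"
    by (intro sum.cong refl) auto
  then show ?thesis using assms by simp
qed

lemma slice_mult_hom:
  fixes X :: "('a::complex_algebra_1, 'b::complex_algebra_1) tensor"
  shows "alg_hom \<phi> \<Longrightarrow> rslice \<phi> (X * (a \<otimes>\<^sub>t b)) = \<phi> b *\<^sub>C (rslice \<phi> X * a)"
    "alg_hom \<psi> \<Longrightarrow> lslice \<psi> (X * (a \<otimes>\<^sub>t b)) = \<psi> a *\<^sub>C (lslice \<psi> X * b)"
proof -
  show "rslice \<phi> (X * (a \<otimes>\<^sub>t b)) = \<phi> b *\<^sub>C (rslice \<phi> X * a)" if "alg_hom \<phi>"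
    using that alg_homD(1)[OF that]
    by (induction X rule: tensor_induct)
      (simp_all add: tensor_mult_pure rslice_tpure alg_homD(3)[OF that] mult_scaleC_left scaleC_scaleC mult.commute
        distrib_right scaleC_add_right clinearD[OF clinear_rslice])
  show "lslice \<psi> (X * (a \<otimes>\<^sub>t b)) = \<psi> a *\<^sub>C (lslice \<psi> X * b)" if "alg_hom \<psi>"
    using that alg_homD(1)[OF that]
    by (induction X rule: tensor_induct)
      (simp_all add: tensor_mult_pure lslice_tpure alg_homD(3)[OF that] mult_scaleC_left scaleC_scaleC mult.commute
        distrib_right scaleC_add_right clinearD[OF clinear_lslice])
qed

lemma laurent_in_csubspace:
  assumes "clinear F" "csubspace A" "\<And>n. F (tpow n) \<in> A"
  shows "F h \<in> A"
proof (induction h rule: poly_mapping_add_induct)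
  case (single k c)
  have "Poly_Mapping.single k c = c *\<^sub>C tpow k" by (simp add: tpow_def scaleC_single)
  then show ?case by (simp add: clinearD[OF assms(1)] complex_vector.subspace_scale[OF assms(2)] assms(3))
qed (simp_all add: clinearD[OF assms(1)] complex_vector.subspace_0[OF assms(2)] complex_vector.subspace_add[OF assms(2)])

lemma tmap_leg_one: "tmap (\<lambda>b. (1::'c::complex_algebra_1) \<otimes>\<^sub>t b) (\<lambda>x. x) (1 :: ('a::complex_algebra_1, 'b::complex_algebra_1) tensor) = 1"
  by (rule alg_homD(2)[OF alg_hom_tmap[OF alg_hom_tpure_one(2) alg_hom_ident(1)]])

lemma mult_linear: "clinear (tlift (*) :: ('a::complex_algebra_1, 'a) tensor \<Rightarrow> 'a)"
  by (rule clinear_tprod[OF clinear_ident clinear_ident])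

lemma mult_tpure: "tlift (*) (a \<otimes>\<^sub>t b) = a * (b :: 'a::complex_algebra_1)"
  by (rule tprod_tpure[OF clinear_ident clinear_ident])

lemma mult_left_right:
  "tlift (*) ((p \<otimes>\<^sub>t 1) * x) = p * tlift (*) x"
    "tlift (*) (x * (1 \<otimes>\<^sub>t p)) = tlift (*) x * (p :: 'a::complex_algebra_1)"
  by (induction x rule: tensor_induct)
    (simp_all add: tensor_mult_pure mult_tpure mult.assoc distrib_left distrib_right clinearD[OF mult_linear])

lemma csubspace_image: "clinear f \<Longrightarrow> csubspace A \<Longrightarrow> csubspace (f ` A)"
proof -
  assume f: "clinear f" and A: "csubspace A"
  interpret Vector_Spaces.linear scaleC scaleC f by (rule f)
  show "csubspace (f ` A)" by (rule subspace_image[OF A])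
qed

section \<open>The sphere as a comodule algebra over the circle\<close>

locale quantum_sphere = coquasitriangular_SU N q qroot u \<Delta> \<epsilon> S r
  for N :: nat and q :: real and qroot :: complex
    and u :: "nat \<Rightarrow> nat \<Rightarrow> 'g::complex_algebra_1"
    and \<Delta> :: "'g \<Rightarrow> ('g, 'g) tensor" and \<epsilon> :: "'g \<Rightarrow> complex" and S :: "'g \<Rightarrow> 'g"
    and r :: "('g, 'g) tensor \<Rightarrow> complex" +
  fixes v :: "nat \<Rightarrow> nat \<Rightarrow> 'k::complex_algebra_1"
    and \<Delta>' :: "'k \<Rightarrow> ('k, 'k) tensor" and \<epsilon>' :: "'k \<Rightarrow> complex" and S' :: "'k \<Rightarrow> 'k"
    and \<beta> :: "'g \<Rightarrow> 'k" and \<gamma> :: "'g \<Rightarrow> laurent"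
  assumes K: "quantum_SU (N - 1) q v \<Delta>' \<epsilon>' S'"
    and beta: "beta_map N u \<Delta> \<epsilon> v \<Delta>' \<epsilon>' \<beta>"
    and gamma: "gamma_map N u \<Delta> \<epsilon> \<gamma>"
begin

text \<open>The exponent of the generator in the image of \<open>u i i\<close> under
  \<open>\<gamma>\<close>. The value at 1 is attained at no other index of the matrix.\<close>

definition w :: "nat \<Rightarrow> int" where
  "w i = (if i = 1 then - 1 else if i = N then 1 else 0)"

lemma beta_hom: "alg_hom \<beta>"
  using beta by (simp add: beta_map_def hopf_hom_def)

lemma gamma_hom: "alg_hom \<gamma>"
  using gamma by (simp add: gamma_map_def hopf_hom_def)

lemma counit_gamma: "eps_U1 (\<gamma> x) = \<epsilon> x"
  using gamma by (simp add: gamma_map_def hopf_hom_def)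

lemma index_cases:
  assumes "i \<in> {1..N}"
  obtains "i = 1" | "i \<in> {2..N}" "i - 1 \<in> {1..N - 1}" "i = i - 1 + 1"
  using assms by (cases "i = 1") (auto simp: atLeastAtMost_iff)

lemma gamma_u: "i \<in> {1..N} \<Longrightarrow> j \<in> {1..N} \<Longrightarrow> \<gamma> (u i j) = of_bool (i = j) * tpow (w i)"
proof (cases "i = j")
  case True
  assume "i \<in> {1..N}" "j \<in> {1..N}"
  then have "i = 1 \<or> i = N \<or> i \<in> {2..N - 1}" by (auto simp: atLeastAtMost_iff)
  moreover have "N \<notin> {2..N - 1}" "1 \<notin> {2..N - 1}" using N by (auto simp: atLeastAtMost_iff)
  ultimately show ?thesis
    using True gamma N by (auto simp: gamma_map_def w_def tpow_zero)
qed (use gamma in \<open>auto simp: gamma_map_def\<close>)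

lemma beta_first_column: "k \<in> {1..N} \<Longrightarrow> \<beta> (u k 1) = of_bool (k = 1)"
  using beta by (elim index_cases) (auto simp: beta_map_def atLeastAtMost_iff)

lemma beta_first_row: "k \<in> {1..N} \<Longrightarrow> \<beta> (u 1 k) = of_bool (k = 1)"
  using beta by (elim index_cases) (auto simp: beta_map_def atLeastAtMost_iff)

lemma beta_block: "i \<in> {2..N} \<Longrightarrow> j \<in> {2..N} \<Longrightarrow> \<beta> (u i j) = v (i - 1) (j - 1)"
  using beta by (simp add: beta_map_def)

text \<open>The adjoint torus coaction, g to g2 tensor gamma(S(g1)) gamma(g3). Taking it from the
  presentation makes it multiplicative at once, which the formula with the antipode does not
  show.\<close>

definition ad :: "'g \<Rightarrow> ('g, laurent) tensor" where
  "ad = (SOME F. alg_hom F \<and> (\<forall>i\<in>{1..N}. \<forall>j\<in>{1..N}. F (u i j) = u i j \<otimes>\<^sub>t tpow (w j - w i)))"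

lemma ad: "alg_hom ad" "i \<in> {1..N} \<Longrightarrow> j \<in> {1..N} \<Longrightarrow> ad (u i j) = u i j \<otimes>\<^sub>t tpow (w j - w i)"
proof -
  have "\<exists>F. alg_hom F \<and> (\<forall>i\<in>{1..N}. \<forall>j\<in>{1..N}. F (u i j) = u i j \<otimes>\<^sub>t tpow (w j - w i))"
    by (rule quantum_SU_torus[OF G, of w w]) auto
  from someI_ex[OF this, folded ad_def]
  show "alg_hom ad" "i \<in> {1..N} \<Longrightarrow> j \<in> {1..N} \<Longrightarrow> ad (u i j) = u i j \<otimes>\<^sub>t tpow (w j - w i)"
    by auto
qed

text \<open>The adjoint torus coaction carried to the smaller quantum group along
  \<open>\<beta>\<close>; the shift by 1 matches the index shift in \<open>\<beta>\<close>.\<close>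

definition conj_K :: "'k \<Rightarrow> ('k, laurent) tensor" where
  "conj_K = (SOME F. alg_hom F \<and> (\<forall>i\<in>{1..N - 1}. \<forall>j\<in>{1..N - 1}.
     F (v i j) = v i j \<otimes>\<^sub>t tpow (w (j + 1) - w (i + 1))))"

lemma conj_K: "alg_hom conj_K"
  "i \<in> {1..N - 1} \<Longrightarrow> j \<in> {1..N - 1} \<Longrightarrow> conj_K (v i j) = v i j \<otimes>\<^sub>t tpow (w (j + 1) - w (i + 1))"
proof -
  have "\<exists>F. alg_hom F \<and> (\<forall>i\<in>{1..N - 1}. \<forall>j\<in>{1..N - 1}.
     F (v i j) = v i j \<otimes>\<^sub>t tpow (w (j + 1) - w (i + 1)))"
    by (rule quantum_SU_torus[OF K, of "\<lambda>i. w (i + 1)" "\<lambda>i. w (i + 1)"]) auto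
  from someI_ex[OF this, folded conj_K_def]
  show "alg_hom conj_K"
    "i \<in> {1..N - 1} \<Longrightarrow> j \<in> {1..N - 1} \<Longrightarrow> conj_K (v i j) = v i j \<otimes>\<^sub>t tpow (w (j + 1) - w (i + 1))"
    by auto
qed

lemma conj_K_beta:
  assumes "k \<in> {1..N}" "j \<in> {1..N}"
  shows "conj_K (\<beta> (u k j)) = \<beta> (u k j) \<otimes>\<^sub>t tpow (w j - w k)"
  using assms(1)
proof (cases rule: index_cases)
  case 1
  then show ?thesis
    using assms(2) by (cases "j = 1") (simp_all add: beta_first_row alg_homD[OF conj_K(1)] one_tensor_def tpow_zero)
next
  case k: 2
  show ?thesis
    using assms(2)
  proof (cases rule: index_cases)
    case 1
    then show ?thesis
      using assms(1) by (cases "k = 1") (simp_all add: beta_first_column alg_homD[OF conj_K(1)] one_tensor_def tpow_zero)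
  next
    case 2
    then show ?thesis using k conj_K(2)[of "k - 1" "j - 1"] by (simp add: beta_block)
  qed
qed

definition delta :: "'g \<Rightarrow> ('g, laurent) tensor" where
  "delta x = tmap (\<lambda>x. x) \<gamma> (\<Delta> x)"

definition coK :: "'g \<Rightarrow> ('g, 'k) tensor" where
  "coK x = tmap (\<lambda>x. x) \<beta> (\<Delta> x)"

abbreviation P :: "'g set" where "P \<equiv> qsphere \<Delta> \<beta>"

lemma delta_eq: "tmap id \<gamma> \<circ> \<Delta> = delta"
  by (simp add: delta_def fun_eq_iff id_def)

lemma P_iff: "p \<in> P \<longleftrightarrow> coK p = p \<otimes>\<^sub>t 1"
  by (simp add: qsphere_def coinv_def coK_def id_def)

lemma delta_hom: "alg_hom delta"
  unfolding delta_def by (intro alg_hom_compose[OF Delta_hom] alg_hom_tmap alg_hom_ident gamma_hom)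

lemma coK_hom: "alg_hom coK"
  unfolding coK_def by (intro alg_hom_compose[OF Delta_hom] alg_hom_tmap alg_hom_ident beta_hom)

lemmas delta_linear = alg_homD(1)[OF delta_hom]
lemmas coK_linear = alg_homD(1)[OF coK_hom]
lemmas Delta_linear = alg_homD(1)[OF Delta_hom]
lemmas gamma_linear = alg_homD(1)[OF gamma_hom]
lemmas beta_linear = alg_homD(1)[OF beta_hom]
lemmas counit_linear = alg_homD(1)[OF counit_hom]
lemmas ad_linear = alg_homD(1)[OF ad(1)]

lemma delta_corep:
  assumes "corep \<Delta> \<epsilon> I y" "i \<in> I" "j \<in> I"
  shows "delta (y i j) = (\<Sum>k\<in>I. y i k \<otimes>\<^sub>t \<gamma> (y k j))" "coK (y i j) = (\<Sum>k\<in>I. y i k \<otimes>\<^sub>t \<beta> (y k j))"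
  using assms
  by (simp_all add: corep_def delta_def coK_def clinearD[OF clinear_tmap] clinear_ident gamma_linear beta_linear tmap_tpure)

lemma delta_u: "i \<in> {1..N} \<Longrightarrow> j \<in> {1..N} \<Longrightarrow> delta (u i j) = u i j \<otimes>\<^sub>t tpow (w j)"
  by (simp add: delta_corep[OF corep_u] gamma_u of_bool_tpure_sum)

lemma coK_u: "i \<in> {1..N} \<Longrightarrow> j \<in> {1..N} \<Longrightarrow> coK (u i j) = (\<Sum>k=1..N. u i k \<otimes>\<^sub>t \<beta> (u k j))"
  by (rule delta_corep[OF corep_u])

lemma subalgebra_P: "subalgebra P"
  by (auto simp: subalgebra_def complex_vector.subspace_def P_iff alg_homD[OF coK_hom] tpure_add_left
      tpure_scale_left one_tensor_def tensor_mult_pure)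

lemma csubspace_P: "csubspace P"
  using subalgebra_P by (simp add: subalgebra_def)

lemma P_mult: "x \<in> P \<Longrightarrow> y \<in> P \<Longrightarrow> x * y \<in> P" and P_one: "1 \<in> P"
  using subalgebra_P by (auto simp: subalgebra_def)

text \<open>On a generator the exponents add up to w_k + (w_j - w_k) = w_j for every k. For p in P
  the second leg is 1, fixed by \<open>conj_K\<close>, so the torus coaction preserves the
  sphere.\<close>

lemma codiag_coK: "codiag delta conj_K (coK g) = tmap coK (\<lambda>x. x) (delta g)"
proof (rule quantum_SU_hom_eqI[OF G])
  show "alg_hom (\<lambda>g. codiag delta conj_K (coK g))"
    by (intro alg_hom_compose[OF coK_hom] alg_hom_codiag delta_hom conj_K)
  show "alg_hom (\<lambda>g. tmap coK (\<lambda>x. x) (delta g))"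
    by (intro alg_hom_compose[OF delta_hom] alg_hom_tmap coK_hom alg_hom_ident)
  fix i j assume ij: "i \<in> {1..N}" "j \<in> {1..N}"
  have "codiag delta conj_K (u i k \<otimes>\<^sub>t \<beta> (u k j)) = (u i k \<otimes>\<^sub>t \<beta> (u k j)) \<otimes>\<^sub>t tpow (w j)" if "k \<in> {1..N}" for k
    using codiag_tpure_homogeneous[OF delta_linear alg_homD(1)[OF conj_K(1)] delta_u[OF ij(1) that] conj_K_beta[OF that ij(2)]]
    by (simp add: tpow_add[symmetric])
  then show "codiag delta conj_K (coK (u i j)) = tmap coK (\<lambda>x. x) (delta (u i j))"
    by (simp add: coK_u delta_u ij tmap_tpure coK_linear clinear_ident tpure_sum_left
        clinearD[OF clinear_codiag[OF delta_linear alg_homD(1)[OF conj_K(1)]]])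
qed

lemma delta_P:
  assumes "p \<in> P"
  shows "delta p \<in> tsub P UNIV"
  unfolding tsub_UNIV_right_iff[OF csubspace_P]
proof (intro allI impI)
  fix \<phi> :: "laurent \<Rightarrow> complex" assume \<phi>: "clinear \<phi>"
  have l1: "clinear (\<lambda>a::'g. a \<otimes>\<^sub>t (1::'k))" by (intro clin)
  have one: "tmap (\<lambda>b. 1 \<otimes>\<^sub>t b) (\<lambda>x. x) 1 = 1"
    by (rule alg_homD(2)[OF alg_hom_tmap[OF alg_hom_tpure_one(2) alg_hom_ident(1)]])
  have "tmap coK (\<lambda>x. x) (delta p) = codiag delta conj_K (p \<otimes>\<^sub>t 1)"
    using assms by (simp add: codiag_coK[symmetric] P_iff)
  also have "\<dots> = tmap (\<lambda>a. a \<otimes>\<^sub>t 1) (\<lambda>x. x) (delta p)"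
    by (simp add: codiag_tpure delta_linear alg_homD[OF conj_K(1)] one)
  finally have "rslice \<phi> (tmap coK (\<lambda>x. x) (delta p)) = rslice \<phi> (tmap (\<lambda>a. a \<otimes>\<^sub>t 1) (\<lambda>x. x) (delta p))"
    by simp
  then show "rslice \<phi> (delta p) \<in> P"
    by (simp add: rslice_tmap[OF coK_linear \<phi>] rslice_tmap[OF l1 \<phi>] P_iff)
qed

text \<open>Coassociativity with \<open>\<beta>\<close> on the last leg. For p in P it makes the
  second leg of the coproduct coinvariant, so the sphere is a left coideal.\<close>

lemma Delta_coK: "tassoc (tmap \<Delta> (\<lambda>x. x) (coK g)) = tmap (\<lambda>x. x) coK (\<Delta> g)"
proof (rule quantum_SU_hom_eqI[OF G])
  show "alg_hom (\<lambda>g. tassoc (tmap \<Delta> (\<lambda>x. x) (coK g)))"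
    by (intro alg_hom_compose[OF alg_hom_compose[OF coK_hom alg_hom_tmap] alg_hom_tassoc] Delta_hom alg_hom_ident)
  show "alg_hom (\<lambda>g. tmap (\<lambda>x. x) coK (\<Delta> g))"
    by (intro alg_hom_compose[OF Delta_hom] alg_hom_tmap coK_hom alg_hom_ident)
  fix i j assume ij: "i \<in> {1..N}" "j \<in> {1..N}"
  have "tassoc (tmap \<Delta> (\<lambda>x. x) (coK (u i j))) = (\<Sum>k=1..N. \<Sum>l=1..N. u i l \<otimes>\<^sub>t u l k \<otimes>\<^sub>t \<beta> (u k j))"
    by (simp add: coK_u ij clinearD[OF clinear_tmap[OF Delta_linear clinear_ident]] clinearD[OF clinear_tassoc]
        tmap_tpure Delta_linear clinear_ident Delta_u tpure_sum_left tassoc_tpure)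
  also have "\<dots> = (\<Sum>l=1..N. \<Sum>k=1..N. u i l \<otimes>\<^sub>t u l k \<otimes>\<^sub>t \<beta> (u k j))"
    by (rule sum.swap)
  also have "\<dots> = tmap (\<lambda>x. x) coK (\<Delta> (u i j))"
    by (simp add: coK_u ij clinearD[OF clinear_tmap[OF clinear_ident coK_linear]]
        tmap_tpure coK_linear clinear_ident Delta_u tpure_sum_right)
  finally show "tassoc (tmap \<Delta> (\<lambda>x. x) (coK (u i j))) = tmap (\<lambda>x. x) coK (\<Delta> (u i j))" .
qed

lemma Delta_P:
  assumes "p \<in> P"
  shows "\<Delta> p \<in> tsub UNIV P"
  unfolding tsub_UNIV_left_iff[OF csubspace_P]
proof (intro allI impI)
  fix \<phi> :: "'g \<Rightarrow> complex" assume \<phi>: "clinear \<phi>"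
  have "lslice \<phi> (tassoc (X \<otimes>\<^sub>t 1)) = lslice \<phi> X \<otimes>\<^sub>t (1::'k)" for X :: "('g, 'g) tensor"
    by (induction X rule: tensor_induct)
      (simp_all add: tassoc_tpure lslice_tpure \<phi> tpure_add_left tpure_scale_left clinearD[OF clinear_tassoc]
        clinearD[OF clinear_lslice[OF \<phi>]])
  moreover have "tmap \<Delta> (\<lambda>x. x) (coK p) = \<Delta> p \<otimes>\<^sub>t 1"
    using assms by (simp add: P_iff tmap_tpure Delta_linear clinear_ident)
  ultimately have "lslice \<phi> (tmap (\<lambda>x. x) coK (\<Delta> p)) = lslice \<phi> (\<Delta> p) \<otimes>\<^sub>t 1"
    unfolding Delta_coK[of p, symmetric] by simp
  then show "lslice \<phi> (\<Delta> p) \<in> P"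
    by (simp add: lslice_tmap[OF coK_linear \<phi>] P_iff)
qed

lemma delta_coassoc: "tassoc (tmap delta (\<lambda>x. x) (delta g)) = tmap (\<lambda>x. x) Delta_U1 (delta g)"
proof (rule quantum_SU_hom_eqI[OF G])
  show "alg_hom (\<lambda>g. tassoc (tmap delta (\<lambda>x. x) (delta g)))"
    by (intro alg_hom_compose[OF alg_hom_compose[OF delta_hom alg_hom_tmap] alg_hom_tassoc] delta_hom alg_hom_ident)
  show "alg_hom (\<lambda>g. tmap (\<lambda>x. x) Delta_U1 (delta g))"
    by (intro alg_hom_compose[OF delta_hom] alg_hom_tmap alg_hom_Delta_U1 alg_hom_ident)
  fix i j assume "i \<in> {1..N}" "j \<in> {1..N}"
  then show "tassoc (tmap delta (\<lambda>x. x) (delta (u i j))) = tmap (\<lambda>x. x) Delta_U1 (delta (u i j))"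
    by (simp add: delta_u tmap_tpure delta_linear clinear_ident alg_homD(1)[OF alg_hom_Delta_U1] tassoc_tpure
        Delta_U1_tpow)
qed

lemma delta_counit: "rslice eps_U1 (delta g) = g"
proof -
  note e = alg_hom_eps_U1 alg_homD(1)[OF alg_hom_eps_U1]
  have "g \<in> {g. rslice eps_U1 (delta g) = g}"
    using G
  proof (induction rule: quantum_SU_induct)
    case subspace
    show ?case by (auto simp: complex_vector.subspace_def alg_homD[OF delta_hom] clinearD[OF clinear_rslice[OF e(2)]])
  next
    case one
    show ?case by (simp add: alg_homD[OF delta_hom] one_tensor_def rslice_tpure e alg_homD[OF e(1)])
  next
    case (mult a i j)
    then show ?case by (simp add: alg_homD[OF delta_hom] delta_u slice_mult_hom(1)[OF e(1)] eps_U1_tpow)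
  qed
  then show ?thesis by simp
qed

lemma ad_counit: "lslice \<epsilon> (ad g) = \<epsilon> g *\<^sub>C 1"
proof -
  have "g \<in> {g. lslice \<epsilon> (ad g) = \<epsilon> g *\<^sub>C 1}"
    using G
  proof (induction rule: quantum_SU_induct)
    case subspace
    show ?case by (auto simp: complex_vector.subspace_def alg_homD[OF ad(1)] alg_homD[OF counit_hom]
          clinearD[OF clinear_lslice[OF counit_linear]] scaleC_add_left scaleC_scaleC)
  next
    case one
    show ?case by (simp add: alg_homD[OF ad(1)] alg_homD[OF counit_hom] one_tensor_def lslice_tpure counit_linear)
  next
    case (mult a i j)
    then show ?case
      by (cases "i = j")
        (simp_all add: alg_homD[OF ad(1)] alg_homD[OF counit_hom] ad(2) slice_mult_hom(2)[OF counit_hom] counit_u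
          tpow_zero)
  qed
  then show ?thesis by simp
qed

lemma comodule_algebra_P: "comodule_algebra P delta Delta_U1 eps_U1"
  unfolding comodule_algebra_def
  using delta_counit
  by (auto simp: subalgebra_P delta_linear delta_P delta_coassoc alg_homD[OF delta_hom] id_def rslice_def)

section \<open>The grading of the sphere by torus weight\<close>

definition Pd :: "int \<Rightarrow> 'g set" where
  "Pd n = {p \<in> P. delta p = p \<otimes>\<^sub>t tpow n}"

lemma Pd_subset: "Pd n \<subseteq> P"
  by (auto simp: Pd_def)

lemma Pd_zero: "Pd 0 = qCP \<Delta> \<beta> \<gamma>"
  by (simp add: Pd_def qCP_def coinv_def delta_eq tpow_zero)

lemma Pd_mult: "x \<in> Pd m \<Longrightarrow> y \<in> Pd n \<Longrightarrow> x * y \<in> Pd (m + n)"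
  by (auto simp: Pd_def P_mult alg_homD[OF delta_hom] tensor_mult_pure tpow_add)

text \<open>The component of degree n is the slice of the coaction along the n-th coefficient.
  Coassociativity makes it homogeneous, and the counit recovers p as the sum of its
  components.\<close>

lemma P_span_Pd: "P \<subseteq> cspan (\<Union>n. Pd n)"
proof
  fix p assume p: "p \<in> P"
  define p' where "p' n = rslice (\<lambda>h. Poly_Mapping.lookup h n) (delta p)" for n
  have "p' n \<in> Pd n" for n
  proof -
    let ?\<phi> = "\<lambda>h :: laurent. Poly_Mapping.lookup h n"
    note l = clinear_lookup[of n]
    have l': "clinear (rslice ?\<phi> :: (laurent, laurent) tensor \<Rightarrow> laurent)" by (rule clinear_rslice[OF l])
    have l'': "clinear (\<lambda>h :: laurent. Poly_Mapping.lookup h n *\<^sub>C tpow n)" by (intro clin l)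
    have a: "tmap (\<lambda>x. x) (rslice ?\<phi>) (tassoc (X \<otimes>\<^sub>t h)) = ?\<phi> h *\<^sub>C X" for X :: "('g, laurent) tensor" and h
      by (induction X rule: tensor_induct)
        (simp_all add: tassoc_tpure tmap_tpure clinear_ident l' rslice_tpure l tpure_scale_right tpure_add_left
          clinearD[OF clinear_tassoc] clinearD[OF clinear_tmap[OF clinear_ident l']] scaleC_add_right)
    have b: "rslice ?\<phi> (Delta_U1 h) = ?\<phi> h *\<^sub>C tpow n" for h
      by (rule laurent_linear_eqI[OF clinear_compose[OF alg_homD(1)[OF alg_hom_Delta_U1] l'] l''])
        (simp add: Delta_U1_tpow rslice_tpure l lookup_tpow)
    have "delta (p' n) = rslice ?\<phi> (tmap delta (\<lambda>x. x) (delta p))"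
      unfolding p'_def by (rule rslice_tmap[OF delta_linear l, symmetric])
    also have "\<dots> = tmap (\<lambda>x. x) (rslice ?\<phi>) (tassoc (tmap delta (\<lambda>x. x) (delta p)))"
      by (rule clinear_tensor_eqI[OF clinear_rslice[OF l]
            clinear_compose[OF clinear_tassoc clinear_tmap[OF clinear_ident l']]])
        (simp add: a rslice_tpure l)
    also have "\<dots> = tmap (\<lambda>x. x) (rslice ?\<phi>) (tmap (\<lambda>x. x) Delta_U1 (delta p))"
      by (simp add: delta_coassoc)
    also have "\<dots> = tmap (\<lambda>x. x) (\<lambda>h. Poly_Mapping.lookup h n *\<^sub>C tpow n) (delta p)"
      by (simp add: tmap_compose clinear_ident l' alg_homD(1)[OF alg_hom_Delta_U1] b)
    also have "\<dots> = p' n \<otimes>\<^sub>t tpow n"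
      unfolding p'_def
      by (rule clinear_tensor_eqI[OF clinear_tmap[OF clinear_ident l''] clinear_tpure_left[OF clinear_rslice[OF l]]])
        (simp add: tmap_tpure clinear_ident l'' rslice_tpure l tpure_scale_left tpure_scale_right)
    finally have "delta (p' n) = p' n \<otimes>\<^sub>t tpow n" .
    moreover have "p' n \<in> P"
      unfolding p'_def using delta_P[OF p] tsub_UNIV_right_iff[OF csubspace_P] l by blast
    ultimately show ?thesis by (simp add: Pd_def)
  qed
  then have "p' n \<in> cspan (\<Union>n. Pd n)" for n
    by (intro complex_vector.span_base) blast
  moreover obtain F where "p = (\<Sum>n\<in>F. p' n)"
    using rslice_counit_U1_expansion[of "delta p"] by (auto simp: delta_counit p'_def)
  ultimately show "p \<in> cspan (\<Union>n. Pd n)"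
    by (simp add: complex_vector.span_sum)
qed

text \<open>Both coactions send \<open>y i 1\<close> to a sum over k whose second legs are images of
  \<open>y k 1\<close>, so only k = 1 survives.\<close>

lemma Pd_corep:
  assumes y: "corep \<Delta> \<epsilon> {1..N} y" and i: "i \<in> {1..N}"
    and b: "\<And>k. k \<in> {1..N} \<Longrightarrow> \<beta> (y k 1) = of_bool (k = 1)"
    and g: "\<And>k. k \<in> {1..N} \<Longrightarrow> \<gamma> (y k 1) = of_bool (k = 1) * tpow n"
  shows "y i 1 \<in> Pd n"
proof -
  have "coK (y i 1) = (\<Sum>k=1..N. y i k \<otimes>\<^sub>t (of_bool (k = 1) * 1))"
    unfolding delta_corep(2)[OF y i one_index] by (intro sum.cong refl) (simp add: b)
  moreover have "delta (y i 1) = (\<Sum>k=1..N. y i k \<otimes>\<^sub>t (of_bool (k = 1) * tpow n))"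
    unfolding delta_corep(1)[OF y i one_index] by (intro sum.cong refl) (simp add: g)
  ultimately show ?thesis
    by (simp only: Pd_def P_iff mem_Collect_eq of_bool_tpure_sum[OF finite_atLeastAtMost one_index])
qed

text \<open>If the first row of a matrix is d times the first unit vector, the first row of its
  inverse is d' times that vector. The other rows of f(y) need not be known.\<close>

lemma antipode_first_row:
  fixes f :: "'g \<Rightarrow> 'b::complex_algebra_1"
  assumes f: "alg_hom f" and y: "corep \<Delta> \<epsilon> {1..N} y" and j: "j \<in> {1..N}"
    and row: "\<And>k. k \<in> {1..N} \<Longrightarrow> f (y 1 k) = of_bool (k = 1) * d" and d: "d' * d = 1"
  shows "f (S (y 1 j)) = of_bool (j = 1) * d'"
proof -
  have "(\<Sum>k=1..N. f (y 1 k) * f (S (y k j))) = f (of_bool (1 = j))"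
    unfolding corep_antipode_mult(2)[OF hopf y one_index j, symmetric] by (simp add: alg_homD[OF f])
  moreover have "(\<Sum>k=1..N. f (y 1 k) * f (S (y k j))) = (\<Sum>k=1..N. of_bool (k = 1) * (d * f (S (y k j))))"
    by (intro sum.cong refl) (simp add: row mult.assoc)
  ultimately have "d * f (S (y 1 j)) = of_bool (1 = j)"
    using one_index by (simp add: alg_hom_of_bool[OF f])
  then have "d' * (d * f (S (y 1 j))) = d' * of_bool (1 = j)" by simp
  then show ?thesis using d by (cases "j = 1") (simp_all add: mult.assoc[symmetric])
qed

lemma antipode_first_column:
  fixes f :: "'g \<Rightarrow> 'b::complex_algebra_1"
  assumes f: "alg_hom f" and y: "corep \<Delta> \<epsilon> {1..N} y" and i: "i \<in> {1..N}"
    and col: "\<And>k. k \<in> {1..N} \<Longrightarrow> f (y k 1) = of_bool (k = 1) * d" and d: "d * d' = 1"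
  shows "f (S (y i 1)) = of_bool (i = 1) * d'"
proof -
  have "(\<Sum>k=1..N. f (S (y i k)) * f (y k 1)) = f (of_bool (i = 1))"
    unfolding corep_antipode_mult(1)[OF hopf y i one_index, symmetric] by (simp add: alg_homD[OF f])
  moreover have "(\<Sum>k=1..N. f (S (y i k)) * f (y k 1)) = (\<Sum>k=1..N. of_bool (k = 1) * (f (S (y i k)) * d))"
    by (intro sum.cong refl) (auto simp: col)
  ultimately have "f (S (y i 1)) * d = of_bool (i = 1)"
    using one_index by (simp add: alg_hom_of_bool[OF f])
  then have "f (S (y i 1)) * d * d' = of_bool (i = 1) * d'" by simp
  then show ?thesis using d by (simp add: mult.assoc)
qed

lemma w_one: "w 1 = - 1"
  by (simp add: w_def)

lemma tpow_cancel: "tpow n * tpow (- n) = 1" "tpow (- n) * tpow n = 1"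
  by (simp_all add: tpow_add[symmetric] tpow_zero)

lemma beta_antipode_first_row: "j \<in> {1..N} \<Longrightarrow> \<beta> (S (u 1 j)) = of_bool (j = 1)"
  using antipode_first_row[OF beta_hom corep_u, of j 1 1] by (simp add: beta_first_row)

lemma beta_antipode_first_column: "i \<in> {1..N} \<Longrightarrow> \<beta> (S (u i 1)) = of_bool (i = 1)"
  using antipode_first_column[OF beta_hom corep_u, of i 1 1] by (simp add: beta_first_column)

lemma gamma_antipode_first_row: "j \<in> {1..N} \<Longrightarrow> \<gamma> (S (u 1 j)) = of_bool (j = 1) * tpow 1"
  using antipode_first_row[OF gamma_hom corep_u, of j "tpow (- 1)" "tpow 1"] tpow_cancel(1)[of 1]
  by (auto simp: gamma_u one_index w_one)

lemma gamma_antipode_first_column: "i \<in> {1..N} \<Longrightarrow> \<gamma> (S (u i 1)) = of_bool (i = 1) * tpow 1"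
  using antipode_first_column[OF gamma_hom corep_u, of i "tpow (- 1)" "tpow 1"] tpow_cancel(2)[of 1]
  by (auto simp: gamma_u one_index w_one)

lemma Pd_u: "i \<in> {1..N} \<Longrightarrow> u i 1 \<in> Pd (- 1)"
  by (rule Pd_corep[OF corep_u]) (auto simp: beta_first_column gamma_u one_index w_one)

lemma Pd_antipode_u: "i \<in> {1..N} \<Longrightarrow> S (u 1 i) \<in> Pd 1"
  by (rule Pd_corep[OF corep_Su]) (auto simp: beta_antipode_first_row gamma_antipode_first_row)

text \<open>Two transpositions cancel, so S(S(u)) is a corepresentation with the indices in their
  original order, and the criterion applies to its first column.\<close>

lemma Pd_antipode_antipode_u:
  assumes "i \<in> {1..N}"
  shows "S (S (u i 1)) \<in> Pd (- 1)"
proof (rule Pd_corep[OF corep_antipode[OF hopf corep_Su] assms])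
  fix k assume k: "k \<in> {1..N}"
  show "\<beta> (S (S (u k 1))) = of_bool (k = 1)"
    using antipode_first_row[OF beta_hom corep_Su k, of 1 1] by (simp add: beta_antipode_first_column)
  show "\<gamma> (S (S (u k 1))) = of_bool (k = 1) * tpow (- 1)"
    using antipode_first_row[OF gamma_hom corep_Su k, of "tpow 1" "tpow (- 1)"] tpow_cancel(2)[of 1]
    by (simp add: gamma_antipode_first_column)
qed

section \<open>Lifts of the powers of the circle generator\<close>

definition V :: "('g, 'g) tensor \<Rightarrow> ('g, 'g) tensor" where
  "V = ver \<Delta>"

lemma V_linear: "clinear V"
  unfolding V_def by (rule clinear_ver[OF Delta_linear])

lemma V_tpure: "V (f \<otimes>\<^sub>t g) = (f \<otimes>\<^sub>t 1) * \<Delta> g"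
  unfolding V_def by (rule ver_tpure[OF Delta_linear])

lemma ver_delta: "ver delta x = tmap (\<lambda>x. x) \<gamma> (V x)"
  using ver_pushforward[OF hopf gamma_hom, of x] by (simp add: V_def delta_def[abs_def])

text \<open>Summing S(y_1k) y_kl over k gives delta_1l, which leaves the corner entry. The tensor is
  S(z1) tensor z2 for z = y_11.\<close>

lemma V_corep:
  assumes y: "corep \<Delta> \<epsilon> {1..N} y"
  shows "V (\<Sum>k=1..N. S (y 1 k) \<otimes>\<^sub>t y k 1) = 1 \<otimes>\<^sub>t y 1 1"
proof -
  have "V (\<Sum>k=1..N. S (y 1 k) \<otimes>\<^sub>t y k 1) = (\<Sum>k=1..N. \<Sum>l=1..N. (S (y 1 k) * y k l) \<otimes>\<^sub>t y l 1)"
    using y one_index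
    by (simp add: clinearD[OF V_linear] V_tpure corep_def sum_distrib_left tensor_mult_pure)
  also have "\<dots> = (\<Sum>l=1..N. \<Sum>k=1..N. (S (y 1 k) * y k l) \<otimes>\<^sub>t y l 1)"
    by (rule sum.swap)
  also have "\<dots> = (\<Sum>l=1..N. of_bool (1 = l) \<otimes>\<^sub>t y l 1)"
    by (intro sum.cong refl) (simp only: tpure_sum_left[symmetric] corep_antipode_mult(1)[OF hopf y one_index])
  also have "\<dots> = (\<Sum>l=1..N. if 1 = l then 1 \<otimes>\<^sub>t y l 1 else 0)"
    by (intro sum.cong refl) auto
  finally show ?thesis using one_index by simp
qed

lemma ad_antipode_u11: "ad (S (u 1 1)) = S (u 1 1) \<otimes>\<^sub>t 1"
proof -
  have "ad (S (u 1 1)) = S (u 1 1) \<otimes>\<^sub>t tpow (w 1 - w 1)"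
  proof (rule alg_hom_antipode_corep[where W = "\<lambda>i j. S (u i j) \<otimes>\<^sub>t tpow (w j - w i)",
        OF hopf corep_u ad(1) _ one_index one_index])
    fix i j assume ij: "i \<in> {1..N}" "j \<in> {1..N}"
    have "(\<Sum>k=1..N. (S (u i k) \<otimes>\<^sub>t tpow (w k - w i)) * ad (u k j))
        = (\<Sum>k=1..N. S (u i k) * u k j) \<otimes>\<^sub>t tpow (w j - w i)"
      using ij by (simp add: ad(2) tensor_mult_pure tpow_add[symmetric] tpure_sum_left)
    then show "(\<Sum>k=1..N. (S (u i k) \<otimes>\<^sub>t tpow (w k - w i)) * ad (u k j)) = of_bool (i = j)"
      by (simp add: corep_antipode_mult(1)[OF hopf corep_u ij] one_tensor_def tpow_zero)
  qed
  then show ?thesis by (simp add: tpow_zero)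
qed

text \<open>\<open>lifts n z t\<close>: the tensor \<open>t\<close> is a strong connection form \<open>S(z\<^sub>(\<^sub>1\<^sub>)) \<otimes> z\<^sub>(\<^sub>2\<^sub>)\<close> for a
  torus-invariant element \<open>z\<close> of the sphere over \<open>t\<^sup>n\<close>.\<close>

definition lifts :: "int \<Rightarrow> 'g \<Rightarrow> ('g, 'g) tensor \<Rightarrow> bool" where
  "lifts n z t \<longleftrightarrow> t \<in> tsub (Pd (- n)) (Pd n) \<and> V t = 1 \<otimes>\<^sub>t z \<and> z \<in> P \<and> \<gamma> z = tpow n \<and> ad z = z \<otimes>\<^sub>t 1"

lemma lifts_zero: "lifts 0 1 (1 \<otimes>\<^sub>t 1)"
proof -
  have "1 \<in> Pd 0" by (simp add: Pd_def P_one alg_homD[OF delta_hom] one_tensor_def tpow_zero)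
  then show ?thesis
    by (simp add: lifts_def tpure_in_tsub V_tpure alg_homD[OF Delta_hom] alg_homD[OF gamma_hom] alg_homD[OF ad(1)] P_one tpow_zero one_tensor_def tensor_mult_pure)
qed

lemma lifts_minus_one: "lifts (- 1) (u 1 1) (\<Sum>k=1..N. S (u 1 k) \<otimes>\<^sub>t u k 1)"
  unfolding lifts_def
  using V_corep[OF corep_u] Pd_u[OF one_index] Pd_subset
  by (auto intro!: complex_vector.subspace_sum[OF csubspace_tsub] tpure_in_tsub Pd_u Pd_antipode_u
      simp: gamma_u one_index w_one ad(2) tpow_zero)

text \<open>The element \<open>S (u 1 1)\<close> is the corner of the transposed antipode
  corepresentation, whose own antipode has the entries \<open>S (S (u k 1))\<close>.\<close>

lemma lifts_one: "lifts 1 (S (u 1 1)) (\<Sum>k=1..N. S (S (u k 1)) \<otimes>\<^sub>t S (u 1 k))"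
  unfolding lifts_def
  using V_corep[OF corep_Su] Pd_antipode_u[OF one_index] Pd_subset
  by (auto intro!: complex_vector.subspace_sum[OF csubspace_tsub] tpure_in_tsub Pd_antipode_u Pd_antipode_antipode_u
      simp: gamma_antipode_first_row one_index ad_antipode_u11)

text \<open>Since S(z z') = S(z') S(z), the tensor t for z is inserted between the two legs of t': a
  tensor c becomes a t c. The canonical map then multiplies by 1 tensor z on the left, which
  commutes with the first leg.\<close>

lemma lifts_mult:
  assumes "lifts m z t" "lifts n z' t'"
  shows "\<exists>t''. lifts (m + n) (z * z') t''"
proof -
  define F where "F = tlift (\<lambda>a b. (a \<otimes>\<^sub>t 1) * t * (1 \<otimes>\<^sub>t b))"
  have b: "cbilinear (\<lambda>a b. (a \<otimes>\<^sub>t 1) * t * (1 \<otimes>\<^sub>t b))" by (intro cbilinearI clin)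
  have Fl: "clinear F" unfolding F_def by (rule clinear_tlift[OF b])
  have Fp: "F (a \<otimes>\<^sub>t c) = (a \<otimes>\<^sub>t 1) * t * (1 \<otimes>\<^sub>t c)" for a c unfolding F_def by (rule tlift_tpure[OF b])
  have "V (F x) = (1 \<otimes>\<^sub>t z) * V x" for x
  proof (induction x rule: tensor_induct)
    case (pure a c)
    have "V ((a \<otimes>\<^sub>t 1) * t * (1 \<otimes>\<^sub>t c)) = (a \<otimes>\<^sub>t 1) * V t * \<Delta> c"
      by (simp add: V_def ver_mult_right[OF hopf] ver_mult_left[OF hopf])
    also have "\<dots> = (1 \<otimes>\<^sub>t z) * ((a \<otimes>\<^sub>t 1) * \<Delta> c)"
      using assms(1) by (simp add: lifts_def tensor_mult_pure mult.assoc[symmetric])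
    finally show ?case by (simp add: Fp V_tpure)
  qed (simp add: clinearD[OF V_linear] clinearD[OF Fl] distrib_left)
  then have "V (F t') = 1 \<otimes>\<^sub>t (z * z')"
    using assms(2) by (simp add: lifts_def tensor_mult_pure)
  moreover have "F t' \<in> tsub (Pd (- (m + n))) (Pd (m + n))"
  proof (rule tsub_image_subset[OF Fl])
    show "t' \<in> tsub (Pd (- n)) (Pd n)" using assms(2) by (simp add: lifts_def)
    fix a c assume ac: "a \<in> Pd (- n)" "c \<in> Pd n"
    have t: "t \<in> tsub (Pd (- m)) (Pd m)" using assms(1) by (simp add: lifts_def)
    have "(a \<otimes>\<^sub>t 1) * t * (1 \<otimes>\<^sub>t c) \<in> tsub (Pd (- (m + n))) (Pd (m + n))"
    proof (rule tsub_image_subset[where F = "\<lambda>t. (a \<otimes>\<^sub>t 1) * t * (1 \<otimes>\<^sub>t c)", OF _ t])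
      fix x y assume xy: "x \<in> Pd (- m)" "y \<in> Pd m"
      show "(a \<otimes>\<^sub>t 1) * (x \<otimes>\<^sub>t y) * (1 \<otimes>\<^sub>t c) \<in> tsub (Pd (- (m + n))) (Pd (m + n))"
      proof -
        have "- n + - m = - (m + n)" by simp
        then have "a * x \<in> Pd (- (m + n))" using Pd_mult[OF ac(1) xy(1)] by metis
        then show ?thesis
          using Pd_mult[OF xy(2) ac(2)] by (simp add: tensor_mult_pure tpure_in_tsub del: minus_add_distrib)
      qed
    qed (intro clin, rule csubspace_tsub)
    then show "F (a \<otimes>\<^sub>t c) \<in> tsub (Pd (- (m + n))) (Pd (m + n))" by (simp add: Fp)
  qed (rule csubspace_tsub)
  ultimately have "lifts (m + n) (z * z') (F t')"
    using assms by (simp add: lifts_def P_mult alg_homD[OF gamma_hom] alg_homD[OF ad(1)] tpow_add tensor_mult_pure)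
  then show ?thesis by blast
qed

lemma ex_lifts: "\<exists>z t. lifts n z t"
proof -
  have pos: "\<exists>z t. lifts (int k) z t" for k
  proof (induction k)
    case 0
    then show ?case using lifts_zero by auto
  next
    case (Suc k)
    then obtain z t where "lifts (int k) z t" by blast
    from lifts_mult[OF lifts_one this] show ?case by (auto simp: add.commute)
  qed
  have neg: "\<exists>z t. lifts (- int k) z t" for k
  proof (induction k)
    case 0
    then show ?case using lifts_zero by auto
  next
    case (Suc k)
    then obtain z t where "lifts (- int k) z t" by blast
    from lifts_mult[OF lifts_minus_one this] show ?case by (auto simp: add.commute)
  qed
  show ?thesis
    using pos[of "nat n"] neg[of "nat (- n)"] by (cases "n \<ge> 0") auto
qed

definition zt :: "int \<Rightarrow> 'g \<times> ('g, 'g) tensor" where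
  "zt n = (SOME p. lifts n (fst p) (snd p))"

lemma zt: "lifts n (fst (zt n)) (snd (zt n))"
proof -
  have "\<exists>p. lifts n (fst p) (snd p)" using ex_lifts[of n] by auto
  then show ?thesis unfolding zt_def by (rule someI_ex)
qed

text \<open>A linear section of \<open>\<gamma>\<close> with values in the torus-invariant elements
  of P. It is chosen separately in each degree, so no multiplicativity is claimed.\<close>

definition Z :: "laurent \<Rightarrow> 'g" where "Z = linext (\<lambda>n. fst (zt n))"
definition T :: "laurent \<Rightarrow> ('g, 'g) tensor" where "T = linext (\<lambda>n. snd (zt n))"

lemma Z_linear: "clinear Z" and T_linear: "clinear T"
  by (simp_all add: Z_def T_def clinear_linext)

lemma Z_tpow: "lifts n (Z (tpow n)) (T (tpow n))"
  using zt by (simp add: Z_def T_def)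

lemma V_T: "V (T h) = 1 \<otimes>\<^sub>t Z h"
  by (rule laurent_linear_eqI[OF clinear_compose[OF T_linear V_linear] clinear_tpure_right[OF Z_linear]])
    (use Z_tpow in \<open>simp add: lifts_def\<close>)

lemma Z_P: "Z h \<in> P"
  by (rule laurent_in_csubspace[OF Z_linear csubspace_P]) (use Z_tpow in \<open>simp add: lifts_def\<close>)

lemma gamma_Z: "\<gamma> (Z h) = h"
  by (rule laurent_linear_eqI[OF clinear_compose[OF Z_linear gamma_linear] clinear_ident])
    (use Z_tpow in \<open>simp add: lifts_def\<close>)

lemma ad_Z: "ad (Z h) = Z h \<otimes>\<^sub>t 1"
  by (rule laurent_linear_eqI[OF clinear_compose[OF Z_linear ad_linear] clinear_tpure_left[OF Z_linear]])
    (use Z_tpow in \<open>simp add: lifts_def\<close>)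

lemma T_P: "T h \<in> tsub P P"
  by (rule laurent_in_csubspace[OF T_linear csubspace_tsub])
    (use Z_tpow tsub_mono[OF Pd_subset Pd_subset] in \<open>auto simp: lifts_def\<close>)

lemma ver_T: "ver delta (T h) = 1 \<otimes>\<^sub>t h"
  by (simp add: ver_delta V_T tmap_tpure clinear_ident gamma_linear gamma_Z)

lemma ver_delta_mult_left: "ver delta ((p \<otimes>\<^sub>t 1) * x) = (p \<otimes>\<^sub>t 1) * ver delta x"
proof -
  have "alg_hom (tmap (\<lambda>x::'g. x) \<gamma>)" by (intro alg_hom_tmap alg_hom_ident gamma_hom)
  then show ?thesis
    by (simp add: ver_delta V_def ver_mult_left[OF hopf] alg_homD tmap_tpure clinear_ident gamma_linear alg_homD[OF gamma_hom])
qed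

lemma mult_T: "tlift (*) (T h) = \<epsilon> (Z h) *\<^sub>C 1"
  using rslice_counit_ver[OF hopf, of "T h"] by (simp add: V_def[symmetric] V_T rslice_tpure counit_linear)

lemma counit_Z: "\<epsilon> (Z h) = eps_U1 h"
  using counit_gamma[of "Z h"] by (simp add: gamma_Z)

section \<open>The Hopf-Galois property\<close>

lemma ver_delta_P:
  assumes "x \<in> tsub P P"
  shows "ver delta x \<in> tsub P UNIV"
proof (rule tsub_image_subset[OF clinear_ver[OF delta_linear] assms])
  fix a b assume "a \<in> P" "b \<in> P"
  have "(a \<otimes>\<^sub>t 1) * delta b \<in> tsub P UNIV"
    by (rule tsub_image_subset[where F = "\<lambda>x. (a \<otimes>\<^sub>t 1) * x", OF _ delta_P[OF \<open>b \<in> P\<close>]])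
      (intro clin, use \<open>a \<in> P\<close> in \<open>auto simp: tensor_mult_pure csubspace_tsub intro!: tpure_in_tsub P_mult\<close>)
  then show "ver delta (a \<otimes>\<^sub>t b) \<in> tsub P UNIV" by (simp add: ver_tpure delta_linear)
qed (rule csubspace_tsub)

text \<open>The inverse of the canonical map sends f tensor h to f T(h). One composite is the
  identity because T lifts h; the other has to be compared modulo the balancing relations, one
  degree at a time.\<close>

lemma hopf_galois_P: "hopf_galois P (qCP \<Delta> \<beta> \<gamma>) delta"
proof -
  define T' where "T' = tlift (\<lambda>f h. (f \<otimes>\<^sub>t 1) * T h)"
  have l1: "clinear (\<lambda>f. f \<otimes>\<^sub>t (1::'g))" by (intro clin)
  have T'l: "clinear T'" unfolding T'_def by (intro clinear_tprod l1 T_linear)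
  have T'p: "T' (f \<otimes>\<^sub>t h) = (f \<otimes>\<^sub>t 1) * T h" for f h unfolding T'_def by (intro tprod_tpure l1 T_linear)
  let ?B = "balancing P (Pd 0)"
  have B: "csubspace ?B" unfolding balancing_def by (rule complex_vector.subspace_span)
  have Bgen: "(p * m) \<otimes>\<^sub>t p' - p \<otimes>\<^sub>t (m * p') \<in> ?B" if "p \<in> P" "m \<in> Pd 0" "p' \<in> P" for p m p'
    unfolding balancing_def by (rule complex_vector.span_base) (use that in blast)
  note vl = clinear_ver[OF delta_linear]
  have "hopf_galois P (Pd 0) delta"
  proof (rule hopf_galoisI[where T = T', OF delta_linear])
    fix x assume x: "x \<in> ?B"
    have "ver delta x \<in> {0}"
    proof (rule cspan_image_subset[OF vl x[unfolded balancing_def]])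
      fix a assume "a \<in> {(p * m) \<otimes>\<^sub>t p' - p \<otimes>\<^sub>t (m * p') |p m p'. p \<in> P \<and> m \<in> Pd 0 \<and> p' \<in> P}"
      then obtain p m p' where a: "a = (p * m) \<otimes>\<^sub>t p' - p \<otimes>\<^sub>t (m * p')" "m \<in> Pd 0" by blast
      have "delta m = m \<otimes>\<^sub>t 1" using a(2) by (simp add: Pd_def tpow_zero)
      then show "ver delta a \<in> {0}"
        by (simp add: a(1) clinearD[OF vl] ver_tpure delta_linear alg_homD[OF delta_hom] mult_tpure_one)
    qed (simp add: complex_vector.subspace_def)
    then show "ver delta x = 0" by simp
  next
    show "ver delta x \<in> tsub P UNIV" if "x \<in> tsub P P" for x by (rule ver_delta_P[OF that])
    show "T' (y - z) = T' y - T' z" for y z by (rule clinearD[OF T'l])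
    show "T' y \<in> tsub P P" if "y \<in> tsub P UNIV" for y
    proof (rule tsub_image_subset[OF T'l that])
      fix a h assume a: "a \<in> P"
      have "(a \<otimes>\<^sub>t 1) * T h \<in> tsub P P"
        by (rule tsub_image_subset[where F = "\<lambda>x. (a \<otimes>\<^sub>t 1) * x", OF _ T_P[of h]])
          (intro clin, use a in \<open>auto simp: tensor_mult_pure csubspace_tsub intro!: tpure_in_tsub P_mult\<close>)
      then show "T' (a \<otimes>\<^sub>t h) \<in> tsub P P" by (simp add: T'p)
    qed (rule csubspace_tsub)
    show "ver delta (T' y) = y" for y
      by (rule clinear_tensor_eqI[OF clinear_compose[OF T'l vl] clinear_ident])
        (simp add: T'p ver_delta_mult_left ver_T tensor_mult_pure)
    fix x assume x: "x \<in> tsub P P"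
    define E where "E x = x - T' (ver delta x)" for x
    have El: "clinear E" unfolding E_def by (intro clin clinear_compose[OF vl T'l])
    \<comment> \<open>The first legs a of t have degree -n, so g a has degree 0 and may cross the
      balanced tensor sign. What remains is g times the product of the legs of t, and that product
      is 1.\<close>
    have hom: "E (p \<otimes>\<^sub>t g) \<in> ?B" if p: "p \<in> P" and g: "g \<in> Pd n" for p g n
    proof -
      define t where "t = T (tpow n)"
      have t: "t \<in> tsub (Pd (- n)) (Pd n)" using Z_tpow[of n] by (simp add: t_def lifts_def)
      have m1: "tlift (*) t = 1"
        by (simp add: t_def mult_T counit_Z eps_U1_tpow)
      note ml = clinear_tprod[OF clinear_ident clinear_ident] and mp = tprod_tpure[OF clinear_ident clinear_ident]
      have "p \<otimes>\<^sub>t (g * tlift (*) t) - ((p * g) \<otimes>\<^sub>t 1) * t \<in> ?B"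
      proof (rule tsub_image_subset[where F = "\<lambda>t. p \<otimes>\<^sub>t (g * tlift (*) t) - ((p * g) \<otimes>\<^sub>t 1) * t", OF _ t])
        show "clinear (\<lambda>t. p \<otimes>\<^sub>t (g * tlift (*) t) - ((p * g) \<otimes>\<^sub>t 1) * t)" by (intro clin ml)
        fix a b assume ab: "a \<in> Pd (- n)" "b \<in> Pd n"
        have "g * a \<in> Pd 0" using Pd_mult[OF g ab(1)] by simp
        then have "- ((p * (g * a)) \<otimes>\<^sub>t b - p \<otimes>\<^sub>t (g * a * b)) \<in> ?B"
          using Bgen[OF p, of "g * a" b] ab(2) Pd_subset by (intro complex_vector.subspace_neg[OF B]) blast
        then show "p \<otimes>\<^sub>t (g * tlift (*) (a \<otimes>\<^sub>t b)) - ((p * g) \<otimes>\<^sub>t 1) * (a \<otimes>\<^sub>t b) \<in> ?B"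
          by (simp add: mp tensor_mult_pure mult.assoc)
      qed (rule B)
      moreover have "T' (ver delta (p \<otimes>\<^sub>t g)) = ((p * g) \<otimes>\<^sub>t 1) * t"
        using g by (simp add: ver_tpure delta_linear Pd_def tensor_mult_pure T'p t_def)
      ultimately show ?thesis by (simp add: E_def m1)
    qed
    have "E x \<in> ?B"
    proof (rule tsub_image_subset[OF El x])
      fix p g assume pg: "p \<in> P" "g \<in> P"
      have "g \<in> cspan (\<Union>n. Pd n)" using pg(2) P_span_Pd by blast
      then show "E (p \<otimes>\<^sub>t g) \<in> ?B"
        by (rule cspan_image_subset[where F = "\<lambda>g. E (p \<otimes>\<^sub>t g)", rotated])
          (use hom pg(1) in \<open>auto intro: clinear_compose[OF clinear_tpure_right[OF clinear_ident] El] B\<close>)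
    qed (rule B)
    then show "x - T' (ver delta x) \<in> ?B" by (simp add: E_def)
  qed
  then show ?thesis by (simp add: Pd_zero)
qed

section \<open>Covariance of the calculus under the torus\<close>

lemma codiag_ad_Delta: "codiag delta ad (\<Delta> g) = tmap \<Delta> (\<lambda>x. x) (delta g)"
proof (rule quantum_SU_hom_eqI[OF G])
  show "alg_hom (\<lambda>g. codiag delta ad (\<Delta> g))"
    by (intro alg_hom_compose[OF Delta_hom] alg_hom_codiag delta_hom ad)
  show "alg_hom (\<lambda>g. tmap \<Delta> (\<lambda>x. x) (delta g))"
    by (intro alg_hom_compose[OF delta_hom] alg_hom_tmap Delta_hom alg_hom_ident)
  fix i j assume ij: "i \<in> {1..N}" "j \<in> {1..N}"
  have "codiag delta ad (u i k \<otimes>\<^sub>t u k j) = (u i k \<otimes>\<^sub>t u k j) \<otimes>\<^sub>t tpow (w j)" if "k \<in> {1..N}" for k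
    using codiag_tpure_homogeneous[OF delta_linear ad_linear delta_u[OF ij(1) that] ad(2)[OF that ij(2)]]
    by (simp add: tpow_add[symmetric])
  then show "codiag delta ad (\<Delta> (u i j)) = tmap \<Delta> (\<lambda>x. x) (delta (u i j))"
    by (simp add: Delta_u delta_u ij tmap_tpure Delta_linear clinear_ident tpure_sum_left
        clinearD[OF clinear_codiag[OF delta_linear ad_linear]])
qed

text \<open>The canonical map turns the diagonal coaction into \<open>delta\<close> on the first leg
  and \<open>ad\<close> on the second, which reduces covariance of the sub-bimodule to stability of
  the ideal under \<open>ad\<close>.\<close>

lemma V_codiag: "tmap V (\<lambda>x. x) (codiag delta delta x) = codiag delta ad (V x)"
proof -
  note tl = clinear_tmap[OF V_linear clinear_ident[where 'a = laurent]]
  have 1: "tmap V (\<lambda>x. x) (tmap (\<lambda>a. a \<otimes>\<^sub>t 1) (\<lambda>x. x) X * Y) = tmap (\<lambda>a. a \<otimes>\<^sub>t 1) (\<lambda>x. x) X * tmap V (\<lambda>x. x) Y"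
    for X :: "('g, laurent) tensor" and Y
  proof (induction X rule: tensor_induct)
    case X: (pure a h)
    show ?case
    proof (induction Y rule: tensor_induct)
      case (pure y k)
      show ?case
        by (simp add: tmap_leg_tpure tensor_mult_pure tmap_tpure V_linear clinear_ident ver_mult_left[OF hopf, folded V_def])
    qed (simp add: distrib_left clinearD[OF tl])
  qed (simp add: clinearD[OF clinear_tmap_leg(1)] distrib_right clinearD[OF tl])
  have 2: "tmap V (\<lambda>x. x) (tmap (\<lambda>b. 1 \<otimes>\<^sub>t b) (\<lambda>x. x) X) = tmap \<Delta> (\<lambda>x. x) X" for X :: "('g, laurent) tensor"
    by (induction X rule: tensor_induct)
      (simp_all add: tmap_leg_tpure tmap_tpure V_linear clinear_ident Delta_linear V_tpure one_tensor_def[symmetric]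
        clinearD[OF tl] clinearD[OF clinear_tmap_leg(2)] clinearD[OF clinear_tmap[OF Delta_linear clinear_ident]])
  note c = alg_hom_codiag[OF delta_hom ad(1)]
  show ?thesis
  proof (rule clinear_tensor_eqI[OF clinear_compose[OF clinear_codiag[OF delta_linear delta_linear] tl]
        clinear_compose[OF V_linear alg_homD(1)[OF c]]])
    fix f g
    have "codiag delta ad (f \<otimes>\<^sub>t 1) = tmap (\<lambda>a. a \<otimes>\<^sub>t 1) (\<lambda>x. x) (delta f)"
      by (simp add: codiag_tpure delta_linear ad_linear alg_homD[OF ad(1)] tmap_leg_one)
    then show "tmap V (\<lambda>x. x) (codiag delta delta (f \<otimes>\<^sub>t g)) = codiag delta ad (V (f \<otimes>\<^sub>t g))"
      by (simp add: V_tpure alg_homD(3)[OF c] codiag_ad_Delta codiag_tpure delta_linear 1 2)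
  qed
qed

lemma mult_codiag: "tmap (tlift (*)) (\<lambda>x. x) (codiag delta delta x) = delta (tlift (*) x)"
proof -
  note ml = mult_linear and mp = mult_tpure
  note tl = clinear_tmap[OF ml clinear_ident[where 'a = laurent]]
  have 1: "tmap (tlift (*)) (\<lambda>x. x) (tmap (\<lambda>a. a \<otimes>\<^sub>t 1) (\<lambda>x. x) X * tmap (\<lambda>b. 1 \<otimes>\<^sub>t b) (\<lambda>x. x) Y) = X * Y"
    for X Y :: "('g, laurent) tensor"
  proof (induction X rule: tensor_induct)
    case X: (pure a h)
    show ?case
    proof (induction Y rule: tensor_induct)
      case (pure y k)
      show ?case
        by (simp add: tmap_leg_tpure tensor_mult_pure tmap_tpure ml clinear_ident mp)
    qed (simp add: distrib_left clinearD[OF tl] clinearD[OF clinear_tmap_leg(2)])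
  qed (simp add: clinearD[OF clinear_tmap_leg(1)] distrib_right clinearD[OF tl])
  show ?thesis
    by (rule clinear_tensor_eqI[OF clinear_compose[OF clinear_codiag[OF delta_linear delta_linear] tl]
        clinear_compose[OF ml delta_linear]])
      (simp add: codiag_tpure delta_linear 1 mp alg_homD[OF delta_hom])
qed

text \<open>The entries of Q are homogeneous and the counit is invariant, so each of the vanishing
  conditions passes to every slice of \<open>ad b\<close>.\<close>

lemma ad_Iq:
  assumes "b \<in> Iq"
  shows "ad b \<in> tsub Iq UNIV"
  unfolding tsub_UNIV_right_iff[OF csubspace_Iq]
proof (intro allI impI)
  fix \<phi> :: "laurent \<Rightarrow> complex" assume \<phi>: "clinear \<phi>"
  have "Q k l (rslice \<phi> (ad b)) = 0" if "k \<in> {1..N}" "l \<in> {1..N}" "Q k l b = 0" for k l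
    using that by (simp add: slice_commute[OF Q_linear \<phi>] Q_torus_weight[OF ad] clinearD[OF \<phi>])
  moreover have "\<epsilon> (rslice \<phi> (ad b)) = 0"
    using assms by (simp add: slice_commute[OF counit_linear \<phi>] ad_counit Iq_def clinearD[OF \<phi>])
  ultimately show "rslice \<phi> (ad b) \<in> Iq"
    using assms one_index by (simp add: Iq_def)
qed

abbreviation N_G :: "('g, 'g) tensor set" where
  "N_G \<equiv> N_SU N u \<Delta> \<epsilon> S r"

lemma N_G_iff: "x \<in> N_G \<longleftrightarrow> V x \<in> tsub UNIV Iq"
  by (simp add: N_SU_def I_SU_eq_Iq s_map_image_iff[OF hopf] V_def)

lemma csubspace_N_G: "csubspace N_G"
  using csubspace_tsub[of UNIV Iq]
  by (auto simp: complex_vector.subspace_def N_G_iff clinearD[OF V_linear])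

lemma N_G_diag:
  assumes "x \<in> N_G"
  shows "codiag delta delta x \<in> tsub N_G UNIV"
  unfolding tsub_UNIV_right_iff[OF csubspace_N_G]
proof (intro allI impI)
  fix \<phi> :: "laurent \<Rightarrow> complex" assume \<phi>: "clinear \<phi>"
  have "codiag delta ad (V x) \<in> tsub (tsub UNIV Iq) UNIV"
  proof (rule tsub_image_subset[OF clinear_codiag[OF delta_linear ad_linear]])
    show "V x \<in> tsub UNIV Iq" using assms by (simp add: N_G_iff)
    fix a b assume "b \<in> Iq"
    have "tmap (\<lambda>a. a \<otimes>\<^sub>t 1) (\<lambda>x. x) X * tmap (\<lambda>b. 1 \<otimes>\<^sub>t b) (\<lambda>x. x) (ad b) \<in> tsub (tsub UNIV Iq) UNIV"
      for X :: "('g, laurent) tensor"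
    proof (rule tsub_image_subset[where F = "\<lambda>Y. tmap (\<lambda>a. a \<otimes>\<^sub>t 1) (\<lambda>x. x) X * tmap (\<lambda>b. 1 \<otimes>\<^sub>t b) (\<lambda>x. x) Y",
          OF _ ad_Iq[OF \<open>b \<in> Iq\<close>]])
      fix b h assume "b \<in> Iq"
      then show "tmap (\<lambda>a. a \<otimes>\<^sub>t 1) (\<lambda>x. x) X * tmap (\<lambda>b. 1 \<otimes>\<^sub>t b) (\<lambda>x. x) (b \<otimes>\<^sub>t h) \<in> tsub (tsub UNIV Iq) UNIV"
        by (induction X rule: tensor_induct)
          (simp_all add: tmap_leg_tpure tensor_mult_pure tpure_in_tsub clinearD[OF clinear_tmap_leg(1)]
            distrib_right complex_vector.subspace_add[OF csubspace_tsub])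
    qed (intro clin clinear_tmap_leg, rule csubspace_tsub)
    then show "codiag delta ad (a \<otimes>\<^sub>t b) \<in> tsub (tsub UNIV Iq) UNIV"
      by (simp add: codiag_tpure delta_linear ad_linear)
  qed (rule csubspace_tsub)
  then have "rslice \<phi> (codiag delta ad (V x)) \<in> tsub UNIV Iq"
    using tsub_UNIV_right_iff[OF csubspace_tsub] \<phi> by blast
  then show "rslice \<phi> (codiag delta delta x) \<in> N_G"
    by (simp add: N_G_iff rslice_tmap[OF V_linear \<phi>, symmetric] V_codiag)
qed

lemma P_diag:
  assumes "x \<in> tsub P P"
  shows "codiag delta delta x \<in> tsub (tsub P P) UNIV"
proof (rule tsub_image_subset[OF clinear_codiag[OF delta_linear delta_linear] assms])
  fix a b assume ab: "a \<in> P" "b \<in> P"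
  have "tmap (\<lambda>a. a \<otimes>\<^sub>t 1) (\<lambda>x. x) X * tmap (\<lambda>b. 1 \<otimes>\<^sub>t b) (\<lambda>x. x) (delta b) \<in> tsub (tsub P P) UNIV"
    if X: "X \<in> tsub P UNIV" for X :: "('g, laurent) tensor"
  proof (rule tsub_image_subset[where F = "\<lambda>Y. tmap (\<lambda>a. a \<otimes>\<^sub>t 1) (\<lambda>x. x) X * tmap (\<lambda>b. 1 \<otimes>\<^sub>t b) (\<lambda>x. x) Y",
        OF _ delta_P[OF ab(2)]])
    fix b' :: 'g and k :: laurent assume b': "b' \<in> P"
    show "tmap (\<lambda>a. a \<otimes>\<^sub>t 1) (\<lambda>x. x) X * tmap (\<lambda>b. 1 \<otimes>\<^sub>t b) (\<lambda>x. x) (b' \<otimes>\<^sub>t k) \<in> tsub (tsub P P) UNIV"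
      by (rule tsub_image_subset[where F = "\<lambda>X. tmap (\<lambda>a. a \<otimes>\<^sub>t 1) (\<lambda>x. x) X * tmap (\<lambda>b. 1 \<otimes>\<^sub>t b) (\<lambda>x. x) (b' \<otimes>\<^sub>t k)",
            OF _ X])
        (intro clin clinear_tmap_leg, use b' in \<open>simp_all add: tmap_leg_tpure tensor_mult_pure tpure_in_tsub csubspace_tsub\<close>)
  qed (intro clin clinear_tmap_leg, rule csubspace_tsub)
  then show "codiag delta delta (a \<otimes>\<^sub>t b) \<in> tsub (tsub P P) UNIV"
    using delta_P[OF ab(1)] by (simp add: codiag_tpure delta_linear)
qed (rule csubspace_tsub)

section \<open>The calculus restricted to the sphere and its character \<open>Q 1 1\<close>\<close>

abbreviation N_P :: "('g, 'g) tensor set" where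
  "N_P \<equiv> N_G \<inter> Omega_u P"

lemma csubspace_N_P: "csubspace N_P"
proof -
  have "csubspace (Omega_u P)"
    using csubspace_tsub[of P P] by (auto simp: Omega_u_def complex_vector.subspace_def clinearD[OF mult_linear])
  then show ?thesis using csubspace_N_G by (rule complex_vector.subspace_inter[rotated])
qed

text \<open>The canonical map is left linear and turns right multiplication by p into right
  multiplication by the coproduct of p, so closure on the right is the right ideal property of
  \<open>Iq\<close>.\<close>

lemma sub_bimodule_N_P: "sub_bimodule P N_P"
  unfolding sub_bimodule_def
proof (intro conjI ballI csubspace_N_P)
  fix p x assume p: "p \<in> P" and x: "x \<in> N_P"
  have xP: "x \<in> tsub P P" "tlift (*) x = 0" "V x \<in> tsub UNIV Iq"
    using x by (auto simp: Omega_u_def N_G_iff)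
  have "(p \<otimes>\<^sub>t 1) * x \<in> tsub P P"
    by (rule tsub_image_subset[where F = "\<lambda>x. (p \<otimes>\<^sub>t 1) * x", OF _ xP(1)])
      (intro clin, use p in \<open>auto simp: tensor_mult_pure csubspace_tsub intro!: tpure_in_tsub P_mult\<close>)
  then show "(p \<otimes>\<^sub>t 1) * x \<in> N_P"
    using xP by (simp add: Omega_u_def N_G_iff mult_left_right V_def ver_mult_left[OF hopf] tsub_mult_left)
  have "x * (1 \<otimes>\<^sub>t p) \<in> tsub P P"
    by (rule tsub_image_subset[where F = "\<lambda>x. x * (1 \<otimes>\<^sub>t p)", OF _ xP(1)])
      (intro clin, use p in \<open>auto simp: tensor_mult_pure csubspace_tsub intro!: tpure_in_tsub P_mult\<close>)
  then show "x * (1 \<otimes>\<^sub>t p) \<in> N_P"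
    using xP by (simp add: Omega_u_def N_G_iff mult_left_right V_def ver_mult_right[OF hopf]
        tsub_mult_right right_ideal_Iq)
qed auto

lemma diag_N_P:
  assumes "x \<in> N_P"
  shows "diag_coaction delta x \<in> tsub N_P UNIV"
  unfolding tsub_UNIV_right_iff[OF csubspace_N_P] diag_coaction_eq_codiag[OF delta_linear]
proof (intro allI impI)
  fix \<phi> :: "laurent \<Rightarrow> complex" assume \<phi>: "clinear \<phi>"
  have x: "x \<in> N_G" "x \<in> tsub P P" "tlift (*) x = 0" using assms by (auto simp: Omega_u_def)
  have "rslice \<phi> (codiag delta delta x) \<in> N_G"
    using N_G_diag[OF x(1)] \<phi> tsub_UNIV_right_iff[OF csubspace_N_G] by blast
  moreover have "rslice \<phi> (codiag delta delta x) \<in> tsub P P"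
    using P_diag[OF x(2)] \<phi> tsub_UNIV_right_iff[OF csubspace_tsub] by blast
  moreover have "tlift (*) (rslice \<phi> (codiag delta delta x)) = 0"
    by (simp add: rslice_tmap[OF mult_linear \<phi>, symmetric] mult_codiag x(3) clinearD[OF delta_linear]
        clinearD[OF clinear_rslice[OF \<phi>]])
  ultimately show "rslice \<phi> (codiag delta delta x) \<in> N_P" by (simp add: Omega_u_def)
qed

text \<open>On the torus the character \<open>Q\<^sub>1\<^sub>1\<close> is \<open>c diag(q\<^sup>2, 1, \<dots>, 1)\<close> with \<open>c = qroot\<^sup>-\<^sup>2\<close>.  It factors as the
  point \<open>z0\<close> of the circle times the character \<open>diag(c, \<dots>, c, c\<^sup>2\<^sup>-\<^sup>N)\<close> of the smaller quantum group, which
  the sphere does not see.\<close>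

definition z0 :: complex where
  "z0 = ((inverse qroot)\<^sup>2) powi (int N - 1)"

lemma Q11_P:
  assumes "p \<in> P"
  shows "Q 1 1 p = laurent_eval z0 (\<gamma> p)"
proof -
  define c where "c = (inverse qroot)\<^sup>2"
  have c: "c \<noteq> 0" using qroot_nonzero by (simp add: c_def)
  have z0: "z0 = c powi (int N - 1)" by (simp add: z0_def c_def)
  then have z0_nonzero: "z0 \<noteq> 0" using c by simp
  \<comment> \<open>The last exponent 2 - N makes the N - 1 exponents add up to zero, as the
    determinant relation of the smaller quantum group requires.\<close>
  define b where "b j = (if j = N - 1 then 2 - int N else 1)" for j
  have "sum b {1..N - 1} = sum b (insert (N - 1) ({1..N - 1} - {N - 1}))"
    using N by (intro arg_cong[of _ _ "sum b"]) (auto simp: atLeastAtMost_iff)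
  also have "\<dots> = 2 - int N + sum b ({1..N - 1} - {N - 1})"
    by (subst sum.insert) (auto simp: b_def)
  also have "sum b ({1..N - 1} - {N - 1}) = (\<Sum>j\<in>{1..N - 1} - {N - 1}. 1)"
    by (intro sum.cong refl) (auto simp: b_def)
  also have "\<dots> = int N - 2"
    using N by (simp add: card_Diff_singleton atLeastAtMost_iff of_nat_diff)
  finally have "sum (\<lambda>i. 0) {1..N - 1} = sum b {1..N - 1}" by simp
  then obtain F where F: "alg_hom F"
    "\<And>i j. i \<in> {1..N - 1} \<Longrightarrow> j \<in> {1..N - 1} \<Longrightarrow> F (v i j) = v i j \<otimes>\<^sub>t tpow (b j - 0)"
    by (rule quantum_SU_torus[OF K]) blast
  have K_hopf: "hopf_algebra \<Delta>' \<epsilon>' S'" using K by (simp add: quantum_SU_def)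
  note e' = hopf_algebraD(2)[OF K_hopf]
  have ev: "alg_hom (laurent_eval z)" if "z \<noteq> 0" for z using that by (rule alg_hom_laurent_eval)
  define \<psi> where "\<psi> k = tlift (\<lambda>x h. \<epsilon>' x * laurent_eval c h) (F k)" for k
  have \<psi>: "alg_hom \<psi>" unfolding \<psi>_def
    by (intro alg_hom_compose[OF F(1)] alg_hom_tprod e' ev c) (simp add: mult.commute)
  have \<psi>_v: "\<psi> (v i j) = of_bool (i = j) * c powi b j" if "i \<in> {1..N - 1}" "j \<in> {1..N - 1}" for i j
    using that quantum_SU_corep[OF K]
    by (simp add: \<psi>_def F(2) tprod_tpure alg_homD(1)[OF e'] alg_homD(1)[OF ev[OF c]] corep_def)
  \<comment> \<open>The convolution product of evaluation at \<open>z0\<close> on the circle with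
    the character \<open>\<psi>\<close> of the smaller quantum group; comparison on generators
    identifies it with \<open>Q 1 1\<close>.\<close>
  define \<Psi> where "\<Psi> g = tlift (\<lambda>a k. laurent_eval z0 (\<gamma> a) * \<psi> k) (coK g)" for g
  note evg = alg_hom_compose[OF gamma_hom ev[OF z0_nonzero]]
  note \<Psi>l = alg_homD(1)[OF evg] alg_homD(1)[OF \<psi>]
  have \<Psi>: "alg_hom \<Psi>" unfolding \<Psi>_def
    by (intro alg_hom_compose[OF coK_hom] alg_hom_tprod evg \<psi>) (simp add: mult.commute)
  \<comment> \<open>This matches the first diagonal entry c q^2, where the circle weight is -1. It
    is the relation c^N q^2 = 1, which comes from \<open>qroot ^ N = q\<close>.\<close>
  have z0_inv: "inverse z0 = c * (complex_of_real q)\<^sup>2"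
  proof -
    have "c ^ N * (complex_of_real q)\<^sup>2 = 1"
      using qroot_nonzero
      by (simp add: c_def qroot[symmetric] power_mult_distrib[symmetric] power_mult[symmetric]
          power_inverse mult.commute)
    moreover have "z0 * c = c ^ N"
      using c power_int_add_1[of c "int N - 1"] by (simp add: z0)
    ultimately have "z0 * (c * (complex_of_real q)\<^sup>2) = 1" by (simp add: mult.assoc[symmetric])
    then show ?thesis using z0_nonzero by (simp add: field_simps)
  qed
  \<comment> \<open>This matches the last diagonal entry, where the circle weight is 1; it dictates
    the exponent N - 1 in \<open>z0\<close>.\<close>
  have z0_c: "z0 * c powi (2 - int N) = c"
    using c by (simp add: z0 power_int_add[symmetric])
  have "Q 1 1 g = \<Psi> g" for g
  proof (rule quantum_SU_hom_eqI[OF G Q11_hom \<Psi>])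
    fix i j assume ij: "i \<in> {1..N}" "j \<in> {1..N}"
    have "\<Psi> (u i j) = (\<Sum>k=1..N. laurent_eval z0 (\<gamma> (u i k)) * \<psi> (\<beta> (u k j)))"
      by (simp add: \<Psi>_def coK_u ij clinearD[OF clinear_tprod[OF \<Psi>l]] tprod_tpure[OF \<Psi>l])
    also have "\<dots> = (\<Sum>k=1..N. of_bool (i = k) * (z0 powi w i * \<psi> (\<beta> (u k j))))"
      by (intro sum.cong refl) (use ij in \<open>auto simp: gamma_u alg_homD[OF ev[OF z0_nonzero]]\<close>)
    also have "\<dots> = z0 powi w i * \<psi> (\<beta> (u i j))" using ij by simp
    also have "\<dots> = c * (if i = 1 then (complex_of_real q)\<^sup>2 else 1) * of_bool (i = j)"
      using ij(1)
    proof (cases rule: index_cases)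
      case 1
      then show ?thesis
        using ij(2) z0_inv by (auto simp: beta_first_row w_one alg_homD[OF \<psi>] alg_hom_of_bool[OF \<psi>] power_int_minus)
    next
      case i: 2
      then have i1: "i \<noteq> 1" by (auto simp: atLeastAtMost_iff)
      show ?thesis
        using ij(2)
      proof (cases rule: index_cases)
        case 1
        then show ?thesis using ij(1) i1 by (simp add: beta_first_column alg_homD[OF \<psi>])
      next
        case j: 2
        have "i - 1 = j - 1 \<longleftrightarrow> i = j" using i(3) j(3) by auto
        moreover have "z0 powi w i * c powi b (i - 1) = c"
          using z0_c i1 i(3) N by (auto simp: w_def b_def)
        ultimately show ?thesis
          using i j i1 by (auto simp: beta_block \<psi>_v)
      qed
    qed
    finally show "Q 1 1 (u i j) = \<Psi> (u i j)"
      by (simp add: Q11_u[OF ij] c_def)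
  qed
  \<comment> \<open>On the sphere the coaction has second leg 1, so \<open>\<psi>\<close>
    contributes only the factor 1.\<close>
  moreover have "\<Psi> p = laurent_eval z0 (\<gamma> p)"
    using assms by (simp add: \<Psi>_def P_iff tprod_tpure[OF \<Psi>l] alg_homD[OF \<psi>])
  ultimately show ?thesis by simp
qed

section \<open>The induced ideal on the circle and the vertical part of the calculus\<close>

abbreviation I_H :: "laurent set" where
  "I_H \<equiv> \<gamma> ` (Iq \<inter> P)"

lemma csubspace_I_H: "csubspace I_H"
  by (intro csubspace_image gamma_linear complex_vector.subspace_inter csubspace_Iq csubspace_P)

text \<open>The counit and \<open>Q 1 1\<close> agree on \<open>Z f\<close> and on any preimage b of
  f in P, because on P both are determined by \<open>\<gamma>\<close>. The remaining entries of the
  first row and column have nonzero weight and vanish since \<open>Z f\<close> is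
  torus-invariant.\<close>

lemma Z_Iq:
  assumes "f \<in> I_H"
  shows "Z f \<in> Iq"
proof -
  obtain b where b: "b \<in> Iq" "b \<in> P" "f = \<gamma> b" using assms by blast
  have "\<epsilon> (Z f) = 0"
    using b by (simp add: counit_Z counit_gamma Iq_def)
  have *: "Q k l (Z f) = 0" if kl: "k \<in> {1..N}" "l \<in> {1..N}" "w k \<noteq> w l" for k l
  proof -
    have "Q k l (Z f) *\<^sub>C tpow (w k - w l) = Q k l (Z f) *\<^sub>C 1"
      using Q_torus_weight[OF ad kl(1,2), of "Z f"] by (simp add: ad_Z lslice_tpure Q_linear)
    then have "Q k l (Z f) *\<^sub>C (tpow (w k - w l) - 1) = 0"
      by (simp add: complex_vector.scale_right_diff_distrib)
    then show ?thesis using kl(3) tpow_eq_one_iff[of "w k - w l"] by (simp add: complex_vector.scale_eq_0_iff)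
  qed
  have "Q 1 k (Z f) = 0 \<and> Q k 1 (Z f) = 0" if k: "k \<in> {1..N}" for k
  proof (cases "k = 1")
    case True
    then show ?thesis
      using b one_index Q11_P[OF b(2)] by (simp add: Q11_P[OF Z_P] gamma_Z Iq_def)
  next
    case False
    then have "w 1 \<noteq> w k" by (simp add: w_def)
    then show ?thesis using *[OF one_index k] *[OF k one_index] by simp
  qed
  with \<open>\<epsilon> (Z f) = 0\<close> show ?thesis by (simp add: Iq_def)
qed

text \<open>Any h lifts to \<open>Z h\<close> in P, and b Z(h) stays in both the right ideal and the
  subalgebra.\<close>

lemma right_ideal_I_H: "right_ideal I_H"
  unfolding right_ideal_def
proof (intro conjI ballI allI csubspace_I_H)
  fix x h assume "x \<in> I_H"
  then obtain b where b: "b \<in> Iq" "b \<in> P" "x = \<gamma> b" by blast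
  have "x * h = \<gamma> (b * Z h)" by (simp add: b(3) alg_homD[OF gamma_hom] gamma_Z)
  moreover have "b * Z h \<in> Iq \<inter> P"
    using b right_ideal_Iq by (simp add: right_ideal_def P_mult Z_P)
  ultimately show "x * h \<in> I_H" by blast
qed

lemma V_P:
  assumes "x \<in> tsub P P"
  shows "V x \<in> tsub UNIV P"
  by (rule tsub_image_subset[OF V_linear assms]) (simp_all add: V_tpure tsub_mult_left Delta_P csubspace_tsub)

text \<open>For one inclusion, the second leg of V(x) lies in the ideal and in P, hence in their
  intersection, while the first leg of the vertical part lies in P; \<open>tsub_Int\<close> combines
  the two constraints. For the other, a T(f) lies in the calculus and has vertical part a tensor
  f.\<close>

lemma ver_N_P: "ver delta ` N_P = tsub P I_H"
proof (intro equalityI subsetI)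
  fix y assume "y \<in> ver delta ` N_P"
  then obtain x where x: "x \<in> N_G" "x \<in> tsub P P" "y = ver delta x" by (auto simp: Omega_u_def)
  note sub = complex_vector.subspace_inter[OF csubspace_Iq csubspace_P]
  have "V x \<in> tsub UNIV (Iq \<inter> P)"
    using x(1) V_P[OF x(2)]
    by (simp add: N_G_iff tsub_UNIV_left_iff[OF sub] tsub_UNIV_left_iff[OF csubspace_Iq] tsub_UNIV_left_iff[OF csubspace_P])
  then have "tmap (\<lambda>x. x) \<gamma> (V x) \<in> tsub UNIV I_H"
  proof (rule tsub_image_subset[OF clinear_tmap[OF clinear_ident gamma_linear]])
    fix a b assume "b \<in> Iq \<inter> P"
    then have "\<gamma> b \<in> I_H" by (rule imageI)
    then show "tmap (\<lambda>x. x) \<gamma> (a \<otimes>\<^sub>t b) \<in> tsub UNIV I_H"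
      by (simp only: tmap_tpure[OF clinear_ident gamma_linear] tpure_in_tsub UNIV_I)
  qed (rule csubspace_tsub)
  then show "y \<in> tsub P I_H"
    using ver_delta_P[OF x(2)] by (simp add: x(3) ver_delta tsub_Int[OF csubspace_P])
next
  fix y assume y: "y \<in> tsub P I_H"
  have "csubspace (ver delta ` N_P)"
    by (rule csubspace_image[OF clinear_ver[OF delta_linear] csubspace_N_P])
  moreover have "a \<otimes>\<^sub>t f \<in> ver delta ` N_P" if a: "a \<in> P" and f: "f \<in> I_H" for a f
  proof -
    have "T f \<in> N_P"
      using Z_Iq[OF f] T_P[of f]
      by (simp add: N_G_iff V_T tpure_in_tsub Omega_u_def mult_T Iq_def)
    then have "(a \<otimes>\<^sub>t 1) * T f \<in> N_P" using sub_bimodule_N_P a by (simp add: sub_bimodule_def)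
    moreover have "ver delta ((a \<otimes>\<^sub>t 1) * T f) = a \<otimes>\<^sub>t f"
      by (simp add: ver_delta_mult_left ver_T tensor_mult_pure)
    ultimately show ?thesis by (metis imageI)
  qed
  ultimately show "y \<in> ver delta ` N_P"
    using tsub_image_subset[OF clinear_ident y] by blast
qed

theorem quantum_principal_bundle_P:
  "quantum_principal_bundle P (qCP \<Delta> \<beta> \<gamma>) (tmap id \<gamma> \<circ> \<Delta>) Delta_U1 eps_U1 antipode_U1
     N_P (\<gamma> ` (I_SU N u \<Delta> \<epsilon> S r \<inter> P))"
  unfolding quantum_principal_bundle_def delta_eq I_SU_eq_Iq
proof (intro conjI)
  show "\<forall>x\<in>N_P. diag_coaction delta x \<in> tsub N_P UNIV" by (blast intro: diag_N_P)
  show "I_H \<subseteq> {h. eps_U1 h = 0}" by (auto simp: counit_gamma Iq_def)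
  show "\<forall>h\<in>I_H. Ad_R Delta_U1 antipode_U1 h \<in> tsub I_H UNIV"
    by (simp only: Ad_R_U1) (blast intro: tpure_in_tsub)
  show "qCP \<Delta> \<beta> \<gamma> = coinv P delta" by (simp add: qCP_def delta_eq)
qed (rule hopf_algebra_U1 comodule_algebra_P hopf_galois_P sub_bimodule_N_P right_ideal_I_H ver_N_P)+

end

theorem proposition5p6:
  fixes N :: nat and q :: real and qroot :: complex
    and u :: "nat \<Rightarrow> nat \<Rightarrow> 'g::complex_algebra_1"
    and \<Delta> :: "'g \<Rightarrow> ('g, 'g) tensor" and \<epsilon> :: "'g \<Rightarrow> complex" and S :: "'g \<Rightarrow> 'g"
    and r :: "('g, 'g) tensor \<Rightarrow> complex"
    and v :: "nat \<Rightarrow> nat \<Rightarrow> 'k::complex_algebra_1"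
    and \<Delta>' :: "'k \<Rightarrow> ('k, 'k) tensor" and \<epsilon>' :: "'k \<Rightarrow> complex" and S' :: "'k \<Rightarrow> 'k"
    and \<beta> :: "'g \<Rightarrow> 'k" and \<gamma> :: "'g \<Rightarrow> laurent"
  assumes "2 \<le> N" and "0 < q" and "q \<le> 1" and "qroot ^ N = complex_of_real q"
    and "quantum_SU N q u \<Delta> \<epsilon> S"
    and "coquasitriangular \<Delta> \<epsilon> r"
    and "\<forall>i\<in>{1..N}. \<forall>j\<in>{1..N}. \<forall>k\<in>{1..N}. \<forall>l\<in>{1..N}.
           r (u i j \<otimes>\<^sub>t u k l) = inverse qroot * Rmat q k i j l"
    and "quantum_SU (N - 1) q v \<Delta>' \<epsilon>' S'"
    and "beta_map N u \<Delta> \<epsilon> v \<Delta>' \<epsilon>' \<beta>"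
    and "gamma_map N u \<Delta> \<epsilon> \<gamma>"
  shows "quantum_principal_bundle (qsphere \<Delta> \<beta>) (qCP \<Delta> \<beta> \<gamma>) (tmap id \<gamma> \<circ> \<Delta>)
           Delta_U1 eps_U1 antipode_U1
           (N_SU N u \<Delta> \<epsilon> S r \<inter> Omega_u (qsphere \<Delta> \<beta>))
           (\<gamma> ` (I_SU N u \<Delta> \<epsilon> S r \<inter> qsphere \<Delta> \<beta>))"
proof -
  interpret quantum_sphere N q qroot u \<Delta> \<epsilon> S r v \<Delta>' \<epsilon>' S' \<beta> \<gamma>
    by unfold_locales (use assms in auto)
  show ?thesis by (rule quantum_principal_bundle_P)
qed

end
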